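(* Let $K=\mathcal{M}(\mathbf{C})$ or $K=\mathbf{C}(\{z\})$, let $P\in\mathcal{D}_{q,K}$ be non-zero, and let $\mu$ be the last (i.e. the largest) slope of $P$; assume $\mu\in\mathbf{Z}$. (a) Let $c_1,\ldots,c_p$ be the (distinct) exponents attached to the slope $\mu$ of $P$, with respective multiplicities $m_1,\ldots,m_p$, indexed so that whenever $c_j/c_i=q^{l}$ with $l\in\mathbf{N}^*$ one has $i<j$. Then there is a convergent factorization $P=QR$ (i.e. all factors below have coefficients in $K$) with $\mu\notin S(Q)$ and $R=R_1\cdots R_p$, where for every $i\in\{1,\ldots,p\}$ $$R_i=(z^{\mu}\sigma_q-c_i)\,u_{i,m_i}^{-1}\cdots(z^{\mu}\sigma_q-c_i)\,u_{i,1}^{-1},$$ each $u_{i,j}\in K$ being a power series in $z$ with $u_{i,j}(0)=1$. Moreover $r_R=(m_1+\cdots+m_p)\delta_\mu$ and $\overline{R}^{(\mu)}=\prod_{i=1}^{p}(X-c_i)^{m_i}$. (b) Let instead $c_1,\ldots,c_p$ be the (distinct) exponents attached to the slope $\mu$ of $P$ that lie in one given class modulo $q^{\mathbf{Z}}$, with respective multiplicities $m_1,\ldots,m_p$, indexed so that $\epsilon(c_1)<\cdots<\epsilon(c_p)$. Then the unique formal factorization $P=QR$ in $\mathcal{D}_{q,\mathbf{C}((z))}$ such that no exponent attached to the slope $\mu$ of $Q$ is congruent to the $c_i$ modulo $q^{\mathbf{Z}}$ and $R=R_1\cdots R_p$ with $R_i=(z^{\mu}\sigma_q-c_i)u_{i,m_i}^{-1}\cdots(z^{\mu}\sigma_q-c_i)u_{i,1}^{-1}$,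 $u_{i,j}\in\mathbf{C}[[z]]$, $u_{i,j}(0)=1$, is convergent (i.e. all factors have coefficients in $K$). Moreover $r_R=(m_1+\cdots+m_p)\delta_\mu$ and $\overline{R}^{(\mu)}=\prod_{i=1}^{p}(X-c_i)^{m_i}$.
   Context: Fix $q\in\mathbf{C}$ with $|q|>1$. $\mathcal{M}(\mathbf{C})$ is the field of meromorphic functions on $\mathbf{C}$, $\mathbf{C}(\{z\})$ the field of germs of meromorphic functions at $0$, and $\mathbf{C}((z))$ the field of formal Laurent series; $\mathcal{M}(\mathbf{C})\subset\mathbf{C}(\{z\})\subset\mathbf{C}((z))$ via Laurent expansion at $0$. $v_0$ is the $z$-adic valuation and $\sigma_q$ the automorphism $f(z)\mapsto f(qz)$. For such a field $K$, $\mathcal{D}_{q,K}=K\langle\sigma_q,\sigma_q^{-1}\rangle$ is the ring of non-commutative Laurent polynomials $\sum a_i\sigma_q^i$ with $\sigma_q^k x=\sigma_q^k(x)\sigma_q^k$ ($x\in K$, $k\in\mathbf{Z}$); elements $u\in K$ are viewed as operators of degree $0$ (multiplication). Newton polygon: for $0\neq P=\sum a_i\sigma_q^i\in\mathcal{D}_{q,K}$, $N(P)$ is the convex hull of $\{(i,j)\in\mathbf{Z}^2: j\ge v_0(a_i)\}$. Its boundary consists of two vertical half-lines and vectors $(r_1,d_1),\ldots,(r_k,d_k)\in\mathbf{N}^*\times\mathbf{Z}$ of slopes $\mu_i=d_i/r_i$, with $\mu_1<\cdots<\mu_k$. $S(P)=\{\mu_1,\ldots,\mu_k\}$ is the set of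 slopes, $\mu_k$ is the last slope, and $r_P=\sum_i r_i\delta_{\mu_i}:\mathbf{Q}\to\mathbf{N}$, where $\delta_\mu$ is the indicator function of $\{\mu\}$. Characteristic polynomial: for $\mu\in\mathbf{Z}$ put $P'=\sum a_i'\sigma_q^i$ with $a_i'=a_i\,q^{-\mu i(i-1)/2}z^{-\mu i}$, let $\ell=\min_i v_0(a_i')$ and $b_i=z^{-\ell}a_i'$. Then $\overline{P}^{(\mu)}(s)=\sum_i b_i(0)s^i\in\mathbf{C}[s,s^{-1}]$, considered as defined up to a factor $\lambda s^k$, $\lambda\in\mathbf{C}^*$, $k\in\mathbf{Z}$ (identities between characteristic polynomials are understood up to such factors). The exponents attached to the slope $\mu$ are the non-zero roots of $\overline{P}^{(\mu)}$, with their multiplicities as roots. Each $c\in\mathbf{C}^*$ is written uniquely $c=q^{\epsilon(c)}\overline{c}$ with $\epsilon(c)\in\mathbf{Z}$, $1\le|\overline{c}|<|q|$. *)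

theory Defs
  imports "HOL-Complex_Analysis.Complex_Analysis" "HOL-Library.Poly_Mapping"
begin

subsection \<open>Coefficient fields, as subfields of the field of formal Laurent series\<close>

definition convergent_germs :: "complex fls set" where
  "convergent_germs = {F. \<exists>f. f has_laurent_expansion F}"

definition meromorphic_functions :: "complex fls set" where
  "meromorphic_functions = {F. \<exists>f. f meromorphic_on UNIV \<and> f has_laurent_expansion F}"

text \<open>\<open>q_shift q k\<close> is the \<open>k\<close>-th power of the automorphism \<open>f(z) \<mapsto> f(q z)\<close>.\<close>

definition q_shift :: "complex \<Rightarrow> int \<Rightarrow> complex fls \<Rightarrow> complex fls" where
  "q_shift q k f = fls_compose_fps f (fps_const (q powi k) * fps_X)"

subsection \<open>Skew Laurent polynomials\<close>

text \<open>
  An element \<open>\<Sum>\<^sub>i a\<^sub>i \<sigma>\<^sub>q\<^sup>i\<close> is the finitely supported family of its coefficients. The ring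
  structure is the pointwise addition of \<open>int \<Rightarrow>\<^sub>0 complex fls\<close> together with \<open>skew_mult q\<close>.
  The multiplication \<open>*\<close> which the type itself carries is the commutative one and is not used.
\<close>

type_synonym skew = "int \<Rightarrow>\<^sub>0 complex fls"

definition skew_mult :: "complex \<Rightarrow> skew \<Rightarrow> skew \<Rightarrow> skew" where
  "skew_mult q P Q =
     (\<Sum>i\<in>Poly_Mapping.keys P. \<Sum>j\<in>Poly_Mapping.keys Q.
        Poly_Mapping.single (i + j)
          (Poly_Mapping.lookup P i * q_shift q i (Poly_Mapping.lookup Q j)))"

definition skew_prod :: "complex \<Rightarrow> skew list \<Rightarrow> skew" where
  "skew_prod q Ps = foldr (skew_mult q) Ps (Poly_Mapping.single 0 1)"

definition skew_over :: "complex fls set \<Rightarrow> skew set" where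
  "skew_over K = {P. \<forall>i. Poly_Mapping.lookup P i \<in> K}"

subsection \<open>Newton polygon\<close>

definition newton_polygon :: "skew \<Rightarrow> (real \<times> real) set" where
  "newton_polygon P =
     convex hull {(real_of_int i, real_of_int j) | i j.
       Poly_Mapping.lookup P i \<noteq> 0 \<and> fls_subdegree (Poly_Mapping.lookup P i) \<le> j}"

text \<open>The vectors \<open>(r, d)\<close> with \<open>r > 0\<close> are those of the bounded, hence non-vertical, edges.\<close>

definition newton_vectors :: "skew \<Rightarrow> (nat \<times> int) set" where
  "newton_vectors P =
     {(r, d). r > 0 \<and>
        (\<exists>v. closed_segment v (v + (real r, real_of_int d)) edge_of newton_polygon P)}"

definition slopes :: "skew \<Rightarrow> rat set" where
  "slopes P = (\<lambda>(r, d). of_int d / of_nat r) ` newton_vectors P"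

definition newton_function :: "skew \<Rightarrow> rat \<Rightarrow> nat" where
  "newton_function P = (\<lambda>\<nu>. \<Sum>(r, d)\<in>newton_vectors P. if \<nu> = of_int d / of_nat r then r else 0)"

definition last_slope :: "skew \<Rightarrow> rat \<Rightarrow> bool" where
  "last_slope P \<mu> \<longleftrightarrow> \<mu> \<in> slopes P \<and> (\<forall>\<nu>\<in>slopes P. \<nu> \<le> \<mu>)"

subsection \<open>Characteristic polynomial and exponents\<close>

definition twisted_coeff :: "complex \<Rightarrow> skew \<Rightarrow> int \<Rightarrow> int \<Rightarrow> complex fls" where
  "twisted_coeff q P \<mu> i =
     Poly_Mapping.lookup P i * fls_const (q powi (- (\<mu> * (i * (i - 1) div 2))))
       * fls_X_intpow (- (\<mu> * i))"

definition twisted_val :: "complex \<Rightarrow> skew \<Rightarrow> int \<Rightarrow> int" where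
  "twisted_val q P \<mu> =
     Min ((\<lambda>i. fls_subdegree (twisted_coeff q P \<mu> i)) ` Poly_Mapping.keys P)"

text \<open>
  The characteristic polynomial is a Laurent polynomial in \<open>s\<close>, defined up to a factor
  \<open>\<lambda> s\<^sup>k\<close>. We take the representative obtained by dividing by \<open>s\<close> to the least index in the
  support of \<open>P\<close>, which is a polynomial.
\<close>

definition char_poly :: "complex \<Rightarrow> skew \<Rightarrow> int \<Rightarrow> complex poly" where
  "char_poly q P \<mu> =
     (\<Sum>i\<in>Poly_Mapping.keys P.
        monom (fls_nth (fls_X_intpow (- twisted_val q P \<mu>) * twisted_coeff q P \<mu> i) 0)
          (nat (i - Min (Poly_Mapping.keys P))))"

text \<open>Equality in \<open>\<complex>[s, s\<^sup>-\<^sup>1]\<close> up to a factor \<open>\<lambda> s\<^sup>k\<close> with \<open>\<lambda> \<noteq> 0\<close> and \<open>k\<close> an integer.\<close>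

definition laurent_associated :: "complex poly \<Rightarrow> complex poly \<Rightarrow> bool" where
  "laurent_associated A B \<longleftrightarrow> (\<exists>c m n. c \<noteq> 0 \<and> monom 1 m * A = monom c n * B)"

text \<open>The multiplicity of an exponent \<open>c\<close> is \<open>order c (char_poly q P \<mu>)\<close>.\<close>

definition exponents :: "complex \<Rightarrow> skew \<Rightarrow> int \<Rightarrow> complex set" where
  "exponents q P \<mu> = {c. c \<noteq> 0 \<and> poly (char_poly q P \<mu>) c = 0}"

definition q_congruent :: "complex \<Rightarrow> complex \<Rightarrow> complex \<Rightarrow> bool" where
  "q_congruent q c d \<longleftrightarrow> (\<exists>k::int. c = q powi k * d)"

definition q_exponent :: "complex \<Rightarrow> complex \<Rightarrow> int" where
  "q_exponent q c = (THE k. \<exists>d. c = q powi k * d \<and> 1 \<le> norm d \<and> norm d < norm q)"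

subsection \<open>The factors\<close>

text \<open>\<open>(z\<^sup>\<mu> \<sigma>\<^sub>q - c) u\<^sup>-\<^sup>1\<close>\<close>

definition elem_factor :: "complex \<Rightarrow> int \<Rightarrow> complex \<Rightarrow> complex fps \<Rightarrow> skew" where
  "elem_factor q \<mu> c u =
     skew_mult q
       (Poly_Mapping.single 1 (fls_X_intpow \<mu>) - Poly_Mapping.single 0 (fls_const c))
       (Poly_Mapping.single 0 (inverse (fps_to_fls u)))"

text \<open>\<open>(z\<^sup>\<mu> \<sigma>\<^sub>q - c) u\<^sub>m\<^sup>-\<^sup>1 \<cdots> (z\<^sup>\<mu> \<sigma>\<^sub>q - c) u\<^sub>1\<^sup>-\<^sup>1\<close>, with decreasing index\<close>

definition block_factor :: "complex \<Rightarrow> int \<Rightarrow> complex \<Rightarrow> nat \<Rightarrow> (nat \<Rightarrow> complex fps) \<Rightarrow> skew" where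
  "block_factor q \<mu> c m u = skew_prod q (map (\<lambda>j. elem_factor q \<mu> c (u j)) (rev [1..<Suc m]))"

text \<open>\<open>R\<^sub>1 \<cdots> R\<^sub>p\<close>\<close>

definition right_factor ::
  "complex \<Rightarrow> int \<Rightarrow> nat \<Rightarrow> (nat \<Rightarrow> complex) \<Rightarrow> (nat \<Rightarrow> nat) \<Rightarrow> (nat \<Rightarrow> nat \<Rightarrow> complex fps) \<Rightarrow> skew"
  where "right_factor q \<mu> p c m u =
     skew_prod q (map (\<lambda>i. block_factor q \<mu> (c i) (m i) (u i)) [1..<Suc p])"

text \<open>
  A formal factorization \<open>P = Q R\<close> with \<open>R = R\<^sub>1 \<cdots> R\<^sub>p\<close> built from the \<open>c\<^sub>i\<close>, \<open>m\<^sub>i\<close>, \<open>u\<^sub>i\<^sub>j\<close>.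
  Only the values \<open>u i j\<close> with \<open>1 \<le> i \<le> p\<close> and \<open>1 \<le> j \<le> m i\<close> matter.
\<close>

definition factorization ::
  "complex \<Rightarrow> int \<Rightarrow> skew \<Rightarrow> nat \<Rightarrow> (nat \<Rightarrow> complex) \<Rightarrow> (nat \<Rightarrow> nat)
     \<Rightarrow> skew \<Rightarrow> skew \<Rightarrow> (nat \<Rightarrow> nat \<Rightarrow> complex fps) \<Rightarrow> bool"
  where "factorization q \<mu> P p c m Q R u \<longleftrightarrow>
     P = skew_mult q Q R \<and> R = right_factor q \<mu> p c m u \<and>
     (\<forall>i\<in>{1..p}. \<forall>j\<in>{1..m i}. fps_nth (u i j) 0 = 1)"

definition convergent_factorization ::
  "complex fls set \<Rightarrow> nat \<Rightarrow> (nat \<Rightarrow> nat) \<Rightarrow> skew \<Rightarrow> skew \<Rightarrow> (nat \<Rightarrow> nat \<Rightarrow> complex fps) \<Rightarrow> bool"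
  where "convergent_factorization K p m Q R u \<longleftrightarrow>
     Q \<in> skew_over K \<and> R \<in> skew_over K \<and>
     (\<forall>i\<in>{1..p}. \<forall>j\<in>{1..m i}. fps_to_fls (u i j) \<in> K)"

end

theory Submission
  imports Defs "HOL-Computational_Algebra.Fundamental_Theorem_Algebra"
begin

text \<open>
  Replacing \<open>z\<^sup>\<mu> \<sigma>\<^sub>q\<close> by \<open>\<sigma>\<^sub>q\<close> is a ring automorphism, so the slope may be taken to be \<open>0\<close>. If \<open>0\<close> is
  the last slope, the leading coefficient of \<open>P = \<Sum>\<^sub>i a\<^sub>i \<sigma>\<^sub>q\<^sup>i\<close> has the least valuation. By right
  division by \<open>\<sigma>\<^sub>q - c\<close>, the right factor \<open>(\<sigma>\<^sub>q - c) u\<^sup>-\<^sup>1\<close> can be split off iff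
  \<open>\<Sum>\<^sub>i a\<^sub>i c\<^sup>i u(q\<^sup>i z) = 0\<close>. Comparing coefficients of \<open>z\<^sup>k\<close>, this is a recursion in which the
  \<open>k\<close>-th coefficient of \<open>u\<close> is multiplied by the characteristic polynomial at \<open>c q\<^sup>k\<close>; it has a
  unique solution with \<open>u(0) = 1\<close> when \<open>c\<close> is an exponent and no \<open>c q\<^sup>k\<close>, \<open>k \<ge> 1\<close>, is one. Because the
  leading coefficient has least valuation, the multiplier dominates all other terms of the
  recursion as \<open>k\<close> grows, and the solution converges; the functional equation, solved for its
  term of highest degree, then continues \<open>u\<close> meromorphically from each disc of radius \<open>r\<close> to the
  one of radius \<open>|q| r\<close>. The ordering of the exponents is exactly what allows the factors to be
  split off one after the other, and uniqueness of \<open>u\<close> at each step makes the factorization unique.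
\<close>

text \<open>Newton polygons enter only at the two ends. From the last slope one extracts three facts
  about the twisted operator: all coefficients have valuation at least l, the support lies in
  \<open>{N..n}\<close>, and the coefficient of index n has valuation exactly l. Splitting off a
  right factor preserves them with n lowered by one, so the induction runs on these facts alone and
  intermediate quotients need no polygon. N and l stay those of P throughout. With them fixed,
  taking the coefficient of z^l is multiplicative on the nose, because \<sigma>_q acts trivially on
  constant terms; the characteristic polynomial, by contrast, is renormalised for every operator.
  Both parts of the theorem come from one statement about a splitting of the characteristic
  polynomial into G and the product of the (X - c_i)^(m_i), where no c_i q^k with k \<ge> 1 is a
  root of G. They differ in what G says about Q. In (a), G is a monomial, so a line of slope \<mu>
  touches the polygon of Q in one vertex only; in (b), the non-zero roots of G are the exponents
  left to Q.\<close>

abbreviation scoeff :: "skew \<Rightarrow> int \<Rightarrow> complex fls" where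
  "scoeff \<equiv> Poly_Mapping.lookup"

abbreviation sterm :: "int \<Rightarrow> complex fls \<Rightarrow> skew" where
  "sterm \<equiv> Poly_Mapping.single"

lemma scoeff_sterm: "scoeff (sterm i a) j = (if i = j then a else 0)"
  by (simp add: lookup_single when_def)

section \<open>The q-shift and the ring of skew Laurent polynomials\<close>

lemma fls_nth_q_shift:
  assumes "q \<noteq> 0"
  shows "fls_nth (q_shift q k f) n = fls_nth f n * q powi (k * n)"
  using assms by (simp add: q_shift_def fls_nth_fls_compose_fps_linear power_int_mult)

lemma q_shift_0 [simp]: "q_shift q k 0 = 0"
  by (simp add: q_shift_def)

lemma q_shift_1 [simp]: "q_shift q k 1 = 1"
  by (simp add: q_shift_def)

lemma q_shift_const [simp]: "q_shift q k (fls_const c) = fls_const c"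
  by (simp add: q_shift_def)

lemma q_shift_zero [simp]: "q \<noteq> 0 \<Longrightarrow> q_shift q 0 f = f"
  by (rule fls_eqI) (simp add: fls_nth_q_shift)

lemma q_shift_add: "q \<noteq> 0 \<Longrightarrow> q_shift q k (f + g) = q_shift q k f + q_shift q k g"
  by (rule fls_eqI) (simp add: fls_nth_q_shift algebra_simps)

lemma q_shift_diff: "q \<noteq> 0 \<Longrightarrow> q_shift q k (f - g) = q_shift q k f - q_shift q k g"
  by (rule fls_eqI) (simp add: fls_nth_q_shift algebra_simps)

lemma q_shift_sum: "q \<noteq> 0 \<Longrightarrow> q_shift q k (\<Sum>x\<in>A. f x) = (\<Sum>x\<in>A. q_shift q k (f x))"
  by (induction A rule: infinite_finite_induct) (auto simp: q_shift_add)

lemma q_shift_mult: "q \<noteq> 0 \<Longrightarrow> q_shift q k (f * g) = q_shift q k f * q_shift q k g"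
  by (simp add: q_shift_def fls_compose_fps_mult)

lemma q_shift_q_shift: "q \<noteq> 0 \<Longrightarrow> q_shift q i (q_shift q j f) = q_shift q (i + j) f"
  by (rule fls_eqI) (simp add: fls_nth_q_shift power_int_add algebra_simps)

lemma q_shift_X_intpow:
  assumes "q \<noteq> 0"
  shows "q_shift q k (fls_X_intpow n) = fls_const (q powi (k * n)) * fls_X_intpow n"
  by (rule fls_eqI) (use assms in \<open>auto simp: fls_nth_q_shift\<close>)

text \<open>An index set larger than the support is allowed so that sums attached to operators with
  different supports can be taken over one common set.\<close>

lemma scoeff_skew_mult_superset:
  assumes "finite I" "Poly_Mapping.keys P \<subseteq> I"
  shows "scoeff (skew_mult q P Q) k = (\<Sum>i\<in>I. scoeff P i * q_shift q i (scoeff Q (k - i)))"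
proof -
  have "scoeff (skew_mult q P Q) k =
      (\<Sum>i\<in>Poly_Mapping.keys P. \<Sum>j\<in>Poly_Mapping.keys Q.
         if j = k - i then scoeff P i * q_shift q i (scoeff Q j) else 0)"
    unfolding skew_mult_def lookup_sum scoeff_sterm
    by (intro sum.cong refl) (auto simp: algebra_simps)
  also have "\<dots> = (\<Sum>i\<in>Poly_Mapping.keys P. scoeff P i * q_shift q i (scoeff Q (k - i)))"
    by (intro sum.cong refl) (auto simp: sum.delta in_keys_iff)
  also have "\<dots> = (\<Sum>i\<in>I. scoeff P i * q_shift q i (scoeff Q (k - i)))"
    by (rule sum.mono_neutral_left) (use assms in \<open>auto simp: in_keys_iff\<close>)
  finally show ?thesis .
qed

lemma scoeff_skew_mult:
  "scoeff (skew_mult q P Q) k =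
     (\<Sum>i\<in>Poly_Mapping.keys P. scoeff P i * q_shift q i (scoeff Q (k - i)))"
  by (rule scoeff_skew_mult_superset) auto

lemma keys_skew_mult_subset:
  "Poly_Mapping.keys (skew_mult q P Q) \<subseteq>
     (\<lambda>(i, j). i + j) ` (Poly_Mapping.keys P \<times> Poly_Mapping.keys Q)"
proof
  fix k assume "k \<in> Poly_Mapping.keys (skew_mult q P Q)"
  hence "(\<Sum>i\<in>Poly_Mapping.keys P. scoeff P i * q_shift q i (scoeff Q (k - i))) \<noteq> 0"
    by (simp only: in_keys_iff scoeff_skew_mult not_False_eq_True)
  then obtain i where i: "i \<in> Poly_Mapping.keys P" "scoeff P i * q_shift q i (scoeff Q (k - i)) \<noteq> 0"
    by (meson sum.not_neutral_contains_not_neutral)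
  hence "k - i \<in> Poly_Mapping.keys Q" by (auto simp: in_keys_iff)
  with i(1) show "k \<in> (\<lambda>(i, j). i + j) ` (Poly_Mapping.keys P \<times> Poly_Mapping.keys Q)"
    by (intro image_eqI[of _ _ "(i, k - i)"]) auto
qed

lemma scoeff_skew_mult_sterm_right:
  assumes "q \<noteq> 0"
  shows "scoeff (skew_mult q P (sterm j b)) k = scoeff P (k - j) * q_shift q (k - j) b"
proof -
  have "scoeff (skew_mult q P (sterm j b)) k =
      (\<Sum>i\<in>Poly_Mapping.keys P. if i = k - j then scoeff P (k - j) * q_shift q (k - j) b else 0)"
    unfolding scoeff_skew_mult by (intro sum.cong refl) (auto simp: scoeff_sterm)
  thus ?thesis by (auto simp: sum.delta in_keys_iff)
qed

lemma scoeff_skew_mult_sterm_left: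
  "scoeff (skew_mult q (sterm i a) Q) k = a * q_shift q i (scoeff Q (k - i))"
  by (subst scoeff_skew_mult_superset[of "{i}"]) auto

lemma skew_mult_add_left:
  "skew_mult q (P + P') Q = skew_mult q P Q + skew_mult q P' Q"
proof (rule poly_mapping_eqI)
  fix k
  define I where "I = Poly_Mapping.keys P \<union> Poly_Mapping.keys P'"
  have I: "finite I" "Poly_Mapping.keys P \<subseteq> I" "Poly_Mapping.keys P' \<subseteq> I"
    "Poly_Mapping.keys (P + P') \<subseteq> I"
    using keys_add[of P P'] by (auto simp: I_def)
  show "scoeff (skew_mult q (P + P') Q) k = scoeff (skew_mult q P Q + skew_mult q P' Q) k"
    by (simp add: lookup_add scoeff_skew_mult_superset[OF I(1)] I algebra_simps sum.distrib)
qed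

lemma skew_mult_diff_left:
  "skew_mult q (P - P') Q = skew_mult q P Q - skew_mult q P' Q"
  using skew_mult_add_left[of q "P - P'" P' Q] by (simp add: algebra_simps)

lemma skew_mult_diff_right:
  assumes "q \<noteq> 0"
  shows "skew_mult q P (Q - Q') = skew_mult q P Q - skew_mult q P Q'"
  by (rule poly_mapping_eqI)
     (simp add: lookup_minus scoeff_skew_mult q_shift_diff assms algebra_simps sum_subtractf)

lemma skew_mult_one_right [simp]: "q \<noteq> 0 \<Longrightarrow> skew_mult q P 1 = P"
  by (rule poly_mapping_eqI) (simp add: scoeff_skew_mult_sterm_right del: single_one flip: single_one)

lemma skew_mult_one_left [simp]: "q \<noteq> 0 \<Longrightarrow> skew_mult q 1 P = P"
  by (rule poly_mapping_eqI) (simp add: scoeff_skew_mult_sterm_left del: single_one flip: single_one)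

lemma skew_mult_assoc:
  assumes q: "q \<noteq> 0"
  shows "skew_mult q (skew_mult q A B) C = skew_mult q A (skew_mult q B C)"
proof (rule poly_mapping_eqI)
  fix k
  let ?K = "Poly_Mapping.keys"
  \<comment> \<open>All sums of indices, including those where the coefficient of A B cancels. Over
    this set the total degree m runs independently of i, so the two sums can be exchanged.\<close>
  define M where "M = (\<lambda>(i, j). i + j) ` (?K A \<times> ?K B)"
  have M: "finite M" "?K (skew_mult q A B) \<subseteq> M"
    using keys_skew_mult_subset[of q A B] by (auto simp: M_def)
  let ?t = "\<lambda>i m. scoeff A i * q_shift q i (scoeff B (m - i)) * q_shift q m (scoeff C (k - m))"
  have "scoeff (skew_mult q (skew_mult q A B) C) k = (\<Sum>m\<in>M. \<Sum>i\<in>?K A. ?t i m)"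
    unfolding scoeff_skew_mult_superset[OF M] scoeff_skew_mult[of q A B] by (simp add: sum_distrib_right)
  also have "\<dots> = (\<Sum>i\<in>?K A. \<Sum>m\<in>M. ?t i m)" by (rule sum.swap)
  also have "\<dots> = (\<Sum>i\<in>?K A. \<Sum>j\<in>?K B. ?t i (i + j))"
  proof (rule sum.cong[OF refl])
    fix i assume i: "i \<in> ?K A"
    have "(\<Sum>m\<in>M. ?t i m) = (\<Sum>m\<in>(\<lambda>j. i + j) ` ?K B. ?t i m)"
    proof (intro sum.mono_neutral_right)
      show "\<forall>m\<in>M - (\<lambda>j. i + j) ` ?K B. ?t i m = 0"
      proof
        fix m assume "m \<in> M - (\<lambda>j. i + j) ` ?K B"
        hence "m - i \<notin> ?K B" by force
        thus "?t i m = 0" by (simp add: in_keys_iff)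
      qed
    qed (use M i in \<open>auto simp: M_def\<close>)
    also have "\<dots> = (\<Sum>j\<in>?K B. ?t i (i + j))"
      by (subst sum.reindex) auto
    finally show "(\<Sum>m\<in>M. ?t i m) = (\<Sum>j\<in>?K B. ?t i (i + j))" .
  qed
  also have "\<dots> = scoeff (skew_mult q A (skew_mult q B C)) k"
    unfolding scoeff_skew_mult
    by (intro sum.cong refl)
       (simp add: q_shift_sum q q_shift_mult q_shift_q_shift sum_distrib_left algebra_simps)
  finally show "scoeff (skew_mult q (skew_mult q A B) C) k = \<dots>" .
qed

lemma skew_prod_append:
  assumes "q \<noteq> 0"
  shows "skew_prod q (xs @ ys) = skew_mult q (skew_prod q xs) (skew_prod q ys)"
  by (induction xs) (auto simp: skew_prod_def skew_mult_assoc assms)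

lemma skew_prod_Nil [simp]: "skew_prod q [] = 1"
  by (simp add: skew_prod_def)

lemma skew_prod_Cons [simp]: "skew_prod q (x # xs) = skew_mult q x (skew_prod q xs)"
  by (simp add: skew_prod_def)

lemma skew_prod_concat:
  assumes "q \<noteq> 0"
  shows "skew_prod q (concat xss) = skew_prod q (map (skew_prod q) xss)"
  by (induction xss) (auto simp: skew_prod_append assms)

subsection \<open>The twist sending \<open>z\<^sup>\<mu> \<sigma>\<^sub>q\<close> to \<open>\<sigma>\<^sub>q\<close>\<close>

text \<open>Since (z^\<mu> \<sigma>_q)^i = q^(\<mu> i (i - 1) / 2) z^(\<mu> i) \<sigma>_q^i, these
  are the coefficients of P written in powers of z^\<mu> \<sigma>_q.\<close>

definition twist :: "complex \<Rightarrow> int \<Rightarrow> skew \<Rightarrow> skew" where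
  "twist q \<mu> P = Abs_poly_mapping (twisted_coeff q P \<mu>)"

lemma scoeff_twist: "scoeff (twist q \<mu> P) i = twisted_coeff q P \<mu> i"
proof -
  have "finite {i. twisted_coeff q P \<mu> i \<noteq> 0}"
    by (rule finite_subset[OF _ finite_keys[of P]]) (auto simp: twisted_coeff_def in_keys_iff)
  thus ?thesis by (simp add: twist_def)
qed

lemma keys_twist [simp]: "q \<noteq> 0 \<Longrightarrow> Poly_Mapping.keys (twist q \<mu> P) = Poly_Mapping.keys P"
  by (auto simp: in_keys_iff scoeff_twist twisted_coeff_def fls_shift_eq0_iff)

text \<open>The cross term i j is the exponent of q^\<mu> that appears when \<sigma>_q^i moves past
  z^(\<mu> j); it is what makes \<open>twist\<close> multiplicative.\<close>

lemma triangle_add: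
  "(i + j) * (i + j - 1) div 2 = i * (i - 1) div 2 + j * (j - 1) div 2 + i * (j::int)"
proof -
  have "(i + j) * (i + j - 1) = i * (i - 1) + (j * (j - 1) + 2 * (i * j))"
    by (simp add: algebra_simps)
  moreover have "even (i * (i - 1))" by auto
  ultimately have "(i + j) * (i + j - 1) div 2 = i * (i - 1) div 2 + (j * (j - 1) + 2 * (i * j)) div 2"
    by (metis div_plus_div_distrib_dvd_left)
  thus ?thesis by simp
qed

lemma twist_mult:
  assumes q: "q \<noteq> 0"
  shows "twist q \<mu> (skew_mult q P Q) = skew_mult q (twist q \<mu> P) (twist q \<mu> Q)"
proof (rule poly_mapping_eqI)
  fix k
  have *: "scoeff P i * q_shift q i (scoeff Q (k - i)) *
        fls_const (q powi (- (\<mu> * (k * (k - 1) div 2)))) * fls_X_intpow (- (\<mu> * k)) =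
      twisted_coeff q P \<mu> i * q_shift q i (twisted_coeff q Q \<mu> (k - i))" for i
  proof -
    obtain j where k: "k = i + j" by (metis add.commute diff_add_cancel)
    have 1: "q powi (- (\<mu> * (k * (k - 1) div 2))) =
       q powi (- (\<mu> * (i * (i - 1) div 2))) * q powi (- (\<mu> * (j * (j - 1) div 2))) * q powi (i * (- (\<mu> * j)))"
    proof -
      have "- (\<mu> * (k * (k - 1) div 2)) =
          - (\<mu> * (i * (i - 1) div 2)) + - (\<mu> * (j * (j - 1) div 2)) + i * (- (\<mu> * j))"
        unfolding k triangle_add by (simp add: distrib_left)
      thus ?thesis by (simp only: power_int_add q simp_thms)
    qed
    have 2: "fls_X_intpow (- (\<mu> * k)) = (fls_X_intpow (- (\<mu> * i)) * fls_X_intpow (- (\<mu> * j)) :: complex fls)"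
      unfolding k by (simp add: fls_times_both_shifted_simp algebra_simps)
    show ?thesis unfolding 1 2 twisted_coeff_def
      by (simp add: q k q_shift_mult q_shift_X_intpow[of q i "- (\<mu> * j)", simplified] fls_const_mult_const[symmetric] del: fls_const_mult_const)
  qed
  show "scoeff (twist q \<mu> (skew_mult q P Q)) k = scoeff (skew_mult q (twist q \<mu> P) (twist q \<mu> Q)) k"
    unfolding scoeff_twist twisted_coeff_def[of _ "skew_mult q P Q"] scoeff_skew_mult keys_twist[OF q]
      sum_distrib_right * ..
qed

lemma twist_twist_minus [simp]:
  assumes "q \<noteq> 0"
  shows "twist q \<mu> (twist q (-\<mu>) P) = P"
  by (rule poly_mapping_eqI)
     (simp add: scoeff_twist twisted_coeff_def[of _ "twist q (-\<mu>) P"],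
      simp add: twisted_coeff_def assms mult_ac power_int_minus fls_times_both_shifted_simp)

lemma twist_sterm_0 [simp]: "twist q \<mu> (sterm 0 a) = sterm 0 a"
  by (rule poly_mapping_eqI) (simp add: scoeff_twist twisted_coeff_def scoeff_sterm)

lemma twist_one [simp]: "twist q \<mu> 1 = 1"
  using twist_sterm_0[of q \<mu> 1] by simp

lemma twist_diff: "twist q \<mu> (P - Q) = twist q \<mu> P - twist q \<mu> Q"
  by (rule poly_mapping_eqI) (simp add: scoeff_twist twisted_coeff_def lookup_minus algebra_simps)

lemma twist_elem_factor:
  assumes "q \<noteq> 0"
  shows "twist q \<mu> (elem_factor q \<mu> c u) = elem_factor q 0 c u"
proof -
  have "twist q \<mu> (sterm 1 (fls_X_intpow \<mu>)) = sterm 1 1"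
    by (rule poly_mapping_eqI) (auto simp: scoeff_twist twisted_coeff_def scoeff_sterm fls_times_both_shifted_simp)
  thus ?thesis by (simp add: elem_factor_def twist_mult twist_diff assms)
qed

lemma twist_skew_prod:
  "q \<noteq> 0 \<Longrightarrow> twist q \<mu> (skew_prod q Ps) = skew_prod q (map (twist q \<mu>) Ps)"
  by (induction Ps) (auto simp: twist_mult)

lemma twist_right_factor:
  assumes "q \<noteq> 0"
  shows "twist q \<mu> (right_factor q \<mu> p c m u) = right_factor q 0 p c m u"
  by (simp add: right_factor_def block_factor_def twist_skew_prod twist_elem_factor assms o_def)

subsection \<open>Valuations and the symbol\<close>

text \<open>Phrased by vanishing coefficients because \<open>fls_subdegree 0\<close> is 0: a bound
  on subdegrees over all indices would fail at zero coefficients as soon as l > 0.\<close>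

definition val_ge :: "int \<Rightarrow> skew \<Rightarrow> bool" where
  "val_ge l P \<longleftrightarrow> (\<forall>i. \<forall>n<l. fls_nth (scoeff P i) n = 0)"

text \<open>The lowest layer of P as a polynomial, with \<sigma>_q^N read as 1. N and l are
  parameters, not computed from P, so that all quotients of P can be measured on the same scale. The
  truncation in \<open>nat\<close> is harmless when the support lies in
  \<open>{N..}\<close>.\<close>

definition symb :: "int \<Rightarrow> int \<Rightarrow> skew \<Rightarrow> complex poly" where
  "symb N l P = (\<Sum>i\<in>Poly_Mapping.keys P. monom (fls_nth (scoeff P i) l) (nat (i - N)))"

lemma coeff_symb:
  assumes "Poly_Mapping.keys P \<subseteq> {N..}"
  shows "coeff (symb N l P) k = fls_nth (scoeff P (N + int k)) l"
proof -
  have "coeff (symb N l P) k =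
      (\<Sum>i\<in>Poly_Mapping.keys P. if i = N + int k then fls_nth (scoeff P (N + int k)) l else 0)"
    unfolding symb_def coeff_sum by (intro sum.cong refl) (use assms in auto)
  also have "\<dots> = fls_nth (scoeff P (N + int k)) l"
    by (auto simp: sum.delta in_keys_iff)
  finally show ?thesis .
qed

lemma fls_nth_eq_0_imp_shift:
  assumes "\<And>n. n < l \<Longrightarrow> fls_nth f n = 0"
  obtains F where "f = fls_shift (- l) (fps_to_fls F)"
proof
  show "f = fls_shift (- l) (fps_to_fls (Abs_fps (\<lambda>n. fls_nth f (l + int n))))"
    by (rule fls_eqI) (use assms in \<open>auto simp: not_le\<close>)
qed

lemma fls_nth_mult_fps:
  fixes f :: "'a :: comm_ring_1 fls"
  assumes "\<And>n. n < l \<Longrightarrow> fls_nth f n = 0"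
  shows "fls_nth (f * fps_to_fls u) (l + int k) = (\<Sum>j\<le>k. fls_nth f (l + int (k - j)) * fps_nth u j)"
proof -
  obtain F where F: "f = fls_shift (- l) (fps_to_fls F)"
    using fls_nth_eq_0_imp_shift assms by metis
  have "f * fps_to_fls u = fls_shift (- l) (fps_to_fls (F * u))"
    using fls_times_both_shifted_simp[of "- l" "fps_to_fls F" 0 "fps_to_fls u"]
    by (simp add: F fls_times_fps_to_fls)
  hence "fls_nth (f * fps_to_fls u) (l + int k) = (\<Sum>j\<le>k. fps_nth u j * fps_nth F (k - j))"
    by (simp add: mult.commute[of F] fps_mult_nth atLeast0AtMost)
  thus ?thesis by (simp add: F mult.commute nat_diff_distrib')
qed

lemma fls_nth_mult_less:
  fixes f g :: "'a :: comm_ring_1 fls"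
  assumes "\<And>n. n < l \<Longrightarrow> fls_nth f n = 0" "\<And>n. n < 0 \<Longrightarrow> fls_nth g n = 0" "n < l"
  shows "fls_nth (f * g) n = 0"
proof -
  obtain F where F: "f = fls_shift (- l) (fps_to_fls F)"
    using fls_nth_eq_0_imp_shift assms(1) by metis
  obtain G where G: "g = fls_shift (- 0) (fps_to_fls G)"
    using fls_nth_eq_0_imp_shift assms(2) by metis
  have "f * g = fls_shift (- l) (fps_to_fls (F * G))"
    using fls_times_both_shifted_simp[of "- l" "fps_to_fls F" 0 "fps_to_fls G"]
    by (simp add: F G fls_times_fps_to_fls)
  thus ?thesis using assms(3) by simp
qed

lemma fls_nth_mult_least:
  fixes f g :: "'a :: comm_ring_1 fls"
  assumes "\<And>n. n < l \<Longrightarrow> fls_nth f n = 0" "\<And>n. n < 0 \<Longrightarrow> fls_nth g n = 0"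
  shows "fls_nth (f * g) l = fls_nth f l * fls_nth g 0"
proof -
  obtain G where G: "g = fls_shift (- 0) (fps_to_fls G)"
    using fls_nth_eq_0_imp_shift assms(2) by metis
  show ?thesis using fls_nth_mult_fps[of l f G 0] assms(1) by (simp add: G)
qed

lemma val_ge_skew_mult:
  assumes "q \<noteq> 0" "val_ge l P" "val_ge 0 R"
  shows "val_ge l (skew_mult q P R)"
  unfolding val_ge_def
proof (intro allI impI)
  fix k n assume "n < l"
  hence "fls_nth (scoeff P i * q_shift q i (scoeff R (k - i))) n = 0" for i
    by (intro fls_nth_mult_less[of l]) (use assms in \<open>auto simp: val_ge_def fls_nth_q_shift\<close>)
  thus "fls_nth (scoeff (skew_mult q P R) k) n = 0"
    by (simp add: scoeff_skew_mult fls_nth_sum)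
qed

lemma keys_skew_mult_ge:
  assumes "Poly_Mapping.keys P \<subseteq> {N..}" "Poly_Mapping.keys R \<subseteq> {M..}"
  shows "Poly_Mapping.keys (skew_mult q P R) \<subseteq> {N + M..}"
  using keys_skew_mult_subset[of q P R] assms by fastforce

lemma keys_skew_mult_le:
  assumes "Poly_Mapping.keys P \<subseteq> {..N}" "Poly_Mapping.keys R \<subseteq> {..M}"
  shows "Poly_Mapping.keys (skew_mult q P R) \<subseteq> {..N + M}"
  using keys_skew_mult_subset[of q P R] assms by fastforce

text \<open>The coefficient of z^l in a product only sees the coefficients of z^l in P and the
  constant terms in R. The q-shift fixes constant terms, so the twisted product becomes the ordinary
  product of polynomials.\<close>

lemma symb_skew_mult:
  assumes q: "q \<noteq> 0" and P: "val_ge l P" "Poly_Mapping.keys P \<subseteq> {N..}"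
    and R: "val_ge 0 R" "Poly_Mapping.keys R \<subseteq> {0..}"
  shows "symb N l (skew_mult q P R) = symb N l P * symb 0 0 R"
proof (rule poly_eqI)
  fix k
  let ?I = "(\<lambda>a. N + int a) ` {..k}"
  have keys: "Poly_Mapping.keys (skew_mult q P R) \<subseteq> {N..}"
    using keys_skew_mult_ge[OF P(2) R(2)] by simp
  have [simp]: "fls_nth (scoeff P i * q_shift q i (scoeff R j)) l = fls_nth (scoeff P i) l * fls_nth (scoeff R j) 0"
    for i j
    by (subst fls_nth_mult_least) (use P R q in \<open>auto simp: val_ge_def fls_nth_q_shift\<close>)
  have "coeff (symb N l (skew_mult q P R)) k =
     (\<Sum>i\<in>Poly_Mapping.keys P. fls_nth (scoeff P i) l * fls_nth (scoeff R (N + int k - i)) 0)"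
    by (simp add: coeff_symb[OF keys] scoeff_skew_mult fls_nth_sum)
  \<comment> \<open>The support of P is exchanged for the indices N, ..., N + k by way of their
    union; beyond N + k the factor from R vanishes, since R has no negative powers of
    \<sigma>_q.\<close>
  also have "\<dots> = (\<Sum>i\<in>Poly_Mapping.keys P \<union> ?I. fls_nth (scoeff P i) l * fls_nth (scoeff R (N + int k - i)) 0)"
    by (rule sum.mono_neutral_left) (auto simp: in_keys_iff)
  also have "\<dots> = (\<Sum>i\<in>?I. fls_nth (scoeff P i) l * fls_nth (scoeff R (N + int k - i)) 0)"
  proof (intro sum.mono_neutral_right ballI)
    fix i assume "i \<in> Poly_Mapping.keys P \<union> ?I - ?I"
    hence i: "i \<ge> N" "i \<notin> ?I" using P(2) by auto
    have "N + int k - i < 0"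
    proof (rule ccontr)
      assume "\<not> N + int k - i < 0"
      hence "i = N + int (nat (i - N))" "nat (i - N) \<le> k" using i(1) by auto
      thus False using i(2) by blast
    qed
    hence "N + int k - i \<notin> Poly_Mapping.keys R" using R(2) by auto
    thus "fls_nth (scoeff P i) l * fls_nth (scoeff R (N + int k - i)) 0 = 0"
      by (simp add: in_keys_iff)
  qed auto
  also have "\<dots> = (\<Sum>a\<le>k. fls_nth (scoeff P (N + int a)) l * fls_nth (scoeff R (0 + int (k - a))) 0)"
    by (subst sum.reindex) (auto simp: inj_on_def of_nat_diff algebra_simps)
  also have "\<dots> = coeff (symb N l P * symb 0 0 R) k"
    by (simp add: coeff_mult coeff_symb[OF P(2)] coeff_symb[OF R(2)])
  finally show "coeff (symb N l (skew_mult q P R)) k = \<dots>" .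
qed

lemma symb_shift:
  assumes "Poly_Mapping.keys P \<subseteq> {N..}" "M \<le> N"
  shows "symb M l P = monom 1 (nat (N - M)) * symb N l P"
  unfolding symb_def sum_distrib_left
proof (intro sum.cong refl)
  fix i assume "i \<in> Poly_Mapping.keys P"
  hence "nat (i - M) = nat (N - M) + nat (i - N)" using assms by auto
  thus "monom (fls_nth (scoeff P i) l) (nat (i - M)) =
      monom 1 (nat (N - M)) * monom (fls_nth (scoeff P i) l) (nat (i - N))"
    by (simp add: mult_monom)
qed

lemma poly_symb:
  assumes "Poly_Mapping.keys P \<subseteq> {N..}" "s \<noteq> 0"
  shows "(\<Sum>i\<in>Poly_Mapping.keys P. fls_nth (scoeff P i) l * s powi i) = s powi N * poly (symb N l P) s"
  unfolding symb_def poly_sum sum_distrib_left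
proof (intro sum.cong refl)
  fix i assume "i \<in> Poly_Mapping.keys P"
  hence "i \<ge> N" using assms by auto
  hence "s powi i = s powi (N + int (nat (i - N)))" by simp
  also have "\<dots> = s powi N * s ^ nat (i - N)"
    using assms(2) by (subst power_int_add) (auto simp: power_int_def)
  finally have "s powi i = s powi N * s ^ nat (i - N)" .
  thus "fls_nth (scoeff P i) l * s powi i = s powi N * poly (monom (fls_nth (scoeff P i) l) (nat (i - N))) s"
    by (simp add: poly_monom)
qed

subsection \<open>Right division by \<open>\<sigma>\<^sub>q - c\<close>\<close>

abbreviation linear_factor :: "complex \<Rightarrow> skew" where
  "linear_factor c \<equiv> sterm 1 1 - sterm 0 (fls_const c)"

lemma scoeff_skew_mult_lin:
  assumes "q \<noteq> 0"
  shows "scoeff (skew_mult q Q (linear_factor c)) j = scoeff Q (j - 1) - scoeff Q j * fls_const c"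
  by (simp add: skew_mult_diff_right assms lookup_minus scoeff_skew_mult_sterm_right)

text \<open>The top coefficient of Q - Q' survives multiplication by \<sigma>_q - c: it is the whole
  coefficient one degree higher.\<close>

lemma skew_mult_lin_cancel:
  assumes q: "q \<noteq> 0" and eq: "skew_mult q Q (linear_factor c) = skew_mult q Q' (linear_factor c)"
  shows "Q = Q'"
proof (rule ccontr)
  assume "Q \<noteq> Q'"
  define D where "D = Q - Q'"
  define M where "M = Max (Poly_Mapping.keys D)"
  have ne: "Poly_Mapping.keys D \<noteq> {}" using \<open>Q \<noteq> Q'\<close> by (simp add: D_def)
  have M: "M \<in> Poly_Mapping.keys D" "M + 1 \<notin> Poly_Mapping.keys D"
    using Max_in[OF _ ne] Max_ge[of "Poly_Mapping.keys D" "M + 1"] by (auto simp: M_def)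
  have "skew_mult q D (linear_factor c) = 0" unfolding D_def skew_mult_diff_left eq by simp
  hence "scoeff D M - scoeff D (M + 1) * fls_const c = 0"
    using scoeff_skew_mult_lin[OF q, of D c "M + 1"] by simp
  thus False using M by (simp add: in_keys_iff)
qed

text \<open>Replacing \<sigma>_q by c, written to the right of the coefficients, gives the remainder
  of right division by \<sigma>_q - c. On a multiple of \<sigma>_q - c it telescopes, because
  \<sigma>_q fixes the constant c.\<close>

lemma skew_mult_lin_remainder:
  assumes q: "q \<noteq> 0" and c: "c \<noteq> 0" and I: "finite I" "Poly_Mapping.keys (skew_mult q Q (linear_factor c)) \<subseteq> I"
  shows "(\<Sum>i\<in>I. scoeff (skew_mult q Q (linear_factor c)) i * fls_const (c powi i)) = 0"
proof -
  let ?S = "skew_mult q Q (linear_factor c)"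
  let ?K = "Poly_Mapping.keys Q"
  define J where "J = I \<union> ?K \<union> (\<lambda>i. i + 1) ` ?K"
  have J: "finite J" using I by (simp add: J_def)
  have "(\<Sum>i\<in>I. scoeff ?S i * fls_const (c powi i)) = (\<Sum>i\<in>J. scoeff ?S i * fls_const (c powi i))"
    by (rule sum.mono_neutral_left) (use J I in \<open>auto simp: J_def in_keys_iff\<close>)
  also have "\<dots> = (\<Sum>i\<in>J. scoeff Q (i - 1) * fls_const (c powi i)) - (\<Sum>i\<in>J. scoeff Q i * fls_const (c powi (i + 1)))"
    unfolding scoeff_skew_mult_lin[OF q] sum_subtractf[symmetric]
    by (intro sum.cong refl) (simp add: algebra_simps power_int_add c flip: fls_const_mult_const)
  also have "(\<Sum>i\<in>J. scoeff Q (i - 1) * fls_const (c powi i)) = (\<Sum>i\<in>(\<lambda>i. i + 1) ` ?K. scoeff Q (i - 1) * fls_const (c powi i))"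
  proof (intro sum.mono_neutral_right ballI)
    fix i assume "i \<in> J - (\<lambda>i. i + 1) ` ?K"
    hence "i - 1 \<notin> ?K" by force
    thus "scoeff Q (i - 1) * fls_const (c powi i) = 0" by (simp add: in_keys_iff)
  qed (use J in \<open>auto simp: J_def\<close>)
  also have "\<dots> = (\<Sum>i\<in>?K. scoeff Q i * fls_const (c powi (i + 1)))"
    by (subst sum.reindex) (auto simp: inj_on_def)
  also have "(\<Sum>i\<in>J. scoeff Q i * fls_const (c powi (i + 1))) = (\<Sum>i\<in>?K. scoeff Q i * fls_const (c powi (i + 1)))"
    by (rule sum.mono_neutral_right) (use J in \<open>auto simp: J_def in_keys_iff\<close>)
  finally show ?thesis by simp
qed

text \<open>The coefficients of the quotient are part of the conclusion: its valuation, its upper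
  degree bound and its membership in the coefficient field are read off from them.\<close>

lemma right_division:
  assumes q: "q \<noteq> 0" and c: "c \<noteq> 0"
    and rem: "(\<Sum>i\<in>Poly_Mapping.keys S. scoeff S i * fls_const (c powi i)) = 0"
  shows "\<exists>Q. S = skew_mult q Q (linear_factor c) \<and>
    (\<forall>j. scoeff Q j =
       (\<Sum>i | i \<in> Poly_Mapping.keys S \<and> j < i. scoeff S i * fls_const (c powi (i - 1 - j))))"
proof -
  let ?K = "Poly_Mapping.keys S"
  \<comment> \<open>\<open>\<Sum>\<^sub>i s\<^sub>i (\<sigma>\<^sup>i - c\<^sup>i) / (\<sigma> - c)\<close>; constants commute with \<open>\<sigma>\<close>, so this is the quotient.\<close>
  define f where "f = (\<lambda>j. \<Sum>i | i \<in> ?K \<and> j < i. scoeff S i * fls_const (c powi (i - 1 - j)))"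
  have fin: "finite {j. f j \<noteq> 0}"
  proof (rule finite_subset)
    show "{j. f j \<noteq> 0} \<subseteq> (if ?K = {} then {} else {Min ?K..Max ?K})"
    proof
      fix j assume "j \<in> {j. f j \<noteq> 0}"
      hence fj: "f j \<noteq> 0" by simp
      then obtain i where i: "i \<in> ?K" "j < i"
        unfolding f_def by (metis (mono_tags, lifting) mem_Collect_eq sum.not_neutral_contains_not_neutral)
      \<comment> \<open>Below the support of S every index contributes, and the sum is the remainder
        times a power of c. This is where the vanishing remainder makes the quotient finitely
        supported.\<close>
      have "Min ?K \<le> j"
      proof (rule ccontr)
        assume "\<not> Min ?K \<le> j"
        hence eqK: "{i. i \<in> ?K \<and> j < i} = ?K"
          by (auto simp: not_le intro: order_less_le_trans)
        have "f j = (\<Sum>i\<in>?K. scoeff S i * fls_const (c powi i)) * fls_const (c powi (- 1 - j))"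
          unfolding f_def eqK sum_distrib_right
        proof (rule sum.cong[OF refl])
          fix i
          have "c powi (i - 1 - j) = c powi i * c powi (- 1 - j)"
            using power_int_add[of c i "- 1 - j"] c by (simp add: algebra_simps)
          thus "scoeff S i * fls_const (c powi (i - 1 - j)) =
              scoeff S i * fls_const (c powi i) * fls_const (c powi (- 1 - j))"
            by (simp add: mult.assoc)
        qed
        thus False using fj rem by simp
      qed
      moreover have "j \<le> Max ?K" using Max_ge[OF finite_keys i(1)] i(2) by linarith
      ultimately show "j \<in> (if ?K = {} then {} else {Min ?K..Max ?K})" using i by auto
    qed
  qed auto
  define Q where "Q = Abs_poly_mapping f"
  have Q: "scoeff Q j = f j" for j using fin by (simp add: Q_def)
  have "scoeff S j = f (j - 1) - f j * fls_const c" for j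
  proof -
    have "f (j - 1) = (\<Sum>i | i \<in> ?K \<and> (i = j \<or> j < i). scoeff S i * fls_const (c powi (i - j)))"
      unfolding f_def by (intro sum.cong) auto
    also have "{i. i \<in> ?K \<and> (i = j \<or> j < i)} = {i. i \<in> ?K \<and> i = j} \<union> {i. i \<in> ?K \<and> j < i}" by auto
    also have "(\<Sum>i\<in>\<dots>. scoeff S i * fls_const (c powi (i - j))) =
       (\<Sum>i | i \<in> ?K \<and> i = j. scoeff S i * fls_const (c powi (i - j))) + (\<Sum>i | i \<in> ?K \<and> j < i. scoeff S i * fls_const (c powi (i - j)))"
      by (rule sum.union_disjoint) auto
    also have "(\<Sum>i | i \<in> ?K \<and> i = j. scoeff S i * fls_const (c powi (i - j))) = scoeff S j"
    proof (cases "j \<in> ?K")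
      case True
      hence "{i. i \<in> ?K \<and> i = j} = {j}" by auto
      thus ?thesis by simp
    next
      case False
      hence "{i. i \<in> ?K \<and> i = j} = {}" by auto
      thus ?thesis using False by (simp add: in_keys_iff)
    qed
    also have "(\<Sum>i | i \<in> ?K \<and> j < i. scoeff S i * fls_const (c powi (i - j))) = f j * fls_const c"
      unfolding f_def sum_distrib_right
    proof (intro sum.cong refl)
      fix i
      have "c powi (i - j) = c powi (i - 1 - j) * c"
        using power_int_add[of c "i - 1 - j" 1] c by simp
      thus "scoeff S i * fls_const (c powi (i - j)) = scoeff S i * fls_const (c powi (i - 1 - j)) * fls_const c"
        by simp
    qed
    finally show ?thesis by simp
  qed
  hence "S = skew_mult q Q (linear_factor c)"
    by (intro poly_mapping_eqI) (simp add: scoeff_skew_mult_lin[OF q] Q)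
  thus ?thesis using Q unfolding f_def by blast
qed

subsection \<open>The coefficient fields\<close>

text \<open>One definition for both coefficient fields: \<open>A = {}\<close> imposes nothing beyond
  the expansion at 0 and gives the germs, \<open>A = UNIV\<close> the functions meromorphic on the
  plane.\<close>

definition germ_field :: "complex set \<Rightarrow> complex fls set" where
  "germ_field A = {F. \<exists>f. f meromorphic_on A \<and> f has_laurent_expansion F}"

lemma convergent_germs_eq: "convergent_germs = germ_field {}"
  by (simp add: convergent_germs_def germ_field_def)

lemma meromorphic_functions_eq: "meromorphic_functions = germ_field UNIV"
  by (simp add: meromorphic_functions_def germ_field_def)

lemma germ_field_const [simp, intro]: "fls_const c \<in> germ_field A"
  unfolding germ_field_def by (auto intro!: exI[of _ "\<lambda>_. c"] meromorphic_intros)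

lemma germ_field_0 [simp, intro]: "0 \<in> germ_field A"
  using germ_field_const[of 0] by simp

lemma germ_field_1 [simp, intro]: "1 \<in> germ_field A"
  using germ_field_const[of 1] by simp

lemma germ_field_add: "F \<in> germ_field A \<Longrightarrow> G \<in> germ_field A \<Longrightarrow> F + G \<in> germ_field A"
  unfolding germ_field_def mem_Collect_eq
  by (meson meromorphic_on_add has_laurent_expansion_add)

lemma germ_field_uminus: "F \<in> germ_field A \<Longrightarrow> - F \<in> germ_field A"
  unfolding germ_field_def mem_Collect_eq
  by (meson meromorphic_on_uminus has_laurent_expansion_minus)

lemma germ_field_diff: "F \<in> germ_field A \<Longrightarrow> G \<in> germ_field A \<Longrightarrow> F - G \<in> germ_field A"
  using germ_field_add[of F A "- G"] germ_field_uminus[of G A] by simp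

lemma germ_field_mult: "F \<in> germ_field A \<Longrightarrow> G \<in> germ_field A \<Longrightarrow> F * G \<in> germ_field A"
  unfolding germ_field_def mem_Collect_eq
  by (meson meromorphic_on_mult has_laurent_expansion_mult)

lemma germ_field_inverse: "F \<in> germ_field A \<Longrightarrow> inverse F \<in> germ_field A"
  unfolding germ_field_def mem_Collect_eq
  by (meson meromorphic_on_inverse has_laurent_expansion_inverse)

lemma germ_field_sum: "(\<And>x. x \<in> X \<Longrightarrow> F x \<in> germ_field A) \<Longrightarrow> sum F X \<in> germ_field A"
  by (induction X rule: infinite_finite_induct) (auto intro: germ_field_add)

lemma germ_field_X_intpow [simp, intro]: "fls_shift n 1 \<in> germ_field A"
proof -
  have "(\<lambda>z. z powi (- n)) has_laurent_expansion fls_X_intpow (- n)"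
    by (rule has_laurent_expansion_fps_X_power_int)
  moreover have "(\<lambda>z. z powi (- n)) meromorphic_on A"
    by (intro meromorphic_intros)
  ultimately show ?thesis unfolding germ_field_def by auto
qed

lemma has_laurent_expansion_q_shift:
  assumes "q \<noteq> 0" "f has_laurent_expansion F"
  shows "(\<lambda>z. f (q powi k * z)) has_laurent_expansion q_shift q k F"
proof -
  have "(\<lambda>z. q powi k * z) has_laurent_expansion fls_const (q powi k) * fls_X"
    by (intro laurent_expansion_intros)
  hence "(\<lambda>z. q powi k * z) has_laurent_expansion fps_to_fls (fps_const (q powi k) * fps_X)"
    by (simp add: fls_times_fps_to_fls)
  from has_laurent_expansion_compose[OF assms(2) this] show ?thesis
    using assms(1) by (simp add: q_shift_def o_def)
qed

lemma germ_field_q_shift: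
  assumes "q \<noteq> 0" "A = {} \<or> A = UNIV" "F \<in> germ_field A"
  shows "q_shift q k F \<in> germ_field A"
proof -
  obtain f where f: "f meromorphic_on A" "f has_laurent_expansion F"
    using assms(3) by (auto simp: germ_field_def)
  have "(\<lambda>z. f (q powi k * z)) meromorphic_on A"
    by (rule meromorphic_on_compose[OF f(1)]) (use assms(2) in \<open>auto intro!: analytic_intros\<close>)
  thus ?thesis using has_laurent_expansion_q_shift[OF assms(1) f(2)]
    unfolding germ_field_def by blast
qed

lemma skew_over_mult:
  assumes "q \<noteq> 0" "A = {} \<or> A = UNIV" "P \<in> skew_over (germ_field A)" "Q \<in> skew_over (germ_field A)"
  shows "skew_mult q P Q \<in> skew_over (germ_field A)"
  using assms unfolding skew_over_def
  by (auto simp: scoeff_skew_mult intro!: germ_field_sum germ_field_mult germ_field_q_shift)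

lemma skew_over_one: "1 \<in> skew_over (germ_field A)"
  by (auto simp: skew_over_def lookup_one when_def)

lemma skew_over_sterm: "a \<in> germ_field A \<Longrightarrow> sterm i a \<in> skew_over (germ_field A)"
  by (auto simp: skew_over_def scoeff_sterm)

lemma skew_over_diff:
  "P \<in> skew_over (germ_field A) \<Longrightarrow> Q \<in> skew_over (germ_field A) \<Longrightarrow> P - Q \<in> skew_over (germ_field A)"
  unfolding skew_over_def by (auto simp: lookup_minus intro!: germ_field_diff)

lemma skew_over_twist:
  assumes "P \<in> skew_over (germ_field A)"
  shows "twist q \<mu> P \<in> skew_over (germ_field A)"
  using assms unfolding skew_over_def
  by (auto simp: scoeff_twist twisted_coeff_def intro!: germ_field_mult)

section \<open>Meromorphic continuation by the functional equation\<close>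

lemma has_laurent_expansion_eval_fps:
  assumes "fps_conv_radius u > 0"
  shows "eval_fps u has_laurent_expansion fps_to_fls u"
  using assms by (intro has_laurent_expansion_fps) (simp add: has_fps_expansion_def)

lemma meromorphic_extension:
  fixes q :: complex
  assumes q: "norm q > 1" and J: "finite J" "\<And>i. i \<in> J \<Longrightarrow> i < n"
    and h: "\<And>i. i \<in> J \<Longrightarrow> h i meromorphic_on UNIV"
    and u: "fps_conv_radius u > 0"
    and eq: "eventually (\<lambda>w. eval_fps u w = (\<Sum>i\<in>J. h i w * eval_fps u (q powi (i - n) * w))) (at 0)"
  shows "fps_to_fls u \<in> germ_field UNIV"
proof -
  from eq obtain d where d: "d > 0"
    "\<And>w. w \<noteq> 0 \<Longrightarrow> norm w < d \<Longrightarrow> eval_fps u w = (\<Sum>i\<in>J. h i w * eval_fps u (q powi (i - n) * w))"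
    by (auto simp: eventually_at)
  obtain e where e: "0 < e" "ereal e < fps_conv_radius u"
    using u by (metis ereal_dense2 ereal_less(2) zero_ereal_def)
  define r where "r = min d e"
  have r: "r > 0" "r \<le> d" "ereal r < fps_conv_radius u"
    using d e le_less_trans[of "ereal r" "ereal e"] by (auto simp: r_def)
  \<comment> \<open>One use of the equation enlarges the disc by the factor \<open>|q|\<close>; consecutive iterates agree off \<open>0\<close>
    on the smaller disc, so no identity theorem is needed to glue them.\<close>
  define \<Phi> where "\<Phi> = (\<lambda>F w. \<Sum>i\<in>J. h i w * F (q powi (i - n) * w) :: complex)"
  define F where "F = (\<lambda>k. (\<Phi> ^^ k) (eval_fps u))"
  define R where "R = (\<lambda>k::nat. r * norm q ^ k)"
  have F_Suc: "F (Suc k) w = (\<Sum>i\<in>J. h i w * F k (q powi (i - n) * w))" for k w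
    by (simp add: F_def \<Phi>_def)
  have contract: "norm (q powi (i - n) * w) < R k" if "i \<in> J" "norm w < R (Suc k)" for i w k
  proof -
    have "norm q powi (i - n) \<le> norm q powi (-1)"
      by (rule power_int_increasing) (use J(2)[OF that(1)] q in auto)
    hence "norm (q powi (i - n) * w) \<le> norm w / norm q"
      using mult_right_mono[of "norm q powi (i - n)" "inverse (norm q)" "norm w"]
      by (simp add: norm_mult norm_power_int field_simps)
    also have "\<dots> < R k"
    proof -
      have "0 < norm q" using q by linarith
      thus ?thesis using that(2) by (simp add: R_def pos_divide_less_eq mult_ac)
    qed
    finally show ?thesis .
  qed
  have step: "F (Suc k) w = F k w" if "w \<noteq> 0" "norm w < R k" for k w
    using that
  proof (induction k arbitrary: w)
    case 0
    thus ?case using d(2)[of w] r unfolding F_Suc by (simp add: R_def F_def)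
  next
    case (Suc k)
    have "F (Suc k) (q powi (i - n) * w) = F k (q powi (i - n) * w)" if "i \<in> J" for i
      by (rule Suc.IH) (use Suc.prems contract[OF that] q in auto)
    thus ?case unfolding F_Suc[of "Suc k"] F_Suc[of k] by (intro sum.cong) auto
  qed
  have Rmono: "R k \<le> R (k + j)" for k j
    using r q unfolding R_def by (intro mult_left_mono power_increasing) auto
  have stable: "F (k + j) w = F k w" if "w \<noteq> 0" "norm w < R k" for k j w
  proof (induction j)
    case (Suc j)
    have "norm w < R (k + j)" using that(2) Rmono[of k j] by linarith
    thus ?case using step[OF that(1), of "k + j"] Suc by simp
  qed auto
  have mero: "F k meromorphic_on ball 0 (R k)" for k
  proof (induction k)
    case 0
    have "eval_fps u meromorphic_on ball 0 r"
      by (rule meromorphic_on_eval_fps)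
         (use r in \<open>auto intro!: analytic_intros elim!: order.strict_trans[rotated]\<close>)
    thus ?case by (simp add: F_def R_def)
  next
    case (Suc k)
    have "(\<lambda>w. \<Sum>i\<in>J. h i w * F k (q powi (i - n) * w)) meromorphic_on ball 0 (R (Suc k))"
    proof (intro meromorphic_on_sum meromorphic_on_mult)
      fix i assume i: "i \<in> J"
      show "h i meromorphic_on ball 0 (R (Suc k))"
        using h[OF i] by (rule meromorphic_on_subset) auto
      show "(\<lambda>w. F k (q powi (i - n) * w)) meromorphic_on ball 0 (R (Suc k))"
        by (rule meromorphic_on_compose[OF Suc.IH]) (use contract[OF i] in \<open>auto intro!: analytic_intros\<close>)
    qed
    thus ?case by (simp add: F_Suc[abs_def])
  qed
  define N where "N = (\<lambda>w::complex. LEAST k. norm w < R k)"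
  have ex: "\<exists>k. norm w < R k" for w :: complex
  proof -
    obtain k where "norm w / r < norm q ^ k" using real_arch_pow[OF q] by blast
    thus ?thesis using r by (auto simp: R_def field_simps)
  qed
  \<comment> \<open>The iterates need not agree at 0, so the value of G there is arbitrary.
    Meromorphy and the expansion at 0 depend on punctured neighbourhoods only.\<close>
  define G where "G = (\<lambda>w. F (N w) w)"
  have G: "G w = F k w" if "w \<noteq> 0" "norm w < R k" for w k
  proof -
    have "norm w < R (N w)" unfolding N_def using ex by (rule LeastI_ex)
    moreover have "N w \<le> k" unfolding N_def by (rule Least_le) (use that in auto)
    ultimately show ?thesis using stable[OF that(1), of "N w" "k - N w"] by (simp add: G_def)
  qed
  have ev: "eventually (\<lambda>w. G w = F k w) (at z)" if "norm z < R k" for z k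
  proof -
    have "eventually (\<lambda>w. w \<in> ball 0 (R k)) (at z)"
      by (rule eventually_at_in_open') (use that in auto)
    moreover have "eventually (\<lambda>w. w \<noteq> 0) (at z)"
      by (rule eventually_neq_at_within)
    ultimately show ?thesis by eventually_elim (use G in auto)
  qed
  have "G meromorphic_on UNIV"
  proof (subst meromorphic_on_meromorphic_at, intro ballI)
    fix z :: complex
    obtain k where k: "norm z < R k" using ex by blast
    have "F k meromorphic_on {z}" by (rule meromorphic_on_subset[OF mero[of k]]) (use k in auto)
    thus "G meromorphic_on {z}" using meromorphic_on_cong[of "{z}" G "F k" "{z}"] ev[OF k] by auto
  qed
  moreover have "G has_laurent_expansion fps_to_fls u"
  proof -
    have "eventually (\<lambda>w. G w = eval_fps u w) (at 0)"
      using ev[of 0 0] r by (simp add: R_def F_def)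
    thus ?thesis using has_laurent_expansion_eval_fps[OF u] has_laurent_expansion_cong by blast
  qed
  ultimately show ?thesis unfolding germ_field_def by blast
qed

text \<open>Dividing by a_n and applying \<sigma>_q^(-n) gives u(w) as a combination of the u(q^(i -
  n) w) with i < n, the form required by \<open>meromorphic_extension\<close>. For germs, the
  positive radius of convergence is already the claim.\<close>

lemma q_difference_solution_in_germ_field:
  fixes q :: complex
  assumes q: "norm q > 1" and A: "A = {} \<or> A = UNIV"
    and I: "finite I" "n \<in> I" "\<And>i. i \<in> I \<Longrightarrow> i \<le> n"
    and a: "\<And>i. i \<in> I \<Longrightarrow> a i \<in> germ_field A" "a n \<noteq> 0"
    and u: "fps_conv_radius u > 0"
    and eq: "(\<Sum>i\<in>I. a i * q_shift q i (fps_to_fls u)) = 0"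
  shows "fps_to_fls u \<in> germ_field A"
proof (cases "A = {}")
  case True
  thus ?thesis using has_laurent_expansion_eval_fps[OF u] by (auto simp: germ_field_def)
next
  case False
  hence [simp]: "A = UNIV" using A by simp
  have q0: "q \<noteq> 0" using q by auto
  let ?U = "fps_to_fls u"
  define J where "J = I - {n}"
  have J: "finite J" "\<And>i. i \<in> J \<Longrightarrow> i < n" using I(1,3) by (auto simp: J_def order_less_le)
  define b where "b = (\<lambda>i. q_shift q (- n) (- a i * inverse (a n)))"
  have "a n * q_shift q n ?U + (\<Sum>i\<in>J. a i * q_shift q i ?U) = 0"
    using eq sum.remove[OF I(1,2), of "\<lambda>i. a i * q_shift q i ?U"] by (simp add: J_def)
  hence "q_shift q n ?U = (\<Sum>i\<in>J. - a i * inverse (a n) * q_shift q i ?U)"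
  proof -
    assume "a n * q_shift q n ?U + (\<Sum>i\<in>J. a i * q_shift q i ?U) = 0"
    hence "a n * q_shift q n ?U = - (\<Sum>i\<in>J. a i * q_shift q i ?U)"
      by (simp add: eq_neg_iff_add_eq_0)
    hence "q_shift q n ?U = - (\<Sum>i\<in>J. a i * q_shift q i ?U) * inverse (a n)"
      using a(2) by (simp add: field_simps)
    also have "\<dots> = (\<Sum>i\<in>J. - a i * inverse (a n) * q_shift q i ?U)"
      by (simp add: sum_negf sum_distrib_left sum_distrib_right mult_ac)
    finally show ?thesis .
  qed
  hence "q_shift q (- n) (q_shift q n ?U) = q_shift q (- n) (\<Sum>i\<in>J. - a i * inverse (a n) * q_shift q i ?U)"
    by simp
  hence U: "?U = (\<Sum>i\<in>J. b i * q_shift q (i - n) ?U)"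
    unfolding b_def q_shift_q_shift[OF q0] q_shift_sum[OF q0] q_shift_mult[OF q0]
      uminus_add_conv_diff diff_self q_shift_zero[OF q0] .
  have "\<exists>h. \<forall>i\<in>J. h i meromorphic_on UNIV \<and> h i has_laurent_expansion b i"
  proof (rule bchoice, rule ballI)
    fix i assume "i \<in> J"
    hence "b i \<in> germ_field A" unfolding b_def
      by (intro germ_field_q_shift[OF q0 A] germ_field_mult germ_field_uminus germ_field_inverse)
         (use a I in \<open>auto simp: J_def\<close>)
    thus "\<exists>f. f meromorphic_on UNIV \<and> f has_laurent_expansion b i" by (simp add: germ_field_def)
  qed
  then obtain h where h: "\<And>i. i \<in> J \<Longrightarrow> h i meromorphic_on UNIV"
    "\<And>i. i \<in> J \<Longrightarrow> h i has_laurent_expansion b i" by blast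
  have "(\<lambda>w. \<Sum>i\<in>J. h i w * eval_fps u (q powi (i - n) * w)) has_laurent_expansion
      (\<Sum>i\<in>J. b i * q_shift q (i - n) ?U)"
    by (intro has_laurent_expansion_sum has_laurent_expansion_mult h
        has_laurent_expansion_q_shift[OF q0] has_laurent_expansion_eval_fps u)
  \<comment> \<open>Equal expansions give equality on a punctured neighbourhood of 0, which is all
    that the continuation starts from.\<close>
  hence ev: "eventually (\<lambda>w. eval_fls ?U w = (\<Sum>i\<in>J. h i w * eval_fps u (q powi (i - n) * w))) (at 0)"
    unfolding U[symmetric] by (simp add: has_laurent_expansion_def)
  have ev': "eventually (\<lambda>w. eval_fls ?U w = eval_fps u w) (at 0)"
    using has_laurent_expansion_eval_fps[OF u] by (simp add: has_laurent_expansion_def)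
  have "eventually (\<lambda>w. eval_fps u w = (\<Sum>i\<in>J. h i w * eval_fps u (q powi (i - n) * w))) (at 0)"
    using ev ev' by eventually_elim simp
  thus ?thesis using meromorphic_extension[OF q J h(1) u] by simp
qed

subsection \<open>Solving the \<open>q\<close>-difference equation\<close>

fun recursive_solution :: "(nat \<Rightarrow> nat \<Rightarrow> 'a :: field) \<Rightarrow> nat \<Rightarrow> 'a" where
  "recursive_solution a k =
     (if k = 0 then 1 else - (\<Sum>j<k. a k j * recursive_solution a j) / a k k)"

declare recursive_solution.simps [simp del]

text \<open>The zero in the corner leaves u_0 free to be 1; each later row then determines one new
  coefficient, as its diagonal entry is invertible.\<close>

lemma triangular_system:
  fixes a :: "nat \<Rightarrow> nat \<Rightarrow> 'a :: field"
  assumes "a 0 0 = 0" "\<And>k. k \<ge> 1 \<Longrightarrow> a k k \<noteq> 0"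
  shows "\<exists>!u. fps_nth u 0 = 1 \<and> (\<forall>k. (\<Sum>j\<le>k. a k j * fps_nth u j) = 0)"
proof (rule ex_ex1I)
  let ?u = "Abs_fps (recursive_solution a)"
  have "(\<Sum>j\<le>k. a k j * fps_nth ?u j) = 0" for k
  proof (cases k)
    case 0
    thus ?thesis using assms(1) by simp
  next
    case (Suc n)
    hence "a k k \<noteq> 0" using assms(2) by simp
    thus ?thesis
      using Suc by (simp add: lessThan_Suc_atMost[symmetric] recursive_solution.simps[of a "Suc n"])
  qed
  moreover have "fps_nth ?u 0 = 1" by (simp add: recursive_solution.simps)
  ultimately show "\<exists>u. fps_nth u 0 = 1 \<and> (\<forall>k. (\<Sum>j\<le>k. a k j * fps_nth u j) = 0)" by blast
next
  fix u v :: "'a fps"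
  assume u: "fps_nth u 0 = 1 \<and> (\<forall>k. (\<Sum>j\<le>k. a k j * fps_nth u j) = 0)"
    and v: "fps_nth v 0 = 1 \<and> (\<forall>k. (\<Sum>j\<le>k. a k j * fps_nth v j) = 0)"
  have "fps_nth u k = fps_nth v k" for k
  proof (induction k rule: less_induct)
    case (less k)
    show ?case
    proof (cases "k = 0")
      case False
      have "a k k * fps_nth u k + (\<Sum>j<k. a k j * fps_nth u j) = a k k * fps_nth v k + (\<Sum>j<k. a k j * fps_nth v j)"
        using u v by (simp add: ivl_disj_un_singleton(2)[symmetric] add.commute)
      moreover have "(\<Sum>j<k. a k j * fps_nth u j) = (\<Sum>j<k. a k j * fps_nth v j)"
        by (intro sum.cong) (use less in auto)
      ultimately show ?thesis using assms(2)[of k] False by simp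
    qed (use u v in auto)
  qed
  thus "u = v" by (rule fps_ext)
qed

section \<open>Coefficient bounds for the formal solution\<close>

lemma fps_conv_radius_pos_if_geometric:
  fixes u :: "complex fps"
  assumes B: "B > 0" and u: "\<And>k. norm (fps_nth u k) \<le> B ^ k"
  shows "fps_conv_radius u > 0"
proof -
  \<comment> \<open>Half of the radius 1 / B suggested by the bound, so that the terms are dominated
    by 2^(-k).\<close>
  define z where "z = complex_of_real (1 / (2 * B))"
  have z: "norm z = 1 / (2 * B)" using B by (simp add: z_def norm_divide norm_mult)
  have "summable (\<lambda>k. fps_nth u k * z ^ k)"
  proof (rule summable_comparison_test)
    show "\<exists>N. \<forall>k\<ge>N. norm (fps_nth u k * z ^ k) \<le> (1 / 2) ^ k"
    proof (intro exI allI impI)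
      fix k
      have "norm (fps_nth u k * z ^ k) \<le> B ^ k * (1 / (2 * B)) ^ k"
        unfolding norm_mult norm_power z using B by (intro mult_right_mono u) auto
      also have "\<dots> = (1 / 2) ^ k" using B by (simp flip: power_mult_distrib)
      finally show "norm (fps_nth u k * z ^ k) \<le> (1 / 2) ^ k" .
    qed
  qed (rule summable_geometric, simp)
  hence "ereal (norm z) \<le> fps_conv_radius u"
    unfolding fps_conv_radius_def by (rule conv_radius_geI)
  moreover have "0 < ereal (norm z)" using z B by simp
  ultimately show ?thesis by (rule less_le_trans[rotated])
qed

text \<open>After scaling by D^k, the identity M (1 + (1 + M) + ... + (1 + M)^(k - 1)) = (1 + M)^k -
  1 closes the induction; it dictates the ratio 1 + M.\<close>

lemma geometric_growth:
  fixes u :: "complex fps"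
  assumes M: "M \<ge> 0" and D: "D > 0" and u0: "norm (fps_nth u 0) \<le> 1"
    and u: "\<And>k. k \<ge> 1 \<Longrightarrow> norm (fps_nth u k) \<le> M * (\<Sum>j<k. D ^ (k - j) * norm (fps_nth u j))"
  shows "norm (fps_nth u k) \<le> (D * (1 + M)) ^ k"
proof (induction k rule: less_induct)
  case (less k)
  show ?case
  proof (cases "k = 0")
    case False
    have geo: "M * (\<Sum>j<k. (1 + M) ^ j) = (1 + M) ^ k - 1"
      using power_diff_1_eq[of "1 + M" k] by simp
    have "norm (fps_nth u k) \<le> M * (\<Sum>j<k. D ^ (k - j) * norm (fps_nth u j))"
      using False by (intro u) auto
    also have "\<dots> \<le> M * (\<Sum>j<k. D ^ (k - j) * (D * (1 + M)) ^ j)"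
      by (intro mult_left_mono sum_mono less) (use M D in auto)
    also have "(\<Sum>j<k. D ^ (k - j) * (D * (1 + M)) ^ j) = (\<Sum>j<k. D ^ k * (1 + M) ^ j)"
      by (intro sum.cong refl) (simp add: power_mult_distrib flip: power_add mult.assoc)
    also have "M * \<dots> = D ^ k * ((1 + M) ^ k - 1)"
      by (simp add: geo[symmetric] sum_distrib_left mult_ac)
    also have "\<dots> \<le> D ^ k * (1 + M) ^ k" using D by (intro mult_left_mono) auto
    finally show ?thesis by (simp add: power_mult_distrib)
  qed (use u0 in auto)
qed

lemma norm_fls_nth_le_geometric:
  assumes "F \<in> germ_field A"
  shows "\<exists>B>0. \<forall>m. norm (fls_nth F (l + int m)) \<le> B ^ Suc m"
proof -
  define f where "f = fls_regpart (fls_shift l F)"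
  have "fps_conv_radius f = fls_conv_radius F"
    by (simp add: f_def fps_conv_radius_fls_regpart)
  also have "\<dots> > 0" using assms by (auto simp: germ_field_def has_laurent_expansion_def)
  finally obtain e where e: "0 < e" "ereal e < fps_conv_radius f"
    by (metis ereal_dense2 ereal_less(2) zero_ereal_def)
  have "summable (\<lambda>m. fps_nth f m * of_real e ^ m)"
    using e by (intro summable_fps) auto
  hence "Bseq (\<lambda>m. fps_nth f m * of_real e ^ m)"
    by (intro convergent_imp_Bseq summable_LIMSEQ_zero[THEN convergentI])
  then obtain K where K: "K > 0" "\<And>m. norm (fps_nth f m * of_real e ^ m) \<le> K"
    by (auto simp: Bseq_def)
  \<comment> \<open>One number serves both as the constant and as the ratio of the geometric bound;
    hence the exponent \<open>Suc m\<close>.\<close>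
  define B where "B = max K (1 / e)"
  have B: "B > 0" "K \<le> B" "1 / e \<le> B" using K by (auto simp: B_def)
  have "norm (fls_nth F (l + int m)) \<le> B ^ Suc m" for m
  proof -
    have "norm (fps_nth f m) \<le> K * (1 / e) ^ m"
      using K(2)[of m] e by (simp add: norm_mult norm_power field_simps)
    also have "\<dots> \<le> B * B ^ m"
      by (intro mult_mono power_mono) (use B e in auto)
    finally show ?thesis by (simp add: f_def add.commute)
  qed
  thus ?thesis using B(1) by blast
qed

text \<open>Half the norm of the limit works from some index on, and the finitely many earlier terms
  are non-zero. Index 0 is left out because, in the application to an exponent c, the term at 0
  vanishes.\<close>

lemma bounded_below_if_tendsto:
  fixes X :: "nat \<Rightarrow> 'a :: real_normed_vector"
  assumes "X \<longlonglongrightarrow> L" "L \<noteq> 0" "\<And>k. k \<ge> 1 \<Longrightarrow> X k \<noteq> 0"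
  shows "\<exists>d>0. \<forall>k\<ge>1. d \<le> norm (X k)"
proof -
  have "(\<lambda>k. norm (X k)) \<longlonglongrightarrow> norm L" using assms(1) by (rule tendsto_norm)
  hence "eventually (\<lambda>k. norm L / 2 < norm (X k)) sequentially"
    by (rule order_tendstoD) (use assms(2) in auto)
  then obtain N where N: "\<And>k. k \<ge> N \<Longrightarrow> norm L / 2 < norm (X k)"
    by (auto simp: eventually_sequentially)
  define d where "d = Min (insert (norm L / 2) ((\<lambda>k. norm (X k)) ` {1..N}))"
  have "d > 0" unfolding d_def using assms by (subst Min_gr_iff) auto
  moreover have "d \<le> norm (X k)" if "k \<ge> 1" for k
  proof (cases "k \<le> N")
    case True
    thus ?thesis unfolding d_def using that by (intro Min_le) auto
  next
    case False
    have "d \<le> norm L / 2" unfolding d_def by (intro Min_le) auto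
    thus ?thesis using N[of k] False by linarith
  qed
  ultimately show ?thesis by blast
qed

text \<open>The coefficient of z^m in P with \<sigma>_q specialised to s. At s = c q^j it is the
  multiplier by which that layer acts on the j-th coefficient of u, hence an entry of the triangular
  system. For m = l it is \<open>symb\<close> evaluated at s, up to a power of s.\<close>

definition layer :: "skew \<Rightarrow> int \<Rightarrow> complex \<Rightarrow> complex" where
  "layer P m s = (\<Sum>i\<in>Poly_Mapping.keys P. fls_nth (scoeff P i) m * s powi i)"

text \<open>Two growths are separated: geometric in m, from the convergence of the coefficients of
  P, and at most |q|^(j n) in j, since no index exceeds n.\<close>

lemma layer_upper_bound:
  assumes q: "norm q > 1" and P: "P \<in> skew_over (germ_field A)" and n: "Poly_Mapping.keys P \<subseteq> {..n}"
  shows "\<exists>B C. B > 0 \<and> C \<ge> 0 \<and>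
    (\<forall>m j. norm (layer P (l + int m) (c * q ^ j)) \<le> B ^ Suc m * C * (norm q ^ j) powi n)"
proof -
  let ?K = "Poly_Mapping.keys P"
  have "\<forall>i\<in>?K. \<exists>B>0. \<forall>m. norm (fls_nth (scoeff P i) (l + int m)) \<le> B ^ Suc m"
    using P by (intro ballI norm_fls_nth_le_geometric[of _ A]) (auto simp: skew_over_def)
  then obtain b where b: "\<And>i. i \<in> ?K \<Longrightarrow> b i > 0"
    "\<And>i m. i \<in> ?K \<Longrightarrow> norm (fls_nth (scoeff P i) (l + int m)) \<le> b i ^ Suc m"
    by metis
  \<comment> \<open>The sum dominates every b_i at once; the summand 1 keeps B positive even for
    empty support.\<close>
  define B where "B = 1 + (\<Sum>i\<in>?K. b i)"
  have B0: "B > 0" unfolding B_def using b(1) by (intro add_pos_nonneg sum_nonneg) (auto intro: less_imp_le)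
  have bB: "b i \<le> B" if "i \<in> ?K" for i
  proof -
    have "b i \<le> (\<Sum>i\<in>?K. b i)"
      by (rule member_le_sum) (use that b(1) in \<open>auto intro: less_imp_le\<close>)
    thus ?thesis by (simp add: B_def)
  qed
  define C where "C = (\<Sum>i\<in>?K. norm c powi i)"
  have C: "C \<ge> 0" unfolding C_def by (intro sum_nonneg) auto
  have "norm (layer P (l + int m) (c * q ^ j)) \<le> B ^ Suc m * C * (norm q ^ j) powi n" for m j
  proof -
    have "norm (layer P (l + int m) (c * q ^ j)) \<le>
        (\<Sum>i\<in>?K. norm (fls_nth (scoeff P i) (l + int m) * (c * q ^ j) powi i))"
      unfolding layer_def by (rule norm_sum)
    also have "\<dots> \<le> (\<Sum>i\<in>?K. B ^ Suc m * (norm c powi i * (norm q ^ j) powi n))"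
    proof (rule sum_mono)
      fix i assume i: "i \<in> ?K"
      have "norm (fls_nth (scoeff P i) (l + int m)) \<le> B ^ Suc m"
        using b(2)[OF i] power_mono[OF bB[OF i], of "Suc m"] b(1)[OF i] by (meson less_imp_le order_trans)
      moreover have "(norm q ^ j) powi i \<le> (norm q ^ j) powi n"
        by (rule power_int_increasing) (use n i q in auto)
      ultimately show "norm (fls_nth (scoeff P i) (l + int m) * (c * q ^ j) powi i)
          \<le> B ^ Suc m * (norm c powi i * (norm q ^ j) powi n)"
        unfolding norm_mult norm_power_int norm_power power_int_mult_distrib
        by (intro mult_mono mult_left_mono) (use B0 in auto)
    qed
    also have "\<dots> = B ^ Suc m * C * (norm q ^ j) powi n"
      by (simp add: C_def sum_distrib_left sum_distrib_right mult_ac)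
    finally show ?thesis .
  qed
  thus ?thesis using B0 C by blast
qed

text \<open>Divided by (q^k)^n, every term with i < n tends to 0, as |q| > 1, and the term of index
  n is constant and non-zero. The last slope is felt here: it is what puts index n into the lowest
  layer.\<close>

lemma layer_lower_bound:
  assumes q: "norm q > 1" and n: "Poly_Mapping.keys P \<subseteq> {..n}" and top: "fls_nth (scoeff P n) l \<noteq> 0"
    and c: "c \<noteq> 0" and nz: "\<And>k::nat. k \<ge> 1 \<Longrightarrow> layer P l (c * q ^ k) \<noteq> 0"
  shows "\<exists>d>0. \<forall>k\<ge>1. d * (norm q ^ k) powi n \<le> norm (layer P l (c * q ^ k))"
proof -
  let ?K = "Poly_Mapping.keys P"
  have q0: "q \<noteq> 0" using q by auto
  define X where "X = (\<lambda>k. layer P l (c * q ^ k) / (q ^ k) powi n)"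
  have nK: "n \<in> ?K" using top by (auto simp: in_keys_iff)
  have "(\<lambda>k. \<Sum>i\<in>?K. fls_nth (scoeff P i) l * c powi i * (q powi (i - n)) ^ k) \<longlonglongrightarrow>
     (\<Sum>i\<in>?K. if i = n then fls_nth (scoeff P n) l * c powi n else 0)"
  proof (rule tendsto_sum)
    fix i assume i: "i \<in> ?K"
    show "(\<lambda>k. fls_nth (scoeff P i) l * c powi i * (q powi (i - n)) ^ k) \<longlonglongrightarrow>
        (if i = n then fls_nth (scoeff P n) l * c powi n else 0)"
    proof (cases "i = n")
      case False
      hence "i - n \<le> -1" using i n by auto
      hence "norm q powi (i - n) \<le> norm q powi (-1)" using q by (intro power_int_increasing) auto
      also have "\<dots> < 1" using q less_trans[OF zero_less_one q] by (simp add: inverse_less_1_iff)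
      finally have "norm (q powi (i - n)) < 1" by (simp add: norm_power_int)
      hence "(\<lambda>k. (q powi (i - n)) ^ k) \<longlonglongrightarrow> 0" by (rule LIMSEQ_power_zero)
      thus ?thesis using False tendsto_mult_right_zero by auto
    qed auto
  qed
  also have "(\<lambda>k. \<Sum>i\<in>?K. fls_nth (scoeff P i) l * c powi i * (q powi (i - n)) ^ k) = X"
  proof
    fix k
    have "(q powi (i - n)) ^ k = (q ^ k) powi i / (q ^ k) powi n" for i
    proof -
      have "(q powi (i - n)) ^ k = (q ^ k) powi (i - n)"
        by (metis power_int_mult power_int_of_nat mult.commute)
      thus ?thesis using q0 by (simp add: power_int_diff)
    qed
    thus "(\<Sum>i\<in>?K. fls_nth (scoeff P i) l * c powi i * (q powi (i - n)) ^ k) = X k"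
      by (simp add: X_def layer_def sum_divide_distrib power_int_mult_distrib mult_ac)
  qed
  also have "(\<Sum>i\<in>?K. if i = n then fls_nth (scoeff P n) l * c powi n else 0) = fls_nth (scoeff P n) l * c powi n"
    using nK by simp
  finally have lim: "X \<longlonglongrightarrow> fls_nth (scoeff P n) l * c powi n" .
  have Xnz: "X k \<noteq> 0" if "k \<ge> 1" for k using nz[OF that] q0 by (simp add: X_def)
  have "\<exists>d>0. \<forall>k\<ge>1. d \<le> norm (X k)"
    by (rule bounded_below_if_tendsto[OF lim _ Xnz]) (use top c in auto)
  then obtain d where d: "d > 0" "\<And>k. k \<ge> 1 \<Longrightarrow> d \<le> norm (X k)" by blast
  have "d * (norm q ^ k) powi n \<le> norm (layer P l (c * q ^ k))" if "k \<ge> 1" for k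
  proof -
    have pos: "(norm q ^ k) powi n > 0" using q0 by (intro zero_less_power_int) auto
    show ?thesis using d(2)[OF that] pos
      by (simp add: X_def norm_divide norm_power_int norm_power pos_le_divide_eq)
  qed
  thus ?thesis using d(1) by blast
qed

text \<open>The remainder of P u on right division by \<sigma>_q - c, set to zero: \<sigma>_q^i u
  equals \<sigma>_q^i(u) \<sigma>_q^i, and \<sigma>_q is then replaced by c.\<close>

definition q_difference_eq :: "complex \<Rightarrow> skew \<Rightarrow> complex \<Rightarrow> complex fps \<Rightarrow> bool" where
  "q_difference_eq q P c u \<longleftrightarrow>
     (\<Sum>i\<in>Poly_Mapping.keys P. scoeff P i * fls_const (c powi i) * q_shift q i (fps_to_fls u)) = 0"

lemma q_shift_fps_to_fls:
  assumes "q \<noteq> 0"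
  shows "q_shift q i (fps_to_fls u) = fps_to_fls (Abs_fps (\<lambda>j. fps_nth u j * q powi (i * int j)))"
  by (rule fls_eqI) (simp add: fls_nth_q_shift assms)

text \<open>In the coefficient of z^(l + k), the j-th coefficient of u comes with the factor q^(i j)
  from the shift, which turns c^i into (c q^j)^i.\<close>

lemma q_difference_eq_iff:
  assumes q: "q \<noteq> 0" and P: "val_ge l P"
  shows "q_difference_eq q P c u \<longleftrightarrow>
    (\<forall>k. (\<Sum>j\<le>k. layer P (l + int (k - j)) (c * q ^ j) * fps_nth u j) = 0)"
proof -
  let ?K = "Poly_Mapping.keys P"
  define S where "S = (\<Sum>i\<in>?K. scoeff P i * fls_const (c powi i) * q_shift q i (fps_to_fls u))"
  have v: "fls_nth (scoeff P i * fls_const (c powi i)) n = 0" if "n < l" for i n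
    using P that by (simp add: val_ge_def)
  have low: "fls_nth S n = 0" if "n < l" for n
    unfolding S_def fls_nth_sum
  proof (intro sum.neutral ballI)
    fix i
    show "fls_nth (scoeff P i * fls_const (c powi i) * q_shift q i (fps_to_fls u)) n = 0"
      by (rule fls_nth_mult_less[of l, OF v]) (use that q in \<open>auto simp: fls_nth_q_shift\<close>)
  qed
  have nth: "fls_nth S (l + int k) = (\<Sum>j\<le>k. layer P (l + int (k - j)) (c * q ^ j) * fps_nth u j)" for k
  proof -
    have "fls_nth S (l + int k) =
       (\<Sum>i\<in>?K. \<Sum>j\<le>k. fls_nth (scoeff P i) (l + int (k - j)) * c powi i * (fps_nth u j * q powi (i * int j)))"
      unfolding S_def fls_nth_sum q_shift_fps_to_fls[OF q]
      by (subst fls_nth_mult_fps[OF v]) auto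
    also have "\<dots> = (\<Sum>j\<le>k. \<Sum>i\<in>?K. fls_nth (scoeff P i) (l + int (k - j)) * c powi i * (fps_nth u j * q powi (i * int j)))"
      by (rule sum.swap)
    also have "\<dots> = (\<Sum>j\<le>k. layer P (l + int (k - j)) (c * q ^ j) * fps_nth u j)"
    proof -
      have *: "q powi (i * int j) = (q ^ j) powi i" for i j
        by (metis power_int_mult power_int_of_nat mult.commute)
      show ?thesis unfolding layer_def sum_distrib_right power_int_mult_distrib *
        by (intro sum.cong refl) (simp only: mult_ac)
    qed
    finally show ?thesis .
  qed
  have "S = 0 \<longleftrightarrow> (\<forall>k. fls_nth S (l + int k) = 0)"
  proof
    assume *: "\<forall>k. fls_nth S (l + int k) = 0"
    show "S = 0"
    proof (rule fls_eqI)
      fix n show "fls_nth S n = fls_nth 0 n"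
        using low[of n] *[rule_format, of "nat (n - l)"] by (cases "n < l") auto
    qed
  qed auto
  thus ?thesis unfolding q_difference_eq_def S_def[symmetric] nth .
qed

lemma q_difference_eq_ex1:
  assumes q: "q \<noteq> 0" and P: "val_ge l P"
    and root: "layer P l c = 0" and nz: "\<And>k::nat. k \<ge> 1 \<Longrightarrow> layer P l (c * q ^ k) \<noteq> 0"
  shows "\<exists>!u. fps_nth u 0 = 1 \<and> q_difference_eq q P c u"
  unfolding q_difference_eq_iff[OF q P]
  by (rule triangular_system) (use root nz in auto)

lemma q_difference_eq_in_germ_field:
  assumes q: "norm q > 1" and A: "A = {} \<or> A = UNIV" and P: "P \<in> skew_over (germ_field A)" "val_ge l P"
    and n: "Poly_Mapping.keys P \<subseteq> {..n}" and top: "fls_nth (scoeff P n) l \<noteq> 0"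
    and c: "c \<noteq> 0" and nz: "\<And>k::nat. k \<ge> 1 \<Longrightarrow> layer P l (c * q ^ k) \<noteq> 0"
    and u: "fps_nth u 0 = 1" "q_difference_eq q P c u"
  shows "fps_to_fls u \<in> germ_field A"
proof -
  have q0: "q \<noteq> 0" using q by auto
  let ?K = "Poly_Mapping.keys P"
  obtain B C where BC: "B > 0" "C \<ge> 0"
    "\<And>m j. norm (layer P (l + int m) (c * q ^ j)) \<le> B ^ Suc m * C * (norm q ^ j) powi n"
    using layer_upper_bound[OF q P(1) n] by metis
  obtain d where d: "d > 0" "\<And>k. k \<ge> 1 \<Longrightarrow> d * (norm q ^ k) powi n \<le> norm (layer P l (c * q ^ k))"
    using layer_lower_bound[OF q n top c nz] by metis
  \<comment> \<open>|q|^(j n) is |q|^(k n) times (|q|^(-n))^(k - j). Once the growth |q|^(k n) of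
    the multiplier is divided out, the remaining factor is geometric in k - j, whatever the sign of
    n. M is the quotient of the constants in the upper and the lower bound, with one extra B from
    \<open>Suc\<close>.\<close>
  define D where "D = B * norm q powi (- n)"
  define M where "M = B * C / d"
  have D: "D > 0" unfolding D_def using BC q0 by (intro mult_pos_pos zero_less_power_int) auto
  have M: "M \<ge> 0" unfolding M_def using BC d by auto
  have "norm (fps_nth u k) \<le> M * (\<Sum>j<k. D ^ (k - j) * norm (fps_nth u j))" if k: "k \<ge> 1" for k
  proof -
    let ?Q = "(norm q ^ k) powi n"
    have Q: "?Q > 0" using q0 by (intro zero_less_power_int) auto
    have "(\<Sum>j\<le>k. layer P (l + int (k - j)) (c * q ^ j) * fps_nth u j) = 0"
      using u(2) q_difference_eq_iff[OF q0 P(2)] by blast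
    hence "layer P l (c * q ^ k) * fps_nth u k = - (\<Sum>j<k. layer P (l + int (k - j)) (c * q ^ j) * fps_nth u j)"
      by (simp add: ivl_disj_un_singleton(2)[symmetric] eq_neg_iff_add_eq_0)
    hence "norm (layer P l (c * q ^ k)) * norm (fps_nth u k) =
        norm (\<Sum>j<k. layer P (l + int (k - j)) (c * q ^ j) * fps_nth u j)"
      by (metis norm_mult norm_minus_cancel)
    also have "\<dots> \<le> (\<Sum>j<k. norm (layer P (l + int (k - j)) (c * q ^ j) * fps_nth u j))"
      by (rule norm_sum)
    also have "\<dots> \<le> (\<Sum>j<k. B ^ Suc (k - j) * C * (norm q ^ j) powi n * norm (fps_nth u j))"
      unfolding norm_mult by (intro sum_mono mult_right_mono BC) auto
    also have "\<dots> = (\<Sum>j<k. B * C * ?Q * (D ^ (k - j) * norm (fps_nth u j)))"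
    proof (intro sum.cong refl)
      fix j assume "j \<in> {..<k}"
      hence k_eq: "k = j + (k - j)" by simp
      have "(norm q ^ j) powi n = ?Q * (norm q powi (- n)) ^ (k - j)"
      proof -
        have "(norm q powi (- n)) ^ (k - j) = (norm q ^ (k - j)) powi (- n)"
          by (metis power_int_mult power_int_of_nat mult.commute)
        moreover have "?Q = (norm q ^ j) powi n * (norm q ^ (k - j)) powi n"
          by (subst k_eq) (simp only: power_add power_int_mult_distrib)
        ultimately show ?thesis using q0 by (simp add: power_int_minus)
      qed
      thus "B ^ Suc (k - j) * C * (norm q ^ j) powi n * norm (fps_nth u j) =
          B * C * ?Q * (D ^ (k - j) * norm (fps_nth u j))"
        by (simp add: D_def power_mult_distrib mult_ac)
    qed
    finally have "norm (layer P l (c * q ^ k)) * norm (fps_nth u k) \<le>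
        B * C * ?Q * (\<Sum>j<k. D ^ (k - j) * norm (fps_nth u j))"
      by (simp add: sum_distrib_left)
    moreover have "d * ?Q * norm (fps_nth u k) \<le> norm (layer P l (c * q ^ k)) * norm (fps_nth u k)"
      using d(2)[OF k] by (intro mult_right_mono) auto
    ultimately have "d * ?Q * norm (fps_nth u k) \<le> B * C * ?Q * (\<Sum>j<k. D ^ (k - j) * norm (fps_nth u j))"
      by linarith
    hence "?Q * (d * norm (fps_nth u k)) \<le> ?Q * (B * C * (\<Sum>j<k. D ^ (k - j) * norm (fps_nth u j)))"
      by (simp add: mult_ac)
    hence "d * norm (fps_nth u k) \<le> B * C * (\<Sum>j<k. D ^ (k - j) * norm (fps_nth u j))"
      using Q by (simp only: mult_le_cancel_left_pos)
    thus ?thesis using d(1) by (simp add: M_def field_simps)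
  qed
  hence "norm (fps_nth u k) \<le> (D * (1 + M)) ^ k" for k
    by (intro geometric_growth M D) (use u in auto)
  hence radius: "fps_conv_radius u > 0"
    by (intro fps_conv_radius_pos_if_geometric[of "D * (1 + M)"]) (use D M in auto)
  show ?thesis
  proof (rule q_difference_solution_in_germ_field[OF q A])
    show "n \<in> ?K" using top by (auto simp: in_keys_iff)
    show "(\<Sum>i\<in>?K. scoeff P i * fls_const (c powi i) * q_shift q i (fps_to_fls u)) = 0"
      using u(2) by (simp add: q_difference_eq_def)
    show "scoeff P n * fls_const (c powi n) \<noteq> 0" using top c by auto
  qed (use n P radius in \<open>auto intro!: germ_field_mult simp: skew_over_def\<close>)
qed

subsection \<open>Factorizations\<close>

lemma elem_factor_0:
  "elem_factor q 0 c u = skew_mult q (linear_factor c) (sterm 0 (inverse (fps_to_fls u)))"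
  by (simp add: elem_factor_def)

text \<open>With u(0) = 1 the inverse of u is again a power series with constant term 1, so both
  coefficients of the factor have only non-negative powers of z.\<close>

lemma scoeff_elem_factor_0:
  assumes "q \<noteq> 0" "fps_nth u 0 = 1"
  shows "scoeff (elem_factor q 0 c u) k =
    (if k = 1 then q_shift q 1 (fps_to_fls (inverse u))
     else if k = 0 then - fls_const c * fps_to_fls (inverse u) else 0)"
  using assms
  by (auto simp: elem_factor_0 scoeff_skew_mult_sterm_right lookup_minus scoeff_sterm fls_inverse_fps_to_fls
      subdegree_eq_0_iff)

lemma keys_elem_factor_0:
  assumes "q \<noteq> 0" "fps_nth u 0 = 1"
  shows "Poly_Mapping.keys (elem_factor q 0 c u) \<subseteq> {0..1}"
  by (auto simp: in_keys_iff scoeff_elem_factor_0 assms split: if_splits)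

lemma val_ge_elem_factor_0:
  assumes "q \<noteq> 0" "fps_nth u 0 = 1"
  shows "val_ge 0 (elem_factor q 0 c u)"
  unfolding val_ge_def scoeff_elem_factor_0[OF assms]
  by (auto simp: fls_nth_q_shift assms)

lemma symb_elem_factor_0:
  assumes "q \<noteq> 0" "fps_nth u 0 = 1"
  shows "symb 0 0 (elem_factor q 0 c u) = [:- c, 1:]"
proof (rule poly_eqI)
  fix k
  have "Poly_Mapping.keys (elem_factor q 0 c u) \<subseteq> {0..}"
    using keys_elem_factor_0[OF assms] by fastforce
  thus "coeff (symb 0 0 (elem_factor q 0 c u)) k = coeff [:- c, 1:] k"
    by (auto simp: coeff_symb scoeff_elem_factor_0 assms fls_nth_q_shift coeff_pCons split: nat.split)
qed

lemma skew_over_elem_factor_0: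
  assumes "q \<noteq> 0" "A = {} \<or> A = UNIV" "fps_to_fls u \<in> germ_field A"
  shows "elem_factor q 0 c u \<in> skew_over (germ_field A)"
  unfolding elem_factor_0
  by (intro skew_over_mult skew_over_diff skew_over_sterm germ_field_inverse assms) auto

section \<open>Splitting off one elementary factor\<close>

lemma keys_skew_mult_sterm_0:
  "q \<noteq> 0 \<Longrightarrow> Poly_Mapping.keys (skew_mult q P (sterm 0 a)) \<subseteq> Poly_Mapping.keys P"
  by (auto simp: in_keys_iff scoeff_skew_mult_sterm_right)

lemma q_difference_eq_altdef:
  assumes "q \<noteq> 0" "finite I" "Poly_Mapping.keys P \<subseteq> I"
  shows "q_difference_eq q P c u \<longleftrightarrow>
    (\<Sum>i\<in>I. scoeff (skew_mult q P (sterm 0 (fps_to_fls u))) i * fls_const (c powi i)) = 0"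
proof -
  have "(\<Sum>i\<in>I. scoeff (skew_mult q P (sterm 0 (fps_to_fls u))) i * fls_const (c powi i)) =
      (\<Sum>i\<in>Poly_Mapping.keys P. scoeff (skew_mult q P (sterm 0 (fps_to_fls u))) i * fls_const (c powi i))"
    by (rule sum.mono_neutral_right) (use assms in \<open>auto simp: scoeff_skew_mult_sterm_right in_keys_iff\<close>)
  thus ?thesis
    by (simp add: q_difference_eq_def scoeff_skew_mult_sterm_right assms mult_ac)
qed

text \<open>As u is invertible, u^(-1) can be moved to the other side; the question becomes whether
  P u is right divisible by \<sigma>_q - c.\<close>

lemma skew_mult_elem_factor_iff:
  assumes q: "q \<noteq> 0" and u: "fps_nth u 0 = 1"
  shows "P = skew_mult q Q (elem_factor q 0 c u) \<longleftrightarrow>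
    skew_mult q P (sterm 0 (fps_to_fls u)) = skew_mult q Q (linear_factor c)"
proof -
  let ?U = "fps_to_fls u"
  have nz: "?U \<noteq> 0" using u by (metis fps_to_fls_eq_0_iff fps_zero_nth zero_neq_one)
  have inv: "inverse ?U * ?U = 1" "?U * inverse ?U = 1"
    using left_inverse[OF nz] right_inverse[OF nz] by auto
  have 1: "skew_mult q (sterm 0 (inverse ?U)) (sterm 0 ?U) = 1"
    by (rule poly_mapping_eqI)
       (auto simp: scoeff_skew_mult_sterm_left scoeff_sterm lookup_one when_def q inv)
  have 2: "skew_mult q (sterm 0 ?U) (sterm 0 (inverse ?U)) = 1"
    by (rule poly_mapping_eqI)
       (auto simp: scoeff_skew_mult_sterm_left scoeff_sterm lookup_one when_def q inv)
  show ?thesis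
  proof
    assume "P = skew_mult q Q (elem_factor q 0 c u)"
    thus "skew_mult q P (sterm 0 ?U) = skew_mult q Q (linear_factor c)"
      by (simp add: elem_factor_0 skew_mult_assoc q 1)
  next
    assume eq: "skew_mult q P (sterm 0 ?U) = skew_mult q Q (linear_factor c)"
    have "P = skew_mult q (skew_mult q P (sterm 0 ?U)) (sterm 0 (inverse ?U))"
      by (simp add: skew_mult_assoc q 2)
    thus "P = skew_mult q Q (elem_factor q 0 c u)"
      by (simp add: eq elem_factor_0 skew_mult_assoc q)
  qed
qed

text \<open>Divisibility makes the remainder vanish, so both u and u' solve the q-difference
  equation and coincide; the quotients then agree because \<sigma>_q - c can be cancelled on the
  right.\<close>

lemma right_factor_unique:
  assumes q: "q \<noteq> 0" and c: "c \<noteq> 0"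
    and uniq: "\<exists>!u. fps_nth u 0 = 1 \<and> q_difference_eq q P c u"
    and 1: "fps_nth u 0 = 1" "P = skew_mult q Q (elem_factor q 0 c u)"
    and 2: "fps_nth u' 0 = 1" "P = skew_mult q Q' (elem_factor q 0 c u')"
  shows "u' = u" "Q' = Q"
proof -
  have ueq: "q_difference_eq q P c w"
    if "fps_nth w 0 = 1" "P = skew_mult q R (elem_factor q 0 c w)" for w R
  proof -
    have eq: "skew_mult q P (sterm 0 (fps_to_fls w)) = skew_mult q R (linear_factor c)"
      using skew_mult_elem_factor_iff[OF q that(1)] that(2) by simp
    show ?thesis
      unfolding q_difference_eq_altdef[OF q finite_keys subset_refl] eq
      by (rule skew_mult_lin_remainder[OF q c])
         (use keys_skew_mult_sterm_0[OF q, of P "fps_to_fls w"] in \<open>auto simp: eq\<close>)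
  qed
  show "u' = u" using uniq ueq[OF 1] ueq[OF 2] 1(1) 2(1) by blast
  hence "skew_mult q Q' (linear_factor c) = skew_mult q Q (linear_factor c)"
    using skew_mult_elem_factor_iff[OF q 1(1)] 1(2) 2(2) by metis
  thus "Q' = Q" by (rule skew_mult_lin_cancel[OF q])
qed

text \<open>The quotient satisfies the same conditions on coefficients, valuation, support and top
  coefficient as P, with n - 1 in place of n, so the step can be iterated.\<close>

lemma right_factor_exists:
  assumes q: "norm q > 1" and A: "A = {} \<or> A = UNIV" and P: "P \<in> skew_over (germ_field A)" "val_ge l P"
    and N: "Poly_Mapping.keys P \<subseteq> {N..n}" and top: "fls_nth (scoeff P n) l \<noteq> 0"
    and c: "c \<noteq> 0" and root: "layer P l c = 0"
    and nz: "\<And>k::nat. k \<ge> 1 \<Longrightarrow> layer P l (c * q ^ k) \<noteq> 0"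
  obtains u Q where "fps_nth u 0 = 1" "fps_to_fls u \<in> germ_field A"
    "P = skew_mult q Q (elem_factor q 0 c u)" "Q \<in> skew_over (germ_field A)" "val_ge l Q"
    "Poly_Mapping.keys Q \<subseteq> {N..n - 1}" "fls_nth (scoeff Q (n - 1)) l \<noteq> 0"
proof -
  have q0: "q \<noteq> 0" using q by auto
  obtain u where u: "fps_nth u 0 = 1" "q_difference_eq q P c u"
    using q_difference_eq_ex1[OF q0 P(2) root nz] by blast
  have uK: "fps_to_fls u \<in> germ_field A"
    by (rule q_difference_eq_in_germ_field[OF q A P _ top c nz u]) (use N in auto)
  define S where "S = skew_mult q P (sterm 0 (fps_to_fls u))"
  have S: "scoeff S i = scoeff P i * q_shift q i (fps_to_fls u)" for i
    by (simp add: S_def scoeff_skew_mult_sterm_right q0)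
  have "val_ge 0 (sterm 0 (fps_to_fls u))"
    by (auto simp: val_ge_def scoeff_sterm)
  hence S_val: "val_ge l S" unfolding S_def by (rule val_ge_skew_mult[OF q0 P(2)])
  have S_over: "S \<in> skew_over (germ_field A)"
    unfolding S_def by (intro skew_over_mult q0 A P skew_over_sterm uK)
  have S_keys: "Poly_Mapping.keys S \<subseteq> {N..n}"
    using keys_skew_mult_sterm_0[OF q0] N unfolding S_def by blast
  have S_top: "fls_nth (scoeff S n) l = fls_nth (scoeff P n) l"
    unfolding S using P(2) u(1)
    by (subst fls_nth_mult_least) (auto simp: val_ge_def fls_nth_q_shift q0)
  have "(\<Sum>i\<in>{N..n}. scoeff S i * fls_const (c powi i)) = 0"
    using q_difference_eq_altdef[OF q0, of "{N..n}"] N u(2) by (simp add: S_def)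
  moreover have "(\<Sum>i\<in>Poly_Mapping.keys S. scoeff S i * fls_const (c powi i)) =
      (\<Sum>i\<in>{N..n}. scoeff S i * fls_const (c powi i))"
    by (rule sum.mono_neutral_left) (use S_keys in \<open>auto simp: in_keys_iff\<close>)
  ultimately have rem: "(\<Sum>i\<in>Poly_Mapping.keys S. scoeff S i * fls_const (c powi i)) = 0" by simp
  obtain Q where Q: "S = skew_mult q Q (linear_factor c)"
    "\<And>j. scoeff Q j = (\<Sum>i | i \<in> Poly_Mapping.keys S \<and> j < i. scoeff S i * fls_const (c powi (i - 1 - j)))"
    using right_division[OF q0 c rem] by blast
  have Q_over: "Q \<in> skew_over (germ_field A)"
    using S_over unfolding skew_over_def by (auto simp: Q(2) intro!: germ_field_sum germ_field_mult)
  have Q_val: "val_ge l Q"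
    using S_val unfolding val_ge_def by (auto simp: Q(2) fls_nth_sum)
  have up: "j < n" if "j \<in> Poly_Mapping.keys Q" for j
  proof (rule ccontr)
    assume "\<not> j < n"
    hence empty: "{i. i \<in> Poly_Mapping.keys S \<and> j < i} = {}" using S_keys by auto
    have "scoeff Q j = 0" unfolding Q(2) empty by simp
    thus False using that by (simp add: in_keys_iff)
  qed
  \<comment> \<open>The lowest coefficient of Q, times -c, is a coefficient of S at the same index;
    as c is non-zero, Q cannot start below S.\<close>
  have low: "N \<le> j" if "j \<in> Poly_Mapping.keys Q" for j
  proof -
    define m where "m = Min (Poly_Mapping.keys Q)"
    have m: "m \<in> Poly_Mapping.keys Q" "m \<le> j" unfolding m_def using that by (auto intro!: Min_in Min_le)
    have "m - 1 \<notin> Poly_Mapping.keys Q"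
      using Min_le[OF finite_keys, of "m - 1" Q] by (auto simp: m_def)
    hence "scoeff S m = - scoeff Q m * fls_const c"
      unfolding Q(1) by (simp add: scoeff_skew_mult_lin q0 in_keys_iff)
    hence "m \<in> Poly_Mapping.keys S" using m(1) c by (simp add: in_keys_iff)
    thus ?thesis using S_keys m(2) by auto
  qed
  have "scoeff Q n = 0" using up[of n] by (auto simp: in_keys_iff)
  hence "scoeff S n = scoeff Q (n - 1)" unfolding Q(1) by (simp add: scoeff_skew_mult_lin q0)
  hence Q_top: "fls_nth (scoeff Q (n - 1)) l \<noteq> 0" using S_top top by simp
  have "P = skew_mult q Q (elem_factor q 0 c u)"
    using skew_mult_elem_factor_iff[OF q0 u(1)] Q(1) S_def by simp
  thus ?thesis
    by (intro that[OF u(1) uK _ Q_over Q_val _ Q_top]) (use up low in force)+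
qed

text \<open>The slope 0 form of the product R_1 ... R_p as one flat list. The index type is
  arbitrary, so that equal exponents can carry different series u.\<close>

definition chain :: "complex \<Rightarrow> ('a \<Rightarrow> complex) \<Rightarrow> ('a \<Rightarrow> complex fps) \<Rightarrow> 'a list \<Rightarrow> skew" where
  "chain q c u xs = skew_prod q (map (\<lambda>x. elem_factor q 0 (c x) (u x)) xs)"

lemma chain_Nil [simp]: "chain q c u [] = 1"
  by (simp add: chain_def)

lemma chain_snoc:
  "q \<noteq> 0 \<Longrightarrow> chain q c u (xs @ [x]) = skew_mult q (chain q c u xs) (elem_factor q 0 (c x) (u x))"
  by (simp add: chain_def skew_prod_append)

lemma chain_cong: "(\<And>x. x \<in> set xs \<Longrightarrow> u x = v x) \<Longrightarrow> chain q c u xs = chain q c v xs"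
  unfolding chain_def by (intro arg_cong[of _ _ "skew_prod q"] map_cong) auto

lemma chain_properties:
  assumes q: "q \<noteq> 0" and u: "\<forall>x\<in>set xs. fps_nth (u x) 0 = 1"
  shows "val_ge 0 (chain q c u xs) \<and> Poly_Mapping.keys (chain q c u xs) \<subseteq> {0..int (length xs)} \<and>
    symb 0 0 (chain q c u xs) = (\<Prod>x\<leftarrow>xs. [:- c x, 1:])"
  using u
proof (induction xs rule: rev_induct)
  case Nil
  have "symb 0 0 1 = 1" by (simp add: symb_def lookup_one)
  thus ?case by (auto simp: val_ge_def lookup_one when_def)
next
  case (snoc x xs)
  let ?C = "chain q c u xs" and ?E = "elem_factor q 0 (c x) (u x)"
  from snoc have IH: "val_ge 0 ?C" "Poly_Mapping.keys ?C \<subseteq> {0..int (length xs)}"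
    "symb 0 0 ?C = (\<Prod>x\<leftarrow>xs. [:- c x, 1:])" and ux: "fps_nth (u x) 0 = 1" by auto
  have E: "val_ge 0 ?E" "Poly_Mapping.keys ?E \<subseteq> {0..1}" "symb 0 0 ?E = [:- c x, 1:]"
    using val_ge_elem_factor_0 keys_elem_factor_0 symb_elem_factor_0 q ux by blast+
  have keys: "Poly_Mapping.keys ?C \<subseteq> {0..}" "Poly_Mapping.keys ?E \<subseteq> {0..}"
     "Poly_Mapping.keys ?C \<subseteq> {..int (length xs)}" "Poly_Mapping.keys ?E \<subseteq> {..1}"
    using IH(2) E(2) by auto
  have "Poly_Mapping.keys (skew_mult q ?C ?E) \<subseteq> {0..int (length (xs @ [x]))}"
    using keys_skew_mult_ge[OF keys(1,2), of q] keys_skew_mult_le[OF keys(3,4), of q] by fastforce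
  thus ?case
    unfolding chain_snoc[OF q]
    using val_ge_skew_mult[OF q IH(1) E(1)] symb_skew_mult[OF q IH(1) keys(1) E(1) keys(2)] IH(3) E(3)
    by simp
qed

lemma skew_over_chain:
  assumes q: "q \<noteq> 0" and A: "A = {} \<or> A = UNIV" and u: "\<forall>x\<in>set xs. fps_to_fls (u x) \<in> germ_field A"
  shows "chain q c u xs \<in> skew_over (germ_field A)"
  using u by (induction xs rule: rev_induct)
    (auto simp: chain_snoc q skew_over_one intro!: skew_over_mult[OF q A] skew_over_elem_factor_0[OF q A])

lemma poly_prod_linear_eq_0_iff:
  fixes c :: "'a \<Rightarrow> 'b :: idom"
  shows "poly (\<Prod>x\<leftarrow>xs. [:- c x, 1:]) s = 0 \<longleftrightarrow> (\<exists>x\<in>set xs. s = c x)"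
  by (induction xs) auto

text \<open>Induction from the right end of the list. When x is the last entry, the symbol has the
  root c x, and c x q^k for k \<ge> 1 must be a root neither of G nor of the factors to its left;
  the two non-resonance hypotheses say this. P and n vary in the induction, while N, l and G are
  fixed.\<close>

lemma chain_factorization:
  assumes q: "norm q > 1" and A: "A = {} \<or> A = UNIV"
    and xs: "distinct xs" "\<forall>x\<in>set xs. c x \<noteq> 0"
    and nonres: "sorted_wrt (\<lambda>x y. \<forall>k::nat. k \<ge> 1 \<longrightarrow> c x \<noteq> c y * q ^ k) xs"
      "\<forall>x\<in>set xs. \<forall>k::nat. k \<ge> 1 \<longrightarrow> poly G (c x * q ^ k) \<noteq> 0"
    and P: "P \<in> skew_over (germ_field A)" "val_ge l P" "Poly_Mapping.keys P \<subseteq> {N..n}"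
      "fls_nth (scoeff P n) l \<noteq> 0" "symb N l P = G * (\<Prod>x\<leftarrow>xs. [:- c x, 1:])"
  shows "\<exists>Q u. (\<forall>x\<in>set xs. fps_nth (u x) 0 = 1 \<and> fps_to_fls (u x) \<in> germ_field A) \<and>
     P = skew_mult q Q (chain q c u xs) \<and> Q \<in> skew_over (germ_field A) \<and> val_ge l Q \<and>
     Poly_Mapping.keys Q \<subseteq> {N..} \<and> symb N l Q = G \<and>
     (\<forall>Q' u'. (\<forall>x\<in>set xs. fps_nth (u' x) 0 = 1) \<and> P = skew_mult q Q' (chain q c u' xs) \<longrightarrow>
        Q' = Q \<and> (\<forall>x\<in>set xs. u' x = u x))"
  using xs nonres P
proof (induction xs arbitrary: P n rule: rev_induct)
  case Nil
  have "q \<noteq> 0" using q by auto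
  thus ?case using Nil by (intro exI[of _ P]) auto
next
  case (snoc x xs)
  have q0: "q \<noteq> 0" using q by auto
  define cx where "cx = c x"
  have x: "x \<notin> set xs" and cx: "cx \<noteq> 0" using snoc.prems by (auto simp: cx_def)
  have keysN: "Poly_Mapping.keys P \<subseteq> {N..}" using snoc.prems by auto
  have lay: "layer P l s = s powi N * (poly G s * (poly (\<Prod>x\<leftarrow>xs. [:- c x, 1:]) s * (s - cx)))" if "s \<noteq> 0" for s
    unfolding layer_def poly_symb[OF keysN that] snoc.prems(9) cx_def by (simp add: algebra_simps)
  have root: "layer P l cx = 0" using lay[OF cx] by simp
  have nz: "layer P l (cx * q ^ k) \<noteq> 0" if k: "k \<ge> 1" for k
  proof -
    have "norm (q ^ k) > 1" using q k by (simp add: norm_power one_less_power)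
    hence "q ^ k \<noteq> 1" by auto
    hence "cx * q ^ k - cx \<noteq> 0" using cx by (simp add: algebra_simps)
    moreover have "poly G (cx * q ^ k) \<noteq> 0" using snoc.prems k by (auto simp: cx_def)
    moreover have "poly (\<Prod>x\<leftarrow>xs. [:- c x, 1:]) (cx * q ^ k) \<noteq> 0"
      using snoc.prems(3) k by (fastforce simp: poly_prod_linear_eq_0_iff sorted_wrt_append cx_def)
    ultimately show ?thesis using lay[of "cx * q ^ k"] cx q0 by auto
  qed
  obtain w Q1 where 1: "fps_nth w 0 = 1" "fps_to_fls w \<in> germ_field A"
    "P = skew_mult q Q1 (elem_factor q 0 cx w)" "Q1 \<in> skew_over (germ_field A)" "val_ge l Q1"
    "Poly_Mapping.keys Q1 \<subseteq> {N..n - 1}" "fls_nth (scoeff Q1 (n - 1)) l \<noteq> 0"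
    by (rule right_factor_exists[OF q A snoc.prems(5,6,7,8) cx root nz])
  have E: "val_ge 0 (elem_factor q 0 cx w)" "Poly_Mapping.keys (elem_factor q 0 cx w) \<subseteq> {0..}"
    using val_ge_elem_factor_0 keys_elem_factor_0[OF q0 1(1), of cx] q0 1(1) by auto
  have "symb N l P = symb N l Q1 * [:- cx, 1:]"
    unfolding 1(3) using symb_skew_mult[OF q0 1(5) _ E] 1(6) symb_elem_factor_0[OF q0 1(1), of cx] by force
  hence "symb N l Q1 * [:- cx, 1:] = (G * (\<Prod>x\<leftarrow>xs. [:- c x, 1:])) * [:- cx, 1:]"
    using snoc.prems(9)
    by (simp only: cx_def map_append prod_list.append list.map prod_list.Cons prod_list.Nil mult_1_right mult.assoc)
  hence symb1: "symb N l Q1 = G * (\<Prod>x\<leftarrow>xs. [:- c x, 1:])"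
    by (subst (asm) mult_right_cancel) auto
  have "\<exists>Q u. (\<forall>x\<in>set xs. fps_nth (u x) 0 = 1 \<and> fps_to_fls (u x) \<in> germ_field A) \<and>
     Q1 = skew_mult q Q (chain q c u xs) \<and> Q \<in> skew_over (germ_field A) \<and> val_ge l Q \<and>
     Poly_Mapping.keys Q \<subseteq> {N..} \<and> symb N l Q = G \<and>
     (\<forall>Q' u'. (\<forall>x\<in>set xs. fps_nth (u' x) 0 = 1) \<and> Q1 = skew_mult q Q' (chain q c u' xs) \<longrightarrow>
        Q' = Q \<and> (\<forall>x\<in>set xs. u' x = u x))"
    by (rule snoc.IH[OF _ _ _ _ 1(4,5,6,7) symb1]) (use snoc.prems in \<open>auto simp: sorted_wrt_append\<close>)
  then obtain Q u where IH: "\<forall>x\<in>set xs. fps_nth (u x) 0 = 1 \<and> fps_to_fls (u x) \<in> germ_field A"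
     "Q1 = skew_mult q Q (chain q c u xs)" "Q \<in> skew_over (germ_field A)" "val_ge l Q"
     "Poly_Mapping.keys Q \<subseteq> {N..}" "symb N l Q = G"
     "\<And>Q' u'. (\<forall>x\<in>set xs. fps_nth (u' x) 0 = 1) \<Longrightarrow> Q1 = skew_mult q Q' (chain q c u' xs) \<Longrightarrow>
        Q' = Q \<and> (\<forall>x\<in>set xs. u' x = u x)"
    by blast
  define v where "v = u(x := w)"
  have v: "v x = w" "\<And>y. y \<in> set xs \<Longrightarrow> v y = u y" using x by (auto simp: v_def)
  have chain_v: "chain q c v xs = chain q c u xs" by (rule chain_cong) (use v in auto)
  have Peq: "P = skew_mult q Q (chain q c v (xs @ [x]))"
    unfolding chain_snoc[OF q0] chain_v v(1) by (simp add: 1(3) IH(2) skew_mult_assoc q0 cx_def)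
  have uniq: "Q' = Q \<and> (\<forall>y\<in>set (xs @ [x]). u' y = v y)"
    if "\<forall>y\<in>set (xs @ [x]). fps_nth (u' y) 0 = 1" "P = skew_mult q Q' (chain q c u' (xs @ [x]))" for Q' u'
  proof -
    \<comment> \<open>Regrouping exhibits the rightmost factor of the competing factorization. It is
      unique, so the left parts agree as well and the induction hypothesis applies to them.\<close>
    have "P = skew_mult q (skew_mult q Q' (chain q c u' xs)) (elem_factor q 0 cx (u' x))"
      using that(2) by (simp add: chain_snoc q0 skew_mult_assoc cx_def)
    from right_factor_unique[OF q0 cx q_difference_eq_ex1[OF q0 snoc.prems(6) root nz] 1(1,3) _ this]
    have "u' x = w" "skew_mult q Q' (chain q c u' xs) = Q1" using that(1) by auto
    thus ?thesis using IH(7)[of u' Q'] that(1) v by auto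
  qed
  show ?case
    by (rule exI[of _ Q], rule exI[of _ v])
       (use v 1 IH Peq uniq in auto)
qed

subsection \<open>Newton polygons\<close>

abbreviation sval :: "skew \<Rightarrow> int \<Rightarrow> int" where
  "sval P i \<equiv> fls_subdegree (scoeff P i)"

lemma newton_polygon_vertex:
  "i \<in> Poly_Mapping.keys P \<Longrightarrow> (real_of_int i, real_of_int (sval P i)) \<in> newton_polygon P"
  unfolding newton_polygon_def by (rule hull_inc) (auto simp: in_keys_iff)

lemma convex_newton_polygon [simp]: "convex (newton_polygon P)"
  by (simp add: newton_polygon_def)

lemma newton_polygon_up:
  assumes "(x, y) \<in> newton_polygon P"
  shows "(x, y + 1) \<in> newton_polygon P"
proof -
  let ?S = "{(real_of_int i, real_of_int j) | i j. scoeff P i \<noteq> 0 \<and> sval P i \<le> j}"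
  have "(\<lambda>p. (0, 1) + p) ` ?S \<subseteq> ?S"
  proof (clarsimp)
    fix i j assume "scoeff P i \<noteq> 0" "sval P i \<le> j"
    thus "\<exists>j'. 1 + real_of_int j = real_of_int j' \<and> sval P i \<le> j'"
      by (intro exI[of _ "j + 1"]) auto
  qed
  hence "convex hull ((\<lambda>p. (0, 1) + p) ` ?S) \<subseteq> newton_polygon P"
    unfolding newton_polygon_def by (rule hull_mono)
  hence "(\<lambda>p. (0, 1) + p) ` newton_polygon P \<subseteq> newton_polygon P"
    unfolding convex_hull_translation newton_polygon_def .
  moreover have "(x, y + 1) \<in> (\<lambda>p. (0, 1) + p) ` newton_polygon P"
    using assms by (intro image_eqI[of _ _ "(x, y)"]) auto
  ultimately show ?thesis by blast
qed

section \<open>Supporting lines, faces and edges of the polygon\<close>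

lemma convex_bound_ge:
  fixes a x y :: real
  assumes "a \<le> x" "a \<le> y" "0 \<le> u" "0 \<le> v" "u + v = 1"
  shows "a \<le> u * x + v * y"
  using convex_bound_le[of "- x" "- a" "- y" u v] assms by (simp add: algebra_simps)

text \<open>An open half-plane together with a segment of its boundary line. Convexity lets it
  absorb the whole hull, which bounds the polygon by a line and at the same time locates where the
  line is met.\<close>

lemma convex_strict_epigraph_with_segment:
  fixes \<kappa> \<nu> a b :: real
  shows "convex {p :: real \<times> real. \<kappa> < snd p - \<nu> * fst p \<or> (snd p - \<nu> * fst p = \<kappa> \<and> a \<le> fst p \<and> fst p \<le> b)}"
    (is "convex ?C")
proof (rule convexI)
  fix p p' :: "real \<times> real" and s t :: real
  assume p: "p \<in> ?C" "p' \<in> ?C" and st: "0 \<le> s" "0 \<le> t" "s + t = 1"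
  define \<phi> where "\<phi> = (\<lambda>p :: real \<times> real. snd p - \<nu> * fst p)"
  have \<phi>: "\<phi> (s *\<^sub>R p + t *\<^sub>R p') = s * \<phi> p + t * \<phi> p'" by (simp add: \<phi>_def algebra_simps)
  have ge: "\<phi> p \<ge> \<kappa>" "\<phi> p' \<ge> \<kappa>" using p by (auto simp: \<phi>_def)
  have t: "t = 1 - s" using st by simp
  consider "s = 0" | "t = 0" | "s > 0" "t > 0" "\<phi> p > \<kappa> \<or> \<phi> p' > \<kappa>"
    | "s > 0" "t > 0" "\<phi> p = \<kappa>" "\<phi> p' = \<kappa>"
    using st ge by linarith
  thus "s *\<^sub>R p + t *\<^sub>R p' \<in> ?C"
  proof cases
    case 3
    have "s * (\<phi> p - \<kappa>) + t * (\<phi> p' - \<kappa>) > 0"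
      using 3(3)
    proof
      assume "\<phi> p > \<kappa>"
      thus ?thesis using 3(1,2) ge(2) by (intro add_pos_nonneg) auto
    next
      assume "\<phi> p' > \<kappa>"
      thus ?thesis using 3(1,2) ge(1) by (intro add_nonneg_pos) auto
    qed
    moreover have "s * \<kappa> + t * \<kappa> = \<kappa>" by (simp add: t algebra_simps)
    ultimately have "\<phi> (s *\<^sub>R p + t *\<^sub>R p') > \<kappa>" unfolding \<phi> by (simp add: right_diff_distrib)
    thus ?thesis by (simp add: \<phi>_def)
  next
    case 4
    hence ab: "a \<le> fst p" "fst p \<le> b" "a \<le> fst p'" "fst p' \<le> b" using p by (auto simp: \<phi>_def)
    have "\<phi> (s *\<^sub>R p + t *\<^sub>R p') = \<kappa>" unfolding \<phi> 4(3,4) by (simp add: t algebra_simps)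
    moreover have "a \<le> s * fst p + t * fst p'"
      by (rule convex_bound_ge) (use ab st in auto)
    moreover have "s * fst p + t * fst p' \<le> b"
      by (rule convex_bound_le) (use ab st in auto)
    ultimately show ?thesis by (simp add: \<phi>_def)
  qed (use p st in auto)
qed

lemma newton_polygon_support:
  fixes \<kappa> \<nu> a b :: real
  assumes ge: "\<And>i. i \<in> Poly_Mapping.keys P \<Longrightarrow> \<kappa> \<le> sval P i - \<nu> * i"
    and eq: "\<And>i. i \<in> Poly_Mapping.keys P \<Longrightarrow> sval P i - \<nu> * i = \<kappa> \<Longrightarrow> a \<le> i \<and> i \<le> b"
    and p: "p \<in> newton_polygon P"
  shows "\<kappa> < snd p - \<nu> * fst p \<or> (snd p - \<nu> * fst p = \<kappa> \<and> a \<le> fst p \<and> fst p \<le> b)"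
proof -
  let ?C = "{p. \<kappa> < snd p - \<nu> * fst p \<or> (snd p - \<nu> * fst p = \<kappa> \<and> a \<le> fst p \<and> fst p \<le> b)}"
  have "newton_polygon P \<subseteq> ?C"
    unfolding newton_polygon_def
  proof (rule hull_minimal)
    show "{(real_of_int i, real_of_int j) | i j. scoeff P i \<noteq> 0 \<and> sval P i \<le> j} \<subseteq> ?C"
    proof
      fix x assume "x \<in> {(real_of_int i, real_of_int j) | i j. scoeff P i \<noteq> 0 \<and> sval P i \<le> j}"
      then obtain i j where *: "x = (real_of_int i, real_of_int j)" "scoeff P i \<noteq> 0" "sval P i \<le> j"
        by auto
      have i: "i \<in> Poly_Mapping.keys P" using *(2) by (simp add: in_keys_iff)
      have "real_of_int (sval P i) \<le> real_of_int j" using *(3) by simp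
      hence "\<kappa> < real_of_int j - \<nu> * i \<or> (real_of_int j - \<nu> * i = \<kappa> \<and> sval P i - \<nu> * i = \<kappa>)"
        using ge[OF i] by linarith
      thus "x \<in> ?C" using eq[OF i] by (auto simp: *(1))
    qed
  qed (rule convex_strict_epigraph_with_segment)
  thus ?thesis using p by auto
qed

lemma newton_polygon_fst:
  assumes "Poly_Mapping.keys P \<subseteq> {a..b}" "p \<in> newton_polygon P"
  shows "real_of_int a \<le> fst p" "fst p \<le> real_of_int b"
proof -
  have 1: "convex {p :: real \<times> real. real_of_int a \<le> fst p \<and> fst p \<le> real_of_int b}" (is "convex ?C")
    by (auto simp: convex_def intro!: convex_bound_ge convex_bound_le)
  have "newton_polygon P \<subseteq> ?C" unfolding newton_polygon_def
  proof (rule hull_minimal)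
    show "{(real_of_int i, real_of_int j) | i j. scoeff P i \<noteq> 0 \<and> sval P i \<le> j} \<subseteq> ?C"
      using assms(1) by (auto simp: in_keys_iff subset_iff)
  qed (rule 1)
  thus "real_of_int a \<le> fst p" "fst p \<le> real_of_int b" using assms(2) by auto
qed

lemma closed_segment_on_line:
  fixes a b :: real
  assumes "a \<le> b"
  shows "closed_segment (a, \<nu> * a + \<kappa>) (b, \<nu> * b + \<kappa>) =
    {p. snd p - \<nu> * fst p = \<kappa> \<and> a \<le> fst p \<and> fst p \<le> b}" (is "?L = ?R")
proof
  show "?L \<subseteq> ?R"
  proof
    fix p assume "p \<in> ?L"
    then obtain u where u: "0 \<le> u" "u \<le> 1" "p = (1 - u) *\<^sub>R (a, \<nu> * a + \<kappa>) + u *\<^sub>R (b, \<nu> * b + \<kappa>)"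
      by (auto simp: in_segment)
    have "a \<le> (1 - u) * a + u * b" by (rule convex_bound_ge) (use u assms in auto)
    moreover have "(1 - u) * a + u * b \<le> b" by (rule convex_bound_le) (use u assms in auto)
    ultimately show "p \<in> ?R" unfolding u(3) by (simp add: algebra_simps)
  qed
  show "?R \<subseteq> ?L"
  proof
    fix p assume p: "p \<in> ?R"
    hence "fst p \<in> closed_segment a b" using assms by (auto simp: closed_segment_eq_real_ivl)
    then obtain u where u: "0 \<le> u" "u \<le> 1" "fst p = (1 - u) * a + u * b"
      by (auto simp: in_segment)
    have "snd p = \<nu> * fst p + \<kappa>" using p by auto
    hence "p = (1 - u) *\<^sub>R (a, \<nu> * a + \<kappa>) + u *\<^sub>R (b, \<nu> * b + \<kappa>)"
      by (auto simp: prod_eq_iff u(3) algebra_simps)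
    thus "p \<in> ?L" using u by (auto simp: in_segment)
  qed
qed

text \<open>A supporting line cuts out a face. The equality condition keeps that face between the
  abscissas I and J, and both ends are vertices on the line, so the face is exactly the segment
  joining them.\<close>

lemma newton_vector_of_support:
  fixes \<kappa> \<nu> :: real and I J :: int
  assumes ge: "\<And>i. i \<in> Poly_Mapping.keys P \<Longrightarrow> \<kappa> \<le> sval P i - \<nu> * i"
    and eq: "\<And>i. i \<in> Poly_Mapping.keys P \<Longrightarrow> sval P i - \<nu> * i = \<kappa> \<Longrightarrow> I \<le> i \<and> i \<le> J"
    and I: "I \<in> Poly_Mapping.keys P" "sval P I - \<nu> * I = \<kappa>"
    and J: "J \<in> Poly_Mapping.keys P" "sval P J - \<nu> * J = \<kappa>" and "I < J"
  shows "(nat (J - I), sval P J - sval P I) \<in> newton_vectors P"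
proof -
  let ?N = "newton_polygon P"
  let ?v = "(real_of_int I, real_of_int (sval P I))" and ?w = "(real_of_int J, real_of_int (sval P J))"
  have vw: "?v \<in> ?N" "?w \<in> ?N" using newton_polygon_vertex I(1) J(1) by auto
  have seg: "closed_segment ?v ?w = {p. snd p - \<nu> * fst p = \<kappa> \<and> real_of_int I \<le> fst p \<and> fst p \<le> real_of_int J}"
    using closed_segment_on_line[of I J \<nu> \<kappa>] \<open>I < J\<close> I(2) J(2) by (simp add: algebra_simps)
  have supp: "\<kappa> < snd p - \<nu> * fst p \<or> (snd p - \<nu> * fst p = \<kappa> \<and> real_of_int I \<le> fst p \<and> fst p \<le> real_of_int J)"
    if "p \<in> ?N" for p :: "real \<times> real"
    by (rule newton_polygon_support[OF ge _ that]) (use eq in auto)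
  have inner: "(- \<nu>, 1) \<bullet> p = snd p - \<nu> * fst p" for p :: "real \<times> real"
    by (cases p) (simp add: inner_prod_def)
  have "(?N \<inter> {p. (- \<nu>, 1) \<bullet> p = \<kappa>}) face_of ?N"
    by (rule face_of_Int_supporting_hyperplane_ge) (use supp in \<open>force simp: inner\<close>)+
  moreover have "?N \<inter> {p. (- \<nu>, 1) \<bullet> p = \<kappa>} = closed_segment ?v ?w"
  proof
    show "?N \<inter> {p. (- \<nu>, 1) \<bullet> p = \<kappa>} \<subseteq> closed_segment ?v ?w"
      unfolding seg using supp by (force simp: inner)
    have "closed_segment ?v ?w \<subseteq> ?N" by (rule closed_segment_subset) (use vw in auto)
    thus "closed_segment ?v ?w \<subseteq> ?N \<inter> {p. (- \<nu>, 1) \<bullet> p = \<kappa>}"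
      unfolding seg by (auto simp: inner)
  qed
  moreover have "aff_dim (closed_segment ?v ?w) = 1"
    using \<open>I < J\<close> aff_dim_convex_hull[of "{?v, ?w}"] by (simp add: segment_convex_hull)
  ultimately have edge: "closed_segment ?v ?w edge_of ?N" by (simp add: edge_of_def)
  have w_eq: "?w = ?v + (real (nat (J - I)), real_of_int (sval P J - sval P I))"
    using \<open>I < J\<close> by simp
  have "closed_segment ?v (?v + (real (nat (J - I)), real_of_int (sval P J - sval P I))) edge_of ?N"
    using edge by (subst w_eq[symmetric])
  moreover have "nat (J - I) > 0" using \<open>I < J\<close> by simp
  ultimately show ?thesis unfolding newton_vectors_def mem_Collect_eq case_prod_conv by blast
qed

text \<open>Here the information on slopes is turned into an inequality between valuations, the only
  form in which the factorization uses it.\<close>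

lemma top_coeff_minimal_if_slopes_le:
  assumes slopes: "\<forall>\<nu>\<in>slopes P. \<nu> \<le> of_int \<mu>" and i: "i \<in> Poly_Mapping.keys P"
  defines "n \<equiv> Max (Poly_Mapping.keys P)"
  shows "sval P n - \<mu> * n \<le> sval P i - \<mu> * i"
proof -
  let ?K = "Poly_Mapping.keys P"
  define w where "w = (\<lambda>i. sval P i - \<mu> * i)"
  define \<kappa> where "\<kappa> = Min (w ` ?K)"
  have min: "\<kappa> \<le> w i" if "i \<in> ?K" for i unfolding \<kappa>_def using that by auto
  have "\<kappa> \<in> w ` ?K" unfolding \<kappa>_def using i by (intro Min_in) auto
  hence ne: "{i \<in> ?K. w i = \<kappa>} \<noteq> {}" by auto
  \<comment> \<open>The last index attaining the minimum: all later indices then lie strictly above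
    the line of slope \<mu> through I.\<close>
  define I where "I = Max {i \<in> ?K. w i = \<kappa>}"
  have "I \<in> {i \<in> ?K. w i = \<kappa>}" unfolding I_def by (rule Max_in) (use ne in auto)
  hence I: "I \<in> ?K" "w I = \<kappa>" by auto
  have I_max: "i \<le> I" if "i \<in> ?K" "w i = \<kappa>" for i unfolding I_def using that by auto
  \<comment> \<open>Otherwise the edge which starts at \<open>I\<close>, of slope \<open>\<nu>\<close> below, is steeper than \<open>\<mu>\<close>.\<close>
  have "I = n"
  proof (rule ccontr)
    assume "I \<noteq> n"
    have n: "n \<in> ?K" "\<And>i. i \<in> ?K \<Longrightarrow> i \<le> n" unfolding n_def using i by (auto intro!: Max_in)
    define K' where "K' = {i \<in> ?K. I < i}"
    have K': "finite K'" "n \<in> K'" using n \<open>I \<noteq> n\<close> I by (auto simp: K'_def order_less_le)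
    define f where "f = (\<lambda>i. real_of_int (sval P i - sval P I) / real_of_int (i - I))"
    define \<nu> where "\<nu> = Min (f ` K')"
    have "\<nu> \<in> f ` K'" unfolding \<nu>_def using K' by (intro Min_in) auto
    hence ne': "{i \<in> K'. f i = \<nu>} \<noteq> {}" by auto
    \<comment> \<open>The last index on the line of least slope \<nu> from I, hence the far end of
      the edge.\<close>
    define J where "J = Max {i \<in> K'. f i = \<nu>}"
    have "J \<in> {i \<in> K'. f i = \<nu>}" unfolding J_def by (rule Max_in) (use ne' K' in auto)
    hence J: "J \<in> ?K" "I < J" "f J = \<nu>" by (auto simp: K'_def)
    have J_max: "i \<le> J" if "i \<in> K'" "f i = \<nu>" for i unfolding J_def using that K' by auto
    have f_gt: "f i > \<mu>" if "i \<in> K'" for i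
    proof -
      have i: "i \<in> ?K" "I < i" using that by (auto simp: K'_def)
      hence "w i > w I" using min[of i] I I_max[of i] by force
      hence "\<mu> * (i - I) < sval P i - sval P I" by (simp add: w_def algebra_simps)
      hence "real_of_int \<mu> * real_of_int (i - I) < real_of_int (sval P i - sval P I)"
        by (metis of_int_less_iff of_int_mult)
      thus ?thesis using i by (simp add: f_def less_divide_eq)
    qed
    have \<nu>: "\<nu> > \<mu>" using f_gt[of J] J by (auto simp: K'_def)
    define \<kappa>' where "\<kappa>' = sval P I - \<nu> * I"
    have gt: "sval P i - \<nu> * i - \<kappa>' = (i - I) * (f i - \<nu>)" if "i \<in> K'" for i
      using that by (simp add: f_def \<kappa>'_def K'_def field_simps)
    \<comment> \<open>To the left of I, the line of slope \<mu> through I already bounds the points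
      from below, and the steeper line of slope \<nu> runs strictly under it.\<close>
    have lt: "sval P i - \<nu> * i > \<kappa>'" if "i \<in> ?K" "i < I" for i
    proof -
      have "w i \<ge> w I" using min[OF that(1)] I by simp
      hence "sval P i - sval P I \<ge> \<mu> * (i - I)" by (simp add: w_def algebra_simps)
      hence "real_of_int \<mu> * real_of_int (i - I) \<le> real_of_int (sval P i - sval P I)"
        by (metis of_int_le_iff of_int_mult)
      moreover have "\<nu> * real_of_int (i - I) < \<mu> * real_of_int (i - I)"
        using \<nu> that(2) by (intro mult_strict_right_mono_neg) auto
      ultimately show ?thesis by (simp add: \<kappa>'_def algebra_simps)
    qed
    have cases: "i < I \<or> i = I \<or> i \<in> K'" if "i \<in> ?K" for i using that by (auto simp: K'_def)
    have "(nat (J - I), sval P J - sval P I) \<in> newton_vectors P"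
    proof (rule newton_vector_of_support[where \<kappa> = \<kappa>' and \<nu> = \<nu>])
      fix i assume i: "i \<in> ?K"
      have f_ge: "f i \<ge> \<nu>" if "i \<in> K'" unfolding \<nu>_def using that K' by auto
      have "(i - I) * (f i - \<nu>) \<ge> 0" if "i \<in> K'"
        using f_ge that by (intro mult_nonneg_nonneg) (auto simp: K'_def)
      thus "\<kappa>' \<le> sval P i - \<nu> * i" using cases[OF i] gt[of i] lt[OF i] by (auto simp: \<kappa>'_def)
      assume eq: "sval P i - \<nu> * i = \<kappa>'"
      show "I \<le> i \<and> i \<le> J"
      proof (cases "i \<in> K'")
        case True
        hence "real_of_int (i - I) * (f i - \<nu>) = 0" using gt[of i] eq by simp
        hence "f i = \<nu>" using True by (auto simp: K'_def)
        thus ?thesis using True J_max[of i] by (auto simp: K'_def)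
      next
        case False
        thus ?thesis using cases[OF i] lt[OF i] eq J(2) by auto
      qed
    next
      show "sval P J - \<nu> * J = \<kappa>'" using gt[of J] J by (simp add: K'_def)
    qed (use I J in \<open>auto simp: \<kappa>'_def\<close>)
    hence "of_int (sval P J - sval P I) / of_nat (nat (J - I)) \<in> slopes P"
      unfolding slopes_def by force
    hence "(of_int (sval P J - sval P I) :: rat) / of_nat (nat (J - I)) \<le> of_int \<mu>"
      using slopes by blast
    hence "(of_int (sval P J - sval P I) :: rat) / of_int (J - I) \<le> of_int \<mu>"
      using J(2) by simp
    hence "(of_int (sval P J - sval P I) :: rat) \<le> of_int \<mu> * of_int (J - I)"
      using J(2) by (simp add: divide_le_eq)
    hence "sval P J - sval P I \<le> \<mu> * (J - I)"
      by (metis of_int_le_iff of_int_mult)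
    moreover have "sval P J - sval P I > \<mu> * (J - I)"
      using I_max[OF J(1)] min[OF J(1)] I J(2) by (force simp: w_def algebra_simps)
    ultimately show False by simp
  qed
  thus ?thesis using min[OF i] I(2) by (simp add: w_def)
qed

text \<open>A point below the midpoint would put the midpoint inside a vertical segment of the polygon.\<close>

lemma edge_below:
  assumes e: "closed_segment v w edge_of newton_polygon P" and lt: "fst v < fst w"
    and g: "g \<in> newton_polygon P" "fst g = (fst v + fst w) / 2"
  shows "(snd v + snd w) / 2 \<le> snd g"
proof (rule ccontr)
  assume "\<not> (snd v + snd w) / 2 \<le> snd g"
  define p where "p = ((fst v + fst w) / 2, (snd v + snd w) / 2)"
  have below: "snd g < snd p" using \<open>\<not> _\<close> by (simp add: p_def)
  have face: "closed_segment v w face_of newton_polygon P" using e by (simp add: edge_of_def)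
  have p_eq: "p = (1 - 1/2) *\<^sub>R v + (1/2) *\<^sub>R w"
    by (simp add: p_def prod_eq_iff field_simps)
  have p_seg: "p \<in> closed_segment v w"
    unfolding in_segment using p_eq by (intro exI[of _ "1/2"]) auto
  hence "p \<in> newton_polygon P" using face face_of_imp_subset by blast
  hence top: "(fst p, snd p + 1) \<in> newton_polygon P"
    using newton_polygon_up[of "fst p" "snd p"] by simp
  \<comment> \<open>The position of p on the vertical segment from g up to p + (0, 1).\<close>
  define u where "u = (snd p - snd g) / (snd p + 1 - snd g)"
  have u: "0 < u" "u < 1" using below by (auto simp: u_def field_simps)
  have "p = (1 - u) *\<^sub>R g + u *\<^sub>R (fst p, snd p + 1)"
  proof -
    have "u * (snd p + 1 - snd g) = snd p - snd g" using below by (simp add: u_def)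
    hence "snd p = (1 - u) * snd g + u * (snd p + 1)" by (simp add: algebra_simps)
    moreover have "fst g = fst p" by (simp add: g(2) p_def)
    hence "fst p = (1 - u) * fst g + u * fst p" by (simp add: algebra_simps)
    ultimately show ?thesis by (simp add: prod_eq_iff)
  qed
  hence "p \<in> open_segment g (fst p, snd p + 1)"
    unfolding in_segment using u below by (auto simp: prod_eq_iff)
  hence "g \<in> closed_segment v w" using face_ofD[OF face _ g(1) top p_seg] by blast
  then obtain s where s: "g = (1 - s) *\<^sub>R v + s *\<^sub>R w" by (auto simp: in_segment)
  have "(s - 1/2) * (fst w - fst v) = 0" using g(2) unfolding s by (simp add: field_simps)
  hence "s = 1/2" using lt by simp
  hence "g = p" unfolding s p_eq by (simp only:)
  thus False using below by simp
qed

lemma newton_vectorE: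
  assumes "(r, d) \<in> newton_vectors P"
  obtains v w where "closed_segment v w edge_of newton_polygon P" "fst v < fst w"
    "fst w = fst v + real r" "snd w = snd v + real_of_int d"
    "v \<in> newton_polygon P" "w \<in> newton_polygon P"
proof -
  obtain v where v: "r > 0" "closed_segment v (v + (real r, real_of_int d)) edge_of newton_polygon P"
    using assms by (auto simp: newton_vectors_def)
  have "closed_segment v (v + (real r, real_of_int d)) \<subseteq> newton_polygon P"
    using v(2) by (rule edge_of_imp_subset)
  thus ?thesis by (intro that[of v "v + (real r, real_of_int d)"]) (use v in auto)
qed

text \<open>The line of slope \<mu> touches the polygon only over i0, so an edge of that slope would
  lie strictly higher. Joining one of its ends to the touching vertex, or taking the vertex itself,
  gives a point below the midpoint of the edge, against \<open>edge_below\<close>.\<close>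

lemma slope_not_in_slopes:
  assumes ge: "\<And>i. i \<in> Poly_Mapping.keys P \<Longrightarrow> \<kappa> \<le> sval P i - \<mu> * i"
    and eq: "\<And>i. i \<in> Poly_Mapping.keys P \<Longrightarrow> sval P i - \<mu> * i = \<kappa> \<longleftrightarrow> i = i0"
    and i0: "i0 \<in> Poly_Mapping.keys P"
  shows "of_int \<mu> \<notin> slopes P"
proof
  let ?N = "newton_polygon P"
  assume "of_int \<mu> \<in> slopes P"
  then obtain r d where rd: "(r, d) \<in> newton_vectors P" "of_int \<mu> = (of_int d / of_nat r :: rat)"
    by (auto simp: slopes_def)
  from rd(1) have "r > 0" by (auto simp: newton_vectors_def)
  hence "(of_int (\<mu> * int r) :: rat) = of_int d" using rd(2) by (simp add: field_simps)
  hence d: "d = \<mu> * int r" by (metis of_int_eq_iff)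
  obtain v w where e: "closed_segment v w edge_of ?N" "fst v < fst w"
    "fst w = fst v + real r" "snd w = snd v + real_of_int d" "v \<in> ?N" "w \<in> ?N"
    using newton_vectorE[OF rd(1)] .
  define p0 where "p0 = (real_of_int i0, real_of_int (sval P i0))"
  have p0: "p0 \<in> ?N" unfolding p0_def by (rule newton_polygon_vertex[OF i0])
  define \<phi> where "\<phi> = (\<lambda>p :: real \<times> real. snd p - \<mu> * fst p)"
  have \<phi>0: "\<phi> p0 = \<kappa>" using eq[OF i0] by (simp add: \<phi>_def p0_def flip: of_int_mult of_int_diff)
  have \<phi>w: "\<phi> w = \<phi> v" by (simp add: \<phi>_def e d algebra_simps)
  have supp: "\<kappa> < \<phi> p \<or> (\<phi> p = \<kappa> \<and> real_of_int i0 \<le> fst p \<and> fst p \<le> real_of_int i0)"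
    if "p \<in> ?N" for p :: "real \<times> real"
    unfolding \<phi>_def
    by (rule newton_polygon_support[OF _ _ that])
       (use ge eq in \<open>force simp flip: of_int_mult of_int_diff\<close>)+
  have gt: "\<phi> v > \<kappa>" using supp[OF e(5)] supp[OF e(6)] e(2) \<phi>w by auto
  define x where "x = (fst v + fst w) / 2"
  \<comment> \<open>Moving from the level of the edge towards p0 strictly lowers the level, while
    the chosen s keeps the abscissa at that of the midpoint.\<close>
  have key: False if a: "a \<in> ?N" "\<phi> a = \<phi> v" and s: "0 < s" "s \<le> 1" "x = (1 - s) * fst a + s * fst p0" for a s
  proof -
    define g where "g = (1 - s) *\<^sub>R a + s *\<^sub>R p0"
    have "g \<in> ?N" unfolding g_def
      by (rule convexD_alt[OF convex_newton_polygon a(1) p0]) (use s in auto)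
    moreover have "fst g = (fst v + fst w) / 2" using s(3) by (simp add: g_def x_def)
    ultimately have "(snd v + snd w) / 2 \<le> snd g" by (rule edge_below[OF e(1,2)])
    hence "snd v + snd w \<le> 2 * snd g" by simp
    moreover have "2 * (real_of_int \<mu> * fst g) = \<mu> * fst v + \<mu> * fst w"
      unfolding \<open>fst g = _\<close> by (simp add: field_simps)
    moreover have "snd w - real_of_int \<mu> * fst w = snd v - real_of_int \<mu> * fst v"
      using \<phi>w by (simp add: \<phi>_def)
    ultimately have "snd v - real_of_int \<mu> * fst v \<le> snd g - real_of_int \<mu> * fst g" by linarith
    hence "\<phi> v \<le> \<phi> g" by (simp add: \<phi>_def)
    moreover have "\<phi> g = (1 - s) * \<phi> v + s * \<kappa>"
      unfolding a(2)[symmetric] \<phi>0[symmetric] by (simp add: g_def \<phi>_def algebra_simps)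
    moreover have "s * \<kappa> < s * \<phi> v" using s gt by simp
    ultimately show False by (simp add: algebra_simps)
  qed
  have combo: "y = (1 - (y - a) / (b - a)) * a + (y - a) / (b - a) * b" if "a \<noteq> b" for a b y :: real
  proof -
    define s where "s = (y - a) / (b - a)"
    have "s * (b - a) = y - a" using that by (simp add: s_def)
    hence "y = (1 - s) * a + s * b" by (simp add: algebra_simps)
    thus ?thesis by (simp add: s_def)
  qed
  \<comment> \<open>The end of the edge is chosen so that the abscissa of the midpoint lies between
    it and p0.\<close>
  consider "x = fst p0" | "x < fst p0" | "x > fst p0" by linarith
  thus False
  proof cases
    case 1
    thus False using key[OF e(5) refl, of 1] by simp
  next
    case 2
    have "fst v < x" using e(2) by (simp add: x_def)
    thus False using key[OF e(5) refl _ _ combo[of "fst v" "fst p0" x]] 2 by simp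
  next
    case 3
    have "x < fst w" using e(2) by (simp add: x_def)
    thus False using key[OF e(6) \<phi>w _ _ combo[of "fst w" "fst p0" x]] 3
      by (simp add: zero_less_divide_iff)
  qed
qed

text \<open>The lower boundary is the segment AB of slope \<mu>. The midpoint of any non-vertical
  edge lies on it: not above by \<open>edge_below\<close>, not below by the supporting line. A face
  that meets the interior of AB contains A and B, which leaves only AB itself.\<close>

lemma newton_vectors_single_slope:
  assumes keys: "Poly_Mapping.keys P \<subseteq> {0..int m}"
    and ends: "0 \<in> Poly_Mapping.keys P" "int m \<in> Poly_Mapping.keys P"
    and ge: "\<And>i. i \<in> Poly_Mapping.keys P \<Longrightarrow> \<kappa> \<le> sval P i - \<mu> * i"
    and eq: "sval P 0 = \<kappa>" "sval P (int m) = \<kappa> + \<mu> * int m"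
  shows "newton_vectors P = (if m = 0 then {} else {(m, \<mu> * int m)})"
proof -
  let ?N = "newton_polygon P"
  have ge': "real_of_int \<kappa> \<le> sval P i - real_of_int \<mu> * i" if "i \<in> Poly_Mapping.keys P" for i
    using ge[OF that] by (simp flip: of_int_mult of_int_diff)
  have bounds: "0 \<le> fst p" "fst p \<le> real m" if "p \<in> ?N" for p :: "real \<times> real"
    using newton_polygon_fst[OF keys that] by auto
  have unique: "m > 0 \<and> r = m \<and> d = \<mu> * int m" if rd: "(r, d) \<in> newton_vectors P" for r d
  proof -
    obtain v w where e: "closed_segment v w edge_of ?N" "fst v < fst w"
      "fst w = fst v + real r" "snd w = snd v + real_of_int d" "v \<in> ?N" "w \<in> ?N"
      using newton_vectorE[OF rd] .
    have m: "m > 0" using bounds[OF e(5)] bounds[OF e(6)] e(2) by (cases m) auto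
    have face: "closed_segment v w face_of ?N" using e(1) by (simp add: edge_of_def)
    define A B where "A = (0 :: real, real_of_int \<kappa>)" and "B = (real m, \<kappa> + \<mu> * real m)"
    have AB: "A \<in> ?N" "B \<in> ?N"
      using newton_polygon_vertex[OF ends(1)] newton_polygon_vertex[OF ends(2)] eq
      by (simp_all add: A_def B_def)
    define p where "p = ((fst v + fst w) / 2, (snd v + snd w) / 2)"
    have px: "0 < fst p" "fst p < real m"
      using bounds[OF e(5)] bounds[OF e(6)] e(2) by (auto simp: p_def)
    define g where "g = (fst p, \<kappa> + \<mu> * fst p)"
    have g_seg: "g \<in> closed_segment A B"
      using closed_segment_on_line[of 0 "real m" \<mu> \<kappa>] px by (simp add: g_def A_def B_def add.commute)
    have "g \<in> ?N" using closed_segment_subset[OF AB convex_newton_polygon] g_seg by blast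
    moreover have "fst g = (fst v + fst w) / 2" by (simp add: g_def p_def)
    ultimately have "snd p \<le> snd g" using edge_below[OF e(1,2)] by (simp add: p_def)
    moreover have supp: "real_of_int \<kappa> \<le> snd x - \<mu> * fst x" if "x \<in> ?N" for x :: "real \<times> real"
      using newton_polygon_support[OF ge' _ that, of 0 "real m"] keys by fastforce
    have "real_of_int \<kappa> \<le> snd v - \<mu> * fst v" "real_of_int \<kappa> \<le> snd w - \<mu> * fst w"
      using supp[OF e(5)] supp[OF e(6)] .
    ultimately have on: "snd v - \<mu> * fst v = \<kappa>" "snd w - \<mu> * fst w = \<kappa>"
      by (simp_all add: g_def p_def field_simps)
    hence pg: "p = g" by (simp add: p_def g_def field_simps)
    have "p \<in> closed_segment v w"
      unfolding in_segment by (intro exI[of _ "1/2"]) (auto simp: p_def prod_eq_iff field_simps)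
    moreover have "p \<in> open_segment A B"
      using g_seg px unfolding pg open_segment_def by (auto simp: g_def A_def B_def)
    ultimately have "A \<in> closed_segment v w" "B \<in> closed_segment v w"
      using face_ofD[OF face _ AB] by blast+
    hence "fst A \<in> closed_segment (fst v) (fst w)" "fst B \<in> closed_segment (fst v) (fst w)"
      by (auto simp: in_segment)
    hence "fst v \<le> 0" "real m \<le> fst w"
      using e(2) by (auto simp: A_def B_def closed_segment_eq_real_ivl)
    hence vw: "fst v = 0" "fst w = real m" using bounds[OF e(5)] bounds[OF e(6)] by auto
    hence r: "r = m" using e(3) by simp
    have "real_of_int d = real_of_int (\<mu> * int m)" using on e(4) vw by (simp add: algebra_simps)
    hence "d = \<mu> * int m" by (simp only: of_int_eq_iff)
    with m r show ?thesis by simp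
  qed
  show ?thesis
  proof (cases "m = 0")
    case True
    thus ?thesis using unique by fastforce
  next
    case False
    have "(nat (int m - 0), sval P (int m) - sval P 0) \<in> newton_vectors P"
    proof (rule newton_vector_of_support[where \<kappa> = \<kappa> and \<nu> = \<mu>])
      show "real_of_int \<kappa> \<le> sval P i - real_of_int \<mu> * i" if "i \<in> Poly_Mapping.keys P" for i
        using ge'[OF that] .
      show "0 \<le> i \<and> i \<le> int m" if "i \<in> Poly_Mapping.keys P" for i
        using keys that by auto
    qed (use ends eq False in simp_all)
    hence mem: "(m, \<mu> * int m) \<in> newton_vectors P" using eq by simp
    have "newton_vectors P \<subseteq> {(m, \<mu> * int m)}"
    proof
      fix x assume "x \<in> newton_vectors P"
      thus "x \<in> {(m, \<mu> * int m)}" using unique[of "fst x" "snd x"] by (simp add: prod_eq_iff)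
    qed
    thus ?thesis using mem False by auto
  qed
qed

lemma newton_function_single_slope:
  assumes "newton_vectors P = (if m = 0 then {} else {(m, \<mu> * int m)})"
  shows "newton_function P = (\<lambda>\<nu>. if \<nu> = of_int \<mu> then m else 0)"
  by (rule ext) (auto simp: newton_function_def assms)

subsection \<open>The characteristic polynomial as a symbol\<close>

lemma fls_subdegree_twisted_coeff:
  assumes "q \<noteq> 0" "i \<in> Poly_Mapping.keys P"
  shows "fls_subdegree (twisted_coeff q P \<mu> i) = sval P i - \<mu> * i"
proof -
  have nz: "scoeff P i \<noteq> 0" using assms(2) by (simp add: in_keys_iff)
  hence "scoeff P i * fls_const (q powi (- (\<mu> * (i * (i - 1) div 2)))) \<noteq> 0"
    using assms(1) by simp
  hence "fls_subdegree (twisted_coeff q P \<mu> i) =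
     fls_subdegree (scoeff P i * fls_const (q powi (- (\<mu> * (i * (i - 1) div 2))))) + (- (\<mu> * i))"
    unfolding twisted_coeff_def by (rule fls_subdegree_mult_fls_X_intpow(2))
  thus ?thesis using assms(1) nz by simp
qed

lemma sval_twist:
  assumes "q \<noteq> 0" "i \<in> Poly_Mapping.keys P"
  shows "sval (twist q \<mu> P) i = sval P i - \<mu> * i"
  by (simp add: scoeff_twist fls_subdegree_twisted_coeff assms)

lemma val_geD_sval:
  assumes "val_ge l P" "i \<in> Poly_Mapping.keys P"
  shows "l \<le> sval P i"
  by (rule fls_subdegree_geI) (use assms in \<open>auto simp: val_ge_def in_keys_iff\<close>)

lemma val_geI_sval:
  assumes "\<And>i. i \<in> Poly_Mapping.keys P \<Longrightarrow> l \<le> sval P i"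
  shows "val_ge l P"
  unfolding val_ge_def
proof (intro allI impI)
  fix i n assume "n < l"
  show "fls_nth (scoeff P i) n = 0"
  proof (cases "i \<in> Poly_Mapping.keys P")
    case True
    thus ?thesis using assms[OF True] \<open>n < l\<close> by (intro fls_eq0_below_subdegree) auto
  qed (auto simp: in_keys_iff)
qed

lemma sval_eq_iff:
  assumes "val_ge l P" "i \<in> Poly_Mapping.keys P"
  shows "sval P i = l \<longleftrightarrow> fls_nth (scoeff P i) l \<noteq> 0"
proof
  assume "sval P i = l"
  thus "fls_nth (scoeff P i) l \<noteq> 0"
    using assms(2) nth_fls_subdegree_nonzero[of "scoeff P i"] by (auto simp: in_keys_iff)
next
  assume "fls_nth (scoeff P i) l \<noteq> 0"
  thus "sval P i = l" by (rule fls_subdegree_eqI) (use assms in \<open>auto simp: val_ge_def\<close>)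
qed

lemma twisted_val_eq:
  assumes "q \<noteq> 0"
  shows "twisted_val q P \<mu> = Min ((\<lambda>i. sval (twist q \<mu> P) i) ` Poly_Mapping.keys P)"
  by (simp add: twisted_val_def scoeff_twist)

lemma twisted_val_eqI:
  assumes q: "q \<noteq> 0" and "val_ge l (twist q \<mu> P)" "fls_nth (scoeff (twist q \<mu> P) i) l \<noteq> 0"
  shows "twisted_val q P \<mu> = l"
proof -
  have i: "i \<in> Poly_Mapping.keys P"
    using assms(3) keys_twist[OF q, of \<mu> P] by (auto simp: in_keys_iff)
  show ?thesis unfolding twisted_val_eq[OF q]
  proof (rule Min_eqI)
    show "l \<in> (\<lambda>i. sval (twist q \<mu> P) i) ` Poly_Mapping.keys P"
      using sval_eq_iff[OF assms(2), of i] i assms(3) q by (intro image_eqI[of _ _ i]) auto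
  qed (use val_geD_sval[OF assms(2)] q in auto)
qed

lemma char_poly_eq_symb:
  "q \<noteq> 0 \<Longrightarrow> char_poly q P \<mu> = symb (Min (Poly_Mapping.keys P)) (twisted_val q P \<mu>) (twist q \<mu> P)"
  by (simp add: char_poly_def symb_def scoeff_twist fls_X_intpow_times_conv_shift
      fls_shifted_times_simps)

lemma keys_ge_Min: "Poly_Mapping.keys P \<subseteq> {Min (Poly_Mapping.keys P)..}"
  by auto

text \<open>Compares the scale N, l inherited from a larger operator with the operator's own
  normalisation. A non-zero symbol forces the minimal valuation to be l, and a later start of the
  support costs only a power of s, which does not affect non-zero roots.\<close>

lemma symb_eq_monom_char_poly:
  assumes q: "q \<noteq> 0" and "val_ge l (twist q \<mu> P)" "Poly_Mapping.keys P \<subseteq> {N..}"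
    and nz: "symb N l (twist q \<mu> P) \<noteq> 0"
  shows "symb N l (twist q \<mu> P) = monom 1 (nat (Min (Poly_Mapping.keys P) - N)) * char_poly q P \<mu>"
proof -
  have "P \<noteq> 0"
  proof
    assume "P = 0"
    hence "Poly_Mapping.keys (twist q \<mu> P) = {}" using q by simp
    thus False using nz by (simp add: symb_def)
  qed
  hence ne: "Poly_Mapping.keys P \<noteq> {}" by simp
  obtain k where "coeff (symb N l (twist q \<mu> P)) k \<noteq> 0" using nz by (auto simp: poly_eq_iff)
  hence "fls_nth (scoeff (twist q \<mu> P) (N + int k)) l \<noteq> 0"
    using assms(3) q by (simp add: coeff_symb)
  hence tv: "twisted_val q P \<mu> = l" by (rule twisted_val_eqI[OF q assms(2)])
  have "N \<le> Min (Poly_Mapping.keys P)" using assms(3) ne by auto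
  moreover have "Poly_Mapping.keys (twist q \<mu> P) \<subseteq> {Min (Poly_Mapping.keys P)..}"
    using q keys_ge_Min by simp
  ultimately show ?thesis unfolding char_poly_eq_symb[OF q] tv by (intro symb_shift)
qed

lemma skew_mult_eq_iff_twist:
  assumes "q \<noteq> 0"
  shows "P = skew_mult q Q R \<longleftrightarrow> twist q \<mu> P = skew_mult q (twist q \<mu> Q) (twist q \<mu> R)"
  using twist_mult[OF assms, of \<mu>] twist_twist_minus[OF assms, of "- \<mu>"] by (metis minus_minus)

subsection \<open>The index set of the elementary factors\<close>

text \<open>The pairs in the order of multiplication: blocks with increasing i, and j decreasing
  inside a block. Pairs keep the list distinct although each c_i occurs m_i times.\<close>

definition factor_indices :: "nat \<Rightarrow> (nat \<Rightarrow> nat) \<Rightarrow> (nat \<times> nat) list" where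
  "factor_indices p m = concat (map (\<lambda>i. map (Pair i) (rev [1..<Suc (m i)])) [1..<Suc p])"

lemma factor_indices_0 [simp]: "factor_indices 0 m = []"
  by (simp add: factor_indices_def)

lemma factor_indices_Suc:
  "factor_indices (Suc p) m = factor_indices p m @ map (Pair (Suc p)) (rev [1..<Suc (m (Suc p))])"
  by (simp add: factor_indices_def del: upt_Suc add: upt_Suc_append)

lemma set_factor_indices: "set (factor_indices p m) = {(i, j). i \<in> {1..p} \<and> j \<in> {1..m i}}"
proof -
  have "set (factor_indices p m) = (\<Union>i\<in>{1..<Suc p}. Pair i ` {1..<Suc (m i)})"
    by (simp add: factor_indices_def del: upt_Suc)
  thus ?thesis by (auto simp: atLeastLessThanSuc_atLeastAtMost)
qed

lemma distinct_factor_indices: "distinct (factor_indices p m)"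
  by (induction p)
     (auto simp: factor_indices_Suc set_factor_indices distinct_map inj_on_def simp del: upt_Suc)

lemma length_factor_indices: "length (factor_indices p m) = (\<Sum>i=1..p. m i)"
  by (induction p) (auto simp: factor_indices_Suc simp del: upt_Suc)

lemma prod_list_factor_indices:
  fixes f :: "nat \<Rightarrow> 'a :: comm_monoid_mult"
  shows "(\<Prod>x\<leftarrow>factor_indices p m. f (fst x)) = (\<Prod>i=1..p. f i ^ m i)"
proof (induction p)
  case (Suc p)
  have "map (\<lambda>x. f (fst x)) (map (Pair (Suc p)) xs) = replicate (length xs) (f (Suc p))" for xs :: "nat list"
    by (induction xs) auto
  hence "(\<Prod>x\<leftarrow>map (Pair (Suc p)) (rev [1..<Suc (m (Suc p))]). f (fst x)) = f (Suc p) ^ m (Suc p)"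
    by (simp only: prod_list_replicate length_rev length_upt diff_Suc_1)
  thus ?case by (simp add: factor_indices_Suc Suc del: upt_Suc map_map)
qed auto

lemma sorted_factor_indices: "sorted_wrt (\<lambda>x y. fst x \<le> fst y) (factor_indices p m)"
proof (induction p)
  case (Suc p)
  have "sorted_wrt (\<lambda>x y. fst x \<le> fst y) (map (Pair (Suc p)) xs)" for xs :: "nat list"
    by (induction xs) auto
  thus ?case using Suc
    by (auto simp: factor_indices_Suc sorted_wrt_append set_factor_indices simp del: upt_Suc)
qed auto

lemma right_factor_eq_chain:
  assumes "q \<noteq> 0"
  shows "right_factor q 0 p c m u = chain q (\<lambda>x. c (fst x)) (\<lambda>x. u (fst x) (snd x)) (factor_indices p m)"
proof -
  have "right_factor q 0 p c m u = skew_prod q (concat (map (\<lambda>i. map (\<lambda>j. elem_factor q 0 (c i) (u i j)) (rev [1..<Suc (m i)])) [1..<Suc p]))"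
    unfolding right_factor_def block_factor_def skew_prod_concat[OF assms] map_map o_def ..
  also have "concat (map (\<lambda>i. map (\<lambda>j. elem_factor q 0 (c i) (u i j)) (rev [1..<Suc (m i)])) [1..<Suc p]) =
      map (\<lambda>x. elem_factor q 0 (c (fst x)) (u (fst x) (snd x))) (factor_indices p m)"
    unfolding factor_indices_def map_concat map_map o_def by simp
  finally show ?thesis unfolding chain_def .
qed

lemma monic_prod_linear:
  fixes c :: "'a \<Rightarrow> 'b :: idom"
  shows "degree (\<Prod>x\<leftarrow>xs. [:- c x, 1:]) = length xs \<and> lead_coeff (\<Prod>x\<leftarrow>xs. [:- c x, 1:]) = 1"
proof (induction xs)
  case (Cons x xs)
  hence nz: "(\<Prod>x\<leftarrow>xs. [:- c x, 1:]) \<noteq> 0" by auto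
  have "degree ([:- c x, 1:] * (\<Prod>x\<leftarrow>xs. [:- c x, 1:])) = 1 + length xs"
    using Cons nz by (subst degree_mult_eq) auto
  moreover have "lead_coeff ([:- c x, 1:] * (\<Prod>x\<leftarrow>xs. [:- c x, 1:])) = 1"
    using Cons by (subst lead_coeff_mult) auto
  ultimately show ?case by (simp del: mult_pCons_left)
qed auto

subsection \<open>The factorization attached to a set of exponents\<close>

text \<open>As the c_i are distinct, the factors already removed do not vanish at the next root, so
  its order in the remaining factor is its order in f.\<close>

lemma split_off_roots:
  fixes f :: "'a :: field poly"
  assumes "f \<noteq> 0" "finite S" "inj_on c S"
  shows "\<exists>G. f = G * (\<Prod>i\<in>S. [:- c i, 1:] ^ order (c i) f) \<and> (\<forall>i\<in>S. poly G (c i) \<noteq> 0)"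
  using assms(2,3)
proof (induction S rule: finite_induct)
  case empty
  show ?case by (intro exI[of _ f]) auto
next
  case (insert i S)
  let ?\<Pi> = "\<Prod>i\<in>S. [:- c i, 1:] ^ order (c i) f"
  from insert obtain G where G: "f = G * ?\<Pi>" "\<forall>i\<in>S. poly G (c i) \<noteq> 0" by auto
  have "poly ?\<Pi> (c i) \<noteq> 0"
    using insert by (auto simp: poly_prod inj_on_def)
  hence "order (c i) ?\<Pi> = 0" by (rule order_0I)
  hence ord: "order (c i) f = order (c i) G"
    using order_mult[of G ?\<Pi> "c i"] G(1) assms(1) by simp
  have "G \<noteq> 0" using G(1) assms(1) by auto
  then obtain H where H: "G = [:- c i, 1:] ^ order (c i) f * H" "\<not> [:- c i, 1:] dvd H"
    unfolding ord using order_decomp by blast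
  have "f = H * ([:- c i, 1:] ^ order (c i) f * ?\<Pi>)"
    by (subst G(1), subst H(1)) (simp only: mult_ac)
  moreover have "poly H (c i) \<noteq> 0" using H(2) by (simp add: poly_eq_0_iff_dvd)
  moreover have "poly H (c j) \<noteq> 0" if "j \<in> S" for j
    using G(2) that by (subst (asm) H(1)) auto
  ultimately show ?case using insert by (intro exI[of _ H]) auto
qed

text \<open>The common core of both parts, which differ in the roots assigned to the c_i and those
  left in G. The last three conclusions describe the lowest layer of Q on the scale of P; the
  statements about slopes or exponents of Q are derived from them.\<close>

lemma exponent_factorization:
  assumes q: "norm q > 1" and A: "A = {} \<or> A = UNIV"
    and P: "P \<in> skew_over (germ_field A)" "P \<noteq> 0" and last: "\<forall>\<nu>\<in>slopes P. \<nu> \<le> of_int \<mu>"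
    and c: "\<forall>i\<in>{1..p}. c i \<noteq> 0"
    and ord: "\<forall>i\<in>{1..p}. \<forall>j\<in>{1..p}. \<forall>l::nat. l \<ge> 1 \<and> c j = c i * q ^ l \<longrightarrow> i < j"
    and G: "char_poly q P \<mu> = G * (\<Prod>i=1..p. [:- c i, 1:] ^ m i)"
      "\<forall>i\<in>{1..p}. \<forall>k::nat. k \<ge> 1 \<longrightarrow> poly G (c i * q ^ k) \<noteq> 0"
  shows "\<exists>Q R u. factorization q \<mu> P p c m Q R u \<and>
     (\<forall>Q' R' u'. factorization q \<mu> P p c m Q' R' u' \<longrightarrow>
        Q' = Q \<and> R' = R \<and> (\<forall>i\<in>{1..p}. \<forall>j\<in>{1..m i}. u' i j = u i j)) \<and>
     convergent_factorization (germ_field A) p m Q R u \<and>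
     newton_function R = (\<lambda>\<nu>. if \<nu> = of_int \<mu> then \<Sum>i=1..p. m i else 0) \<and>
     laurent_associated (char_poly q R \<mu>) (\<Prod>i=1..p. [:- c i, 1:] ^ m i) \<and>
     val_ge (twisted_val q P \<mu>) (twist q \<mu> Q) \<and>
     Poly_Mapping.keys Q \<subseteq> {Min (Poly_Mapping.keys P)..} \<and>
     symb (Min (Poly_Mapping.keys P)) (twisted_val q P \<mu>) (twist q \<mu> Q) = G"
proof -
  have q0: "q \<noteq> 0" using q by auto
  define N n l where "N = Min (Poly_Mapping.keys P)" and "n = Max (Poly_Mapping.keys P)"
    and "l = twisted_val q P \<mu>"
  define P0 where "P0 = twist q \<mu> P"
  define xs where "xs = factor_indices p m"
  define F where "F = (\<Prod>x\<leftarrow>xs. [:- c (fst x), 1:])"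
  have F: "F = (\<Prod>i=1..p. [:- c i, 1:] ^ m i)" unfolding F_def xs_def
    by (rule prod_list_factor_indices)
  have ne: "Poly_Mapping.keys P \<noteq> {}" using P(2) by simp
  have keys: "Poly_Mapping.keys P0 \<subseteq> {N..n}" unfolding P0_def keys_twist[OF q0] N_def n_def by auto
  have n_in: "n \<in> Poly_Mapping.keys P0" unfolding P0_def keys_twist[OF q0] n_def using ne by simp
  have min: "sval P0 n \<le> sval P0 i" if "i \<in> Poly_Mapping.keys P0" for i
    using top_coeff_minimal_if_slopes_le[OF last, of i] that n_in
    unfolding P0_def by (simp add: q0 sval_twist n_def)
  have l: "sval P0 n = l"
    unfolding l_def twisted_val_eq[OF q0] P0_def[symmetric]
    by (rule Min_eqI[symmetric]) (use min n_in q0 in \<open>auto simp: P0_def\<close>)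
  have val: "val_ge l P0" by (rule val_geI_sval) (use min l in auto)
  have top: "fls_nth (scoeff P0 n) l \<noteq> 0" using sval_eq_iff[OF val n_in] l by simp
  have symb: "symb N l P0 = G * F"
    using G(1) char_poly_eq_symb[OF q0, of P \<mu>] unfolding F by (simp add: P0_def N_def l_def)
  have P0_over: "P0 \<in> skew_over (germ_field A)" unfolding P0_def by (rule skew_over_twist[OF P(1)])
  have nonres: "sorted_wrt (\<lambda>x y. \<forall>k::nat. k \<ge> 1 \<longrightarrow> c (fst x) \<noteq> c (fst y) * q ^ k) xs"
    unfolding xs_def
  proof (rule sorted_wrt_mono_rel[OF _ sorted_factor_indices])
    fix x y assume xy: "x \<in> set (factor_indices p m)" "y \<in> set (factor_indices p m)" "fst x \<le> fst y"
    hence "fst x \<in> {1..p}" "fst y \<in> {1..p}" by (auto simp: set_factor_indices)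
    thus "\<forall>k::nat. k \<ge> 1 \<longrightarrow> c (fst x) \<noteq> c (fst y) * q ^ k"
      using ord xy(3) by (meson leD)
  qed
  have xs_fst: "fst x \<in> {1..p}" if "x \<in> set xs" for x
    using that by (auto simp: xs_def set_factor_indices)
  have "\<exists>Q u. (\<forall>x\<in>set xs. fps_nth (u x) 0 = 1 \<and> fps_to_fls (u x) \<in> germ_field A) \<and>
     P0 = skew_mult q Q (chain q (\<lambda>x. c (fst x)) u xs) \<and> Q \<in> skew_over (germ_field A) \<and> val_ge l Q \<and>
     Poly_Mapping.keys Q \<subseteq> {N..} \<and> symb N l Q = G \<and>
     (\<forall>Q' u'. (\<forall>x\<in>set xs. fps_nth (u' x) 0 = 1) \<and> P0 = skew_mult q Q' (chain q (\<lambda>x. c (fst x)) u' xs) \<longrightarrow>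
        Q' = Q \<and> (\<forall>x\<in>set xs. u' x = u x))"
    by (rule chain_factorization[OF q A _ _ nonres _ P0_over val keys top symb[unfolded F_def]])
       (use xs_fst c G(2) distinct_factor_indices in \<open>auto simp: xs_def\<close>)
  then obtain Q0 w where w: "\<forall>x\<in>set xs. fps_nth (w x) 0 = 1" "\<forall>x\<in>set xs. fps_to_fls (w x) \<in> germ_field A"
     and Q0: "P0 = skew_mult q Q0 (chain q (\<lambda>x. c (fst x)) w xs)" "Q0 \<in> skew_over (germ_field A)"
       "val_ge l Q0" "Poly_Mapping.keys Q0 \<subseteq> {N..}" "symb N l Q0 = G"
     and uniq: "\<And>Q' u'. \<forall>x\<in>set xs. fps_nth (u' x) 0 = 1 \<Longrightarrow>
        P0 = skew_mult q Q' (chain q (\<lambda>x. c (fst x)) u' xs) \<Longrightarrow> Q' = Q0 \<and> (\<forall>x\<in>set xs. u' x = w x)"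
    by blast
  define u where "u = (\<lambda>i j. w (i, j))"
  define Q where "Q = twist q (- \<mu>) Q0"
  define R where "R = right_factor q \<mu> p c m u"
  have twQ: "twist q \<mu> Q = Q0" unfolding Q_def by (rule twist_twist_minus[OF q0])
  have tw_right: "twist q \<mu> (right_factor q \<mu> p c m v) = chain q (\<lambda>x. c (fst x)) (\<lambda>x. v (fst x) (snd x)) xs" for v
    unfolding twist_right_factor[OF q0] right_factor_eq_chain[OF q0] xs_def ..
  have twR: "twist q \<mu> R = chain q (\<lambda>x. c (fst x)) w xs"
    unfolding R_def tw_right by (simp add: u_def)
  have set_xs: "set xs = {(i, j). i \<in> {1..p} \<and> j \<in> {1..m i}}"
    unfolding xs_def by (rule set_factor_indices)
  have R_over: "R \<in> skew_over (germ_field A)"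
  proof -
    have "twist q (- \<mu>) (twist q \<mu> R) \<in> skew_over (germ_field A)"
      unfolding twR by (intro skew_over_twist skew_over_chain[OF q0 A w(2)])
    thus ?thesis using twist_twist_minus[OF q0, of "- \<mu>" R] by simp
  qed
  have fact: "factorization q \<mu> P p c m Q R u"
    unfolding factorization_def skew_mult_eq_iff_twist[OF q0, of P Q R \<mu>] twQ twR
    using Q0(1) w(1) by (auto simp: P0_def R_def u_def set_xs)
  have unique: "Q' = Q \<and> R' = R \<and> (\<forall>i\<in>{1..p}. \<forall>j\<in>{1..m i}. u' i j = u i j)"
    if f: "factorization q \<mu> P p c m Q' R' u'" for Q' R' u'
  proof -
    have f': "P = skew_mult q Q' R'" "R' = right_factor q \<mu> p c m u'"
      "\<forall>i\<in>{1..p}. \<forall>j\<in>{1..m i}. fps_nth (u' i j) 0 = 1"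
      using f by (auto simp: factorization_def)
    have twR': "twist q \<mu> R' = chain q (\<lambda>x. c (fst x)) (\<lambda>x. u' (fst x) (snd x)) xs"
      unfolding f'(2) by (rule tw_right)
    have P0': "P0 = skew_mult q (twist q \<mu> Q') (chain q (\<lambda>x. c (fst x)) (\<lambda>x. u' (fst x) (snd x)) xs)"
      unfolding P0_def twR'[symmetric] using skew_mult_eq_iff_twist[OF q0] f'(1) by blast
    have "\<forall>x\<in>set xs. fps_nth (u' (fst x) (snd x)) 0 = 1" using f'(3) by (auto simp: set_xs)
    from uniq[OF this P0'] have *: "twist q \<mu> Q' = Q0" "\<forall>x\<in>set xs. u' (fst x) (snd x) = w x"
      by simp_all
    have "Q' = Q" unfolding Q_def *(1)[symmetric] using twist_twist_minus[OF q0, of "- \<mu>" Q'] by simp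
    moreover have "twist q \<mu> R' = twist q \<mu> R"
      unfolding twR' twR by (rule chain_cong) (use *(2) in auto)
    hence "R' = R" by (metis twist_twist_minus[OF q0] minus_minus)
    ultimately show ?thesis using *(2) by (auto simp: set_xs u_def)
  qed
  have conv: "convergent_factorization (germ_field A) p m Q R u"
    unfolding convergent_factorization_def
    using R_over skew_over_twist[OF Q0(2), of q "- \<mu>"] w(2) by (auto simp: Q_def u_def set_xs)
  define M where "M = (\<Sum>i=1..p. m i)"
  have len: "length xs = M" by (simp add: xs_def M_def length_factor_indices)
  have R0: "val_ge 0 (twist q \<mu> R)" "Poly_Mapping.keys R \<subseteq> {0..int M}" "symb 0 0 (twist q \<mu> R) = F"
    using chain_properties[OF q0 w(1), of "\<lambda>x. c (fst x)"] keys_twist[OF q0, of \<mu> R]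
    unfolding twR[symmetric] F_def len by auto
  have coeffF: "coeff F k = fls_nth (scoeff (twist q \<mu> R) (int k)) 0" for k
    unfolding R0(3)[symmetric] by (subst coeff_symb) (use R0(2) q0 in auto)
  \<comment> \<open>F has leading coefficient 1 and, all c_i being non-zero, a non-zero constant
    term. This puts the indices 0 and M of R on the supporting line of slope \<mu>, so its polygon
    has no other slope.\<close>
  have "degree F = M \<and> lead_coeff F = 1"
    unfolding F_def len[symmetric] by (rule monic_prod_linear)
  hence "coeff F M = 1" by auto
  hence R_top: "fls_nth (scoeff (twist q \<mu> R) (int M)) 0 \<noteq> 0" using coeffF[of M] by simp
  have "poly F 0 \<noteq> 0" unfolding F_def poly_prod_linear_eq_0_iff using c xs_fst by metis
  hence R_bot: "fls_nth (scoeff (twist q \<mu> R) 0) 0 \<noteq> 0" using coeffF[of 0] by (simp add: poly_0_coeff_0)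
  have in_keys: "int M \<in> Poly_Mapping.keys R" "0 \<in> Poly_Mapping.keys R"
    using R_top R_bot keys_twist[OF q0, of \<mu> R] by (auto simp: in_keys_iff)
  have svalR: "sval R i - \<mu> * i \<ge> 0" "sval R i - \<mu> * i = 0 \<longleftrightarrow> fls_nth (scoeff (twist q \<mu> R) i) 0 \<noteq> 0"
    if "i \<in> Poly_Mapping.keys R" for i
    using val_geD_sval[OF R0(1), of i] sval_eq_iff[OF R0(1), of i] that q0 by (auto simp: sval_twist)
  have "newton_vectors R = (if M = 0 then {} else {(M, \<mu> * int M)})"
  proof (rule newton_vectors_single_slope[OF R0(2) in_keys(2,1)])
    show "0 \<le> sval R i - \<mu> * i" if "i \<in> Poly_Mapping.keys R" for i by (rule svalR(1)[OF that])
    show "sval R 0 = 0" using svalR(2)[OF in_keys(2)] R_bot by simp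
    show "sval R (int M) = 0 + \<mu> * int M" using svalR(2)[OF in_keys(1)] R_top by simp
  qed
  hence newton: "newton_function R = (\<lambda>\<nu>. if \<nu> = of_int \<mu> then M else 0)"
    by (rule newton_function_single_slope)
  have "Min (Poly_Mapping.keys R) = 0"
    by (rule Min_eqI) (use in_keys R0(2) in auto)
  moreover have "twisted_val q R \<mu> = 0" by (rule twisted_val_eqI[OF q0 R0(1) R_bot])
  ultimately have "char_poly q R \<mu> = F" using char_poly_eq_symb[OF q0, of R \<mu>] R0(3) by simp
  hence assoc: "laurent_associated (char_poly q R \<mu>) (\<Prod>i=1..p. [:- c i, 1:] ^ m i)"
    unfolding laurent_associated_def F by (intro exI[of _ 1] exI[of _ 0]) simp
  have keysQ: "Poly_Mapping.keys Q \<subseteq> {N..}"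
    using Q0(4) keys_twist[OF q0, of \<mu> Q] unfolding twQ by simp
  have unique': "\<forall>Q' R' u'. factorization q \<mu> P p c m Q' R' u' \<longrightarrow>
      Q' = Q \<and> R' = R \<and> (\<forall>i\<in>{1..p}. \<forall>j\<in>{1..m i}. u' i j = u i j)"
    using unique by blast
  show ?thesis
    unfolding N_def[symmetric] l_def[symmetric] M_def[symmetric]
    by (rule exI[of _ Q], rule exI[of _ R], rule exI[of _ u], unfold twQ,
        intro conjI[OF fact] conjI[OF unique'] conjI[OF conv] conjI[OF newton] conjI[OF assoc]
          conjI[OF Q0(3)] conjI[OF keysQ] Q0(5))
qed

text \<open>After removal of the full power of s no root is left, so the cofactor is constant. For
  part (a) this says that the lowest layer of Q has a single term.\<close>

lemma poly_without_nonzero_roots: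
  fixes G :: "complex poly"
  assumes "G \<noteq> 0" "\<And>e. e \<noteq> 0 \<Longrightarrow> poly G e \<noteq> 0"
  shows "\<exists>k. \<forall>j. coeff G j \<noteq> 0 \<longleftrightarrow> j = k"
proof -
  obtain H where H: "G = [:- 0, 1:] ^ order 0 G * H" "\<not> [:- 0, 1:] dvd H"
    using order_decomp[OF assms(1), of 0] by blast
  have nz: "poly H e \<noteq> 0" for e
  proof (cases "e = 0")
    case True
    thus ?thesis using H(2) by (simp add: poly_eq_0_iff_dvd)
  next
    case False
    thus ?thesis using assms(2)[OF False] by (subst (asm) H(1)) auto
  qed
  then obtain a where a: "a \<noteq> 0" "H = [:a:]"
    using fundamental_theorem_of_algebra_alt[of H] by auto
  have "G = monom a (order 0 G)"
    by (subst H(1)) (simp add: a(2) monom_altdef)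
  hence "coeff G j = (if order 0 G = j then a else 0)" for j by (metis coeff_monom)
  thus ?thesis using a(1) by auto
qed

subsection \<open>The function \<open>\<epsilon>\<close>\<close>

text \<open>With d = c / q^k the condition only involves norms; it says that k is the integer part
  of the logarithm of |c| to base |q|.\<close>

lemma q_exponent_aux:
  fixes q c :: complex
  assumes q: "norm q > 1" and c: "c \<noteq> 0"
  shows "(\<exists>d. c = q powi k * d \<and> 1 \<le> norm d \<and> norm d < norm q) \<longleftrightarrow>
    norm q powi k \<le> norm c \<and> norm c < norm q powi (k + 1)"
proof -
  have q0: "q \<noteq> 0" and pos: "norm q powi k > 0" using q by (auto intro!: zero_less_power_int)
  have "(\<exists>d. c = q powi k * d \<and> 1 \<le> norm d \<and> norm d < norm q) \<longleftrightarrow>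
      1 \<le> norm (c / q powi k) \<and> norm (c / q powi k) < norm q"
    using q0 by (auto intro!: exI[of _ "c / q powi k"])
  also have "\<dots> \<longleftrightarrow> norm q powi k \<le> norm c \<and> norm c < norm q powi (k + 1)"
    using pos q0 by (simp add: norm_divide norm_power_int power_int_add field_simps)
  finally show ?thesis .
qed

lemma q_exponent_bounds_unique:
  fixes x y :: real
  assumes x: "x > 1" and 1: "x powi k \<le> y" "y < x powi (k + 1)" and 2: "x powi k' \<le> y" "y < x powi (k' + 1)"
  shows "k = k'"
proof (rule ccontr)
  assume "k \<noteq> k'"
  then consider "k + 1 \<le> k'" | "k' + 1 \<le> k" by linarith
  thus False
  proof cases
    case 1
    hence "x powi (k + 1) \<le> x powi k'" using x by (intro power_int_increasing) auto
    thus False using assms by linarith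
  next
    case 2
    hence "x powi (k' + 1) \<le> x powi k" using x by (intro power_int_increasing) auto
    thus False using assms by linarith
  qed
qed

lemma q_exponent_eqI:
  assumes q: "norm q > 1" and c: "c \<noteq> 0" and k: "norm q powi k \<le> norm c" "norm c < norm q powi (k + 1)"
  shows "q_exponent q c = k"
  unfolding q_exponent_def q_exponent_aux[OF q c]
  by (rule the_equality) (use k q_exponent_bounds_unique[OF q] in auto)

lemma q_exponent_bounds:
  assumes q: "norm q > 1" and c: "c \<noteq> 0"
  shows "norm q powi (q_exponent q c) \<le> norm c" "norm c < norm q powi (q_exponent q c + 1)"
proof -
  define k where "k = \<lfloor>log (norm q) (norm c)\<rfloor>"
  have powr: "norm q powi j = norm q powr (real_of_int j)" for j
    using q by (intro powr_real_of_int'[symmetric]) auto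
  have "norm q powr (log (norm q) (norm c)) = norm c" using q c by (intro powr_log_cancel) auto
  moreover have "norm q powr (real_of_int k) \<le> norm q powr (log (norm q) (norm c))"
    using q by (intro powr_mono) (auto simp: k_def)
  moreover have "norm q powr (log (norm q) (norm c)) < norm q powr (real_of_int (k + 1))"
    using q by (intro powr_less_mono) (auto simp: k_def)
  ultimately have k: "norm q powi k \<le> norm c" "norm c < norm q powi (k + 1)"
    unfolding powr by auto
  thus "norm q powi (q_exponent q c) \<le> norm c" "norm c < norm q powi (q_exponent q c + 1)"
    using q_exponent_eqI[OF q c k] by auto
qed

text \<open>Turns the ordering by \<epsilon> in part (b) into the ordering by quotients q^l used in
  part (a).\<close>

lemma q_exponent_mult_power:
  assumes q: "norm q > 1" and c: "c \<noteq> 0"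
  shows "q_exponent q (c * q ^ l) = q_exponent q c + int l"
proof (rule q_exponent_eqI[OF q])
  have q0: "norm q \<noteq> 0" using q by auto
  hence pos: "norm q ^ l > 0" by simp
  have "norm q powi (q_exponent q c + int l) = norm q powi (q_exponent q c) * norm q ^ l"
    "norm q powi (q_exponent q c + int l + 1) = norm q powi (q_exponent q c + 1) * norm q ^ l"
    using q0 by (simp_all add: power_int_add)
  thus "norm q powi (q_exponent q c + int l) \<le> norm (c * q ^ l)"
    "norm (c * q ^ l) < norm q powi (q_exponent q c + int l + 1)"
    using q_exponent_bounds[OF q c] pos by (simp_all add: norm_mult norm_power)
qed (use c q in auto)

lemma q_congruent_trans:
  "q \<noteq> 0 \<Longrightarrow> q_congruent q a b \<Longrightarrow> q_congruent q b c \<Longrightarrow> q_congruent q a c"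
  unfolding q_congruent_def by (metis power_int_add mult.assoc)

lemma q_congruent_mult_power: "q_congruent q (c * q ^ k) c"
  unfolding q_congruent_def by (intro exI[of _ "int k"]) (simp add: mult.commute)

lemma char_poly_nonzero:
  assumes "q \<noteq> 0" "P \<noteq> 0"
  shows "char_poly q P \<mu> \<noteq> 0"
proof -
  let ?K = "Poly_Mapping.keys P" and ?P = "twist q \<mu> P" and ?l = "twisted_val q P \<mu>"
  have ne: "?K \<noteq> {}" using assms(2) by simp
  have "?l \<in> (\<lambda>i. sval ?P i) ` ?K"
    unfolding twisted_val_eq[OF assms(1)] using ne by (intro Min_in) auto
  then obtain i where i: "i \<in> ?K" "sval ?P i = ?l" by auto
  have "i \<in> Poly_Mapping.keys ?P" using i(1) assms(1) by simp
  hence "scoeff ?P i \<noteq> 0" by (simp only: in_keys_iff not_False_eq_True)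
  from nth_fls_subdegree_nonzero[OF this] have "fls_nth (scoeff ?P i) ?l \<noteq> 0" unfolding i(2) .
  moreover have "i = Min ?K + int (nat (i - Min ?K))" using i(1) by simp
  ultimately have "coeff (char_poly q P \<mu>) (nat (i - Min ?K)) \<noteq> 0"
    unfolding char_poly_eq_symb[OF assms(1)]
    by (subst coeff_symb) (use keys_ge_Min assms(1) in auto)
  thus ?thesis by auto
qed

theorem mainTheorem1:
  fixes q :: complex and K :: "complex fls set" and P :: skew and \<mu> :: int
  assumes q: "norm q > 1"
    and K: "K = meromorphic_functions \<or> K = convergent_germs"
    and P: "P \<in> skew_over K" "P \<noteq> 0"
    and \<mu>: "last_slope P (of_int \<mu>)"
  shows
    "(\<forall>(p::nat) (c :: nat \<Rightarrow> complex) (m :: nat \<Rightarrow> nat).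
        bij_betw c {1..p} (exponents q P \<mu>) \<and>
        (\<forall>i\<in>{1..p}. m i = order (c i) (char_poly q P \<mu>)) \<and>
        (\<forall>i\<in>{1..p}. \<forall>j\<in>{1..p}. \<forall>l::nat. l \<ge> 1 \<and> c j / c i = q ^ l \<longrightarrow> i < j) \<longrightarrow>
        (\<exists>Q R u.
           factorization q \<mu> P p c m Q R u \<and>
           convergent_factorization K p m Q R u \<and>
           of_int \<mu> \<notin> slopes Q \<and>
           newton_function R = (\<lambda>\<nu>. if \<nu> = of_int \<mu> then \<Sum>i=1..p. m i else 0) \<and>
           laurent_associated (char_poly q R \<mu>) (\<Prod>i=1..p. [:- c i, 1:] ^ m i)))
     \<and>
     (\<forall>(a::complex) (p::nat) (c :: nat \<Rightarrow> complex) (m :: nat \<Rightarrow> nat).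
        a \<noteq> 0 \<and>
        bij_betw c {1..p} {e \<in> exponents q P \<mu>. q_congruent q e a} \<and>
        (\<forall>i\<in>{1..p}. m i = order (c i) (char_poly q P \<mu>)) \<and>
        strict_mono_on {1..p} (\<lambda>i. q_exponent q (c i)) \<longrightarrow>
        (\<exists>Q R u.
           (factorization q \<mu> P p c m Q R u \<and>
            (\<forall>e\<in>exponents q Q \<mu>. \<forall>i\<in>{1..p}. \<not> q_congruent q e (c i))) \<and>
           (\<forall>Q' R' u'.
              factorization q \<mu> P p c m Q' R' u' \<and>
              (\<forall>e\<in>exponents q Q' \<mu>. \<forall>i\<in>{1..p}. \<not> q_congruent q e (c i)) \<longrightarrow>
              Q' = Q \<and> R' = R \<and> (\<forall>i\<in>{1..p}. \<forall>j\<in>{1..m i}. u' i j = u i j)) \<and>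
           convergent_factorization K p m Q R u \<and>
           newton_function R = (\<lambda>\<nu>. if \<nu> = of_int \<mu> then \<Sum>i=1..p. m i else 0) \<and>
           laurent_associated (char_poly q R \<mu>) (\<Prod>i=1..p. [:- c i, 1:] ^ m i)))"
proof -
  have q0: "q \<noteq> 0" using q by auto
  obtain A where A: "A = {} \<or> A = UNIV" and KA: "K = germ_field A"
    using K convergent_germs_eq meromorphic_functions_eq by blast
  have P_over: "P \<in> skew_over (germ_field A)" using P(1) KA by simp
  have last: "\<forall>\<nu>\<in>slopes P. \<nu> \<le> of_int \<mu>" using \<mu> by (simp add: last_slope_def)
  have cp: "char_poly q P \<mu> \<noteq> 0" by (rule char_poly_nonzero[OF q0 P(2)])
  let ?N = "Min (Poly_Mapping.keys P)" and ?l = "twisted_val q P \<mu>"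
  have part_a: "\<exists>Q R u. factorization q \<mu> P p c m Q R u \<and> convergent_factorization K p m Q R u \<and>
      of_int \<mu> \<notin> slopes Q \<and>
      newton_function R = (\<lambda>\<nu>. if \<nu> = of_int \<mu> then \<Sum>i=1..p. m i else 0) \<and>
      laurent_associated (char_poly q R \<mu>) (\<Prod>i=1..p. [:- c i, 1:] ^ m i)"
    if c: "bij_betw c {1..p} (exponents q P \<mu>)" and m: "\<forall>i\<in>{1..p}. m i = order (c i) (char_poly q P \<mu>)"
      and ord: "\<forall>i\<in>{1..p}. \<forall>j\<in>{1..p}. \<forall>l::nat. l \<ge> 1 \<and> c j / c i = q ^ l \<longrightarrow> i < j"
    for p :: nat and c :: "nat \<Rightarrow> complex" and m :: "nat \<Rightarrow> nat"
  proof -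
    have c0: "c i \<noteq> 0" if "i \<in> {1..p}" for i
      using bij_betwE[OF c] that by (auto simp: exponents_def)
    obtain G where G: "char_poly q P \<mu> = G * (\<Prod>i=1..p. [:- c i, 1:] ^ m i)"
      "\<forall>i\<in>{1..p}. poly G (c i) \<noteq> 0"
      using split_off_roots[OF cp, of "{1..p}" c] bij_betw_imp_inj_on[OF c] m by auto
    have no_root: "poly G e \<noteq> 0" if "e \<noteq> 0" for e
    proof
      assume "poly G e = 0"
      hence "e \<in> exponents q P \<mu>" using that G(1) by (simp add: exponents_def)
      then obtain i where "i \<in> {1..p}" "e = c i"
        using bij_betw_imp_surj_on[OF c] by blast
      thus False using G(2) \<open>poly G e = 0\<close> by blast
    qed
    have ord': "\<forall>i\<in>{1..p}. \<forall>j\<in>{1..p}. \<forall>l::nat. l \<ge> 1 \<and> c j = c i * q ^ l \<longrightarrow> i < j"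
    proof (intro ballI allI impI)
      fix i j l assume ij: "i \<in> {1..p}" "j \<in> {1..p}" and l: "(l::nat) \<ge> 1 \<and> c j = c i * q ^ l"
      have "c j / c i = q ^ l" using l c0[OF ij(1)] by simp
      thus "i < j" using ord ij l by blast
    qed
    have nonres: "\<forall>i\<in>{1..p}. \<forall>k::nat. k \<ge> 1 \<longrightarrow> poly G (c i * q ^ k) \<noteq> 0"
      using no_root c0 q0 by simp
    obtain Q R u where *: "factorization q \<mu> P p c m Q R u" "convergent_factorization K p m Q R u"
      "newton_function R = (\<lambda>\<nu>. if \<nu> = of_int \<mu> then \<Sum>i=1..p. m i else 0)"
      "laurent_associated (char_poly q R \<mu>) (\<Prod>i=1..p. [:- c i, 1:] ^ m i)"
      and Q: "val_ge ?l (twist q \<mu> Q)" "Poly_Mapping.keys Q \<subseteq> {?N..}" "symb ?N ?l (twist q \<mu> Q) = G"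
      using exponent_factorization[OF q A P_over P(2) last _ ord' G(1) nonres] c0 KA by blast
    have "G \<noteq> 0" using G(1) cp by auto
    then obtain k where k: "\<And>j. coeff G j \<noteq> 0 \<longleftrightarrow> j = k"
      using poly_without_nonzero_roots[OF _ no_root] by blast
    have keysQ: "Poly_Mapping.keys (twist q \<mu> Q) = Poly_Mapping.keys Q" using q0 by simp
    have coeffG: "coeff G j = fls_nth (scoeff (twist q \<mu> Q) (?N + int j)) ?l" for j
      unfolding Q(3)[symmetric] by (rule coeff_symb) (use Q(2) keysQ in simp)
    \<comment> \<open>The lowest layer of Q is the monomial G, so the line of slope \<mu> touches
      the polygon of Q over the single index \<open>?N + int k\<close>.\<close>
    have sval: "?l \<le> sval Q i - \<mu> * i" "sval Q i - \<mu> * i = ?l \<longleftrightarrow> i = ?N + int k"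
      if i: "i \<in> Poly_Mapping.keys Q" for i
    proof -
      have i': "i \<in> Poly_Mapping.keys (twist q \<mu> Q)" using i keysQ by simp
      show "?l \<le> sval Q i - \<mu> * i"
        using val_geD_sval[OF Q(1) i'] sval_twist[OF q0 i] by simp
      have j: "i = ?N + int (nat (i - ?N))" using i Q(2) by auto
      have "sval Q i - \<mu> * i = ?l \<longleftrightarrow> fls_nth (scoeff (twist q \<mu> Q) i) ?l \<noteq> 0"
        using sval_eq_iff[OF Q(1) i'] sval_twist[OF q0 i] by simp
      also have "\<dots> \<longleftrightarrow> nat (i - ?N) = k" using k[of "nat (i - ?N)"] coeffG[of "nat (i - ?N)"] j by simp
      also have "\<dots> \<longleftrightarrow> i = ?N + int k" using j by linarith
      finally show "sval Q i - \<mu> * i = ?l \<longleftrightarrow> i = ?N + int k" .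
    qed
    have "fls_nth (scoeff (twist q \<mu> Q) (?N + int k)) ?l \<noteq> 0" using k[of k] coeffG[of k] by simp
    hence "scoeff (twist q \<mu> Q) (?N + int k) \<noteq> 0" by auto
    hence "?N + int k \<in> Poly_Mapping.keys Q" using keysQ by (simp add: in_keys_iff set_eq_iff)
    hence "of_int \<mu> \<notin> slopes Q"
      by (intro slope_not_in_slopes[where \<kappa> = ?l and ?i0.0 = "?N + int k"]) (use sval in auto)
    thus ?thesis using * by blast
  qed
  have part_b: "\<exists>Q R u.
      (factorization q \<mu> P p c m Q R u \<and>
       (\<forall>e\<in>exponents q Q \<mu>. \<forall>i\<in>{1..p}. \<not> q_congruent q e (c i))) \<and>
      (\<forall>Q' R' u'.
         factorization q \<mu> P p c m Q' R' u' \<and>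
         (\<forall>e\<in>exponents q Q' \<mu>. \<forall>i\<in>{1..p}. \<not> q_congruent q e (c i)) \<longrightarrow>
         Q' = Q \<and> R' = R \<and> (\<forall>i\<in>{1..p}. \<forall>j\<in>{1..m i}. u' i j = u i j)) \<and>
      convergent_factorization K p m Q R u \<and>
      newton_function R = (\<lambda>\<nu>. if \<nu> = of_int \<mu> then \<Sum>i=1..p. m i else 0) \<and>
      laurent_associated (char_poly q R \<mu>) (\<Prod>i=1..p. [:- c i, 1:] ^ m i)"
    if c: "bij_betw c {1..p} {e \<in> exponents q P \<mu>. q_congruent q e a}"
      and m: "\<forall>i\<in>{1..p}. m i = order (c i) (char_poly q P \<mu>)"
      and mono: "strict_mono_on {1..p} (\<lambda>i. q_exponent q (c i))"
    for a :: complex and p :: nat and c :: "nat \<Rightarrow> complex" and m :: "nat \<Rightarrow> nat"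
  proof -
    have c0: "c i \<noteq> 0" and ca: "q_congruent q (c i) a" if "i \<in> {1..p}" for i
      using bij_betwE[OF c] that by (auto simp: exponents_def)
    obtain G where G: "char_poly q P \<mu> = G * (\<Prod>i=1..p. [:- c i, 1:] ^ m i)"
      "\<forall>i\<in>{1..p}. poly G (c i) \<noteq> 0"
      using split_off_roots[OF cp, of "{1..p}" c] bij_betw_imp_inj_on[OF c] m by auto
    \<comment> \<open>A non-zero root of G congruent to some c_i lies in the class of a, hence is
      one of the c_j; but G does not vanish there, since the full multiplicity was split
      off.\<close>
    have no_root: "poly G e \<noteq> 0" if e: "e \<noteq> 0" "q_congruent q e (c i)" "i \<in> {1..p}" for e i
    proof
      assume root: "poly G e = 0"
      have "q_congruent q e a" by (rule q_congruent_trans[OF q0 e(2) ca[OF e(3)]])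
      hence "e \<in> {e \<in> exponents q P \<mu>. q_congruent q e a}"
        using e(1) root G(1) by (simp add: exponents_def)
      then obtain j where "j \<in> {1..p}" "e = c j"
        using bij_betw_imp_surj_on[OF c] by blast
      thus False using G(2) root by blast
    qed
    have ord: "\<forall>i\<in>{1..p}. \<forall>j\<in>{1..p}. \<forall>l::nat. l \<ge> 1 \<and> c j = c i * q ^ l \<longrightarrow> i < j"
    proof (intro ballI allI impI)
      fix i j l assume ij: "i \<in> {1..p}" "j \<in> {1..p}" and l: "(l::nat) \<ge> 1 \<and> c j = c i * q ^ l"
      have "q_exponent q (c i) < q_exponent q (c j)"
        using q_exponent_mult_power[OF q c0[OF ij(1)], of l] l by simp
      thus "i < j" using strict_mono_onD[OF mono ij(2,1)] by (metis less_asym' linorder_neqE_nat)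
    qed
    have nonres: "\<forall>i\<in>{1..p}. \<forall>k::nat. k \<ge> 1 \<longrightarrow> poly G (c i * q ^ k) \<noteq> 0"
    proof (intro ballI allI impI)
      fix i k assume i: "i \<in> {1..p}"
      show "poly G (c i * q ^ k) \<noteq> 0"
        by (rule no_root[OF _ q_congruent_mult_power i]) (use c0[OF i] q0 in simp)
    qed
    obtain Q R u where *: "factorization q \<mu> P p c m Q R u" "convergent_factorization K p m Q R u"
      "\<forall>Q' R' u'. factorization q \<mu> P p c m Q' R' u' \<longrightarrow>
         Q' = Q \<and> R' = R \<and> (\<forall>i\<in>{1..p}. \<forall>j\<in>{1..m i}. u' i j = u i j)"
      "newton_function R = (\<lambda>\<nu>. if \<nu> = of_int \<mu> then \<Sum>i=1..p. m i else 0)"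
      "laurent_associated (char_poly q R \<mu>) (\<Prod>i=1..p. [:- c i, 1:] ^ m i)"
      and Q: "val_ge ?l (twist q \<mu> Q)" "Poly_Mapping.keys Q \<subseteq> {?N..}" "symb ?N ?l (twist q \<mu> Q) = G"
      using exponent_factorization[OF q A P_over P(2) last _ ord G(1) nonres] c0 KA by blast
    have "G \<noteq> 0" using G(1) cp by auto
    hence "G = monom 1 (nat (Min (Poly_Mapping.keys Q) - ?N)) * char_poly q Q \<mu>"
      using symb_eq_monom_char_poly[OF q0 Q(1,2)] Q(3) by simp
    hence root: "e \<noteq> 0 \<and> poly G e = 0" if "e \<in> exponents q Q \<mu>" for e
      using that by (simp add: exponents_def)
    have "\<forall>e\<in>exponents q Q \<mu>. \<forall>i\<in>{1..p}. \<not> q_congruent q e (c i)"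
      using root no_root by blast
    thus ?thesis using * by blast
  qed
  show ?thesis
  proof (rule conjI)
    show "\<forall>(p::nat) (c :: nat \<Rightarrow> complex) (m :: nat \<Rightarrow> nat).
        bij_betw c {1..p} (exponents q P \<mu>) \<and>
        (\<forall>i\<in>{1..p}. m i = order (c i) (char_poly q P \<mu>)) \<and>
        (\<forall>i\<in>{1..p}. \<forall>j\<in>{1..p}. \<forall>l::nat. l \<ge> 1 \<and> c j / c i = q ^ l \<longrightarrow> i < j) \<longrightarrow>
        (\<exists>Q R u.
           factorization q \<mu> P p c m Q R u \<and>
           convergent_factorization K p m Q R u \<and>
           of_int \<mu> \<notin> slopes Q \<and>
           newton_function R = (\<lambda>\<nu>. if \<nu> = of_int \<mu> then \<Sum>i=1..p. m i else 0) \<and>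
           laurent_associated (char_poly q R \<mu>) (\<Prod>i=1..p. [:- c i, 1:] ^ m i))"
      by (intro allI impI, elim conjE, rule part_a)
  qed (intro allI impI, elim conjE, rule part_b)
qed

end
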